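(* As a $\Bbbk$-linear (strict) monoidal category, the oriented Brauer category $\mathcal{OB}$ is generated by the objects $\uparrow,\downarrow$ and the morphisms $c:\varnothing\to\uparrow\downarrow$, $d:\downarrow\uparrow\to\varnothing$, $s:\uparrow\uparrow\to\uparrow\uparrow$, subject only to the relations (1) $(\uparrow d)\circ(c\uparrow)=\uparrow$; (2) $(d\downarrow)\circ(\downarrow c)=\downarrow$; (3) $s^2=\uparrow\uparrow$; (4) $(\uparrow s)\circ(s\uparrow)\circ(\uparrow s)=(s\uparrow)\circ(\uparrow s)\circ(s\uparrow)$; (5) $(d\uparrow\downarrow)\circ(\downarrow s\downarrow)\circ(\downarrow\uparrow c)$ is invertible.
   Context: $\Bbbk$ is a fixed integral domain; all categories and functors are $\Bbbk$-linear. In a monoidal category, $gh$ denotes $g\otimes h$, and an object also denotes its identity morphism. $\langle\uparrow,\downarrow\rangle$ is the set of all words in the letters $\uparrow,\downarrow$, including the empty word $\varnothing$. For words $\mathsf a,\mathsf b$, an oriented Brauer diagram of type $\mathsf a\to\mathsf b$ is a picture (with the letters of $\mathsf a$ along the bottom edge and the letters of $\mathsf b$ along the top edge) representing a bijection from $\{\text{positions of }\uparrow\text{ in }\mathsf a\}\sqcup\{\text{positions of }\downarrow\text{ in }\mathsf b\}$ onto $\{\text{positions of }\uparrow\text{ in }\mathsf b\}\sqcup\{\text{positions of }\downarrow\text{ in }\mathsf a\}$, each matched pair being joined by a strand oriented from the first set to the second. Two such diagrams are equivalent if they are of the same type and represent the same bijection. An oriented Brauer diagram with bubbles is such a diagram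 together with finitely many closed loops (bubbles); two are equivalent if the underlying diagrams without bubbles are equivalent and the numbers of bubbles agree (regardless of orientation). The oriented Brauer category $\mathcal{OB}$ has object set $\langle\uparrow,\downarrow\rangle$; $\mathrm{Hom}_{\mathcal{OB}}(\mathsf a,\mathsf b)$ is the free $\Bbbk$-module on the equivalence classes of oriented Brauer diagrams with bubbles of type $\mathsf a\to\mathsf b$. Composition $g\circ h$ is vertical stacking of $g$ on top of $h$ (closed loops created become bubbles); the tensor product $g\otimes h$ is horizontal stacking of $g$ to the left of $h$ (concatenation of words on objects), with unit object $\varnothing$. The morphism $c$ is the diagram with one strand (a cup), $d$ is the diagram with one strand (a cap), and $s$ is the crossing of two upward strands. Relation (5) means that there is a further generator $t:\uparrow\downarrow\to\downarrow\uparrow$ which is a two-sided inverse of the displayed morphism. *)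

theory Defs
  imports "HOL-Algebra.Module" "HOL-Library.Poly_Mapping"
begin

section \<open>Strict linear monoidal categories\<close>

definition scalars :: "'k::idom ring" where
  "scalars = \<lparr>carrier = UNIV, mult = (*), one = 1, zero = 0, add = (+)\<rparr>"

text \<open>
  Hom-sets are not required to be disjoint, so the operations on morphisms take the objects
  involved as arguments: for \<open>f : a \<rightarrow> b\<close>, \<open>g : b \<rightarrow> c\<close> the composite of \<open>g\<close> after \<open>f\<close> is
  \<open>Cmp C a b c g f\<close>, and for \<open>f : a \<rightarrow> b\<close>, \<open>g : a' \<rightarrow> b'\<close> the tensor product of \<open>f\<close> and \<open>g\<close> is
  \<open>TenM C a b a' b' f g\<close>. The ring-multiplication fields of the module records \<open>Hom C a b\<close>
  play no role.
\<close>

record ('o, 'm, 'k) lmcat =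
  Obj  :: "'o set"
  Hom  :: "'o \<Rightarrow> 'o \<Rightarrow> ('k, 'm) module"
  Idm  :: "'o \<Rightarrow> 'm"
  Cmp  :: "'o \<Rightarrow> 'o \<Rightarrow> 'o \<Rightarrow> 'm \<Rightarrow> 'm \<Rightarrow> 'm"
  Unit :: "'o"
  TenO :: "'o \<Rightarrow> 'o \<Rightarrow> 'o"
  TenM :: "'o \<Rightarrow> 'o \<Rightarrow> 'o \<Rightarrow> 'o \<Rightarrow> 'm \<Rightarrow> 'm \<Rightarrow> 'm"

definition linear_map :: "('k, 'm) module \<Rightarrow> ('k, 'n) module \<Rightarrow> ('m \<Rightarrow> 'n) \<Rightarrow> bool" where
  "linear_map M N h \<longleftrightarrow>
     (\<forall>x \<in> carrier M. h x \<in> carrier N) \<and>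
     (\<forall>x \<in> carrier M. \<forall>y \<in> carrier M. h (x \<oplus>\<^bsub>M\<^esub> y) = h x \<oplus>\<^bsub>N\<^esub> h y) \<and>
     (\<forall>r. \<forall>x \<in> carrier M. h (r \<odot>\<^bsub>M\<^esub> x) = r \<odot>\<^bsub>N\<^esub> h x)"

definition bilinear_map ::
    "('k, 'm) module \<Rightarrow> ('k, 'n) module \<Rightarrow> ('k, 'p) module \<Rightarrow> ('m \<Rightarrow> 'n \<Rightarrow> 'p) \<Rightarrow> bool" where
  "bilinear_map M N P h \<longleftrightarrow>
     (\<forall>x \<in> carrier M. linear_map N P (h x)) \<and>
     (\<forall>y \<in> carrier N. linear_map M P (\<lambda>x. h x y))"

locale strict_linear_monoidal_category =
  fixes C :: "('o, 'm, 'k::idom) lmcat"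
  assumes Hom_module: "\<lbrakk>a \<in> Obj C; b \<in> Obj C\<rbrakk> \<Longrightarrow> Module.module scalars (Hom C a b)"
    and Idm_in_Hom: "a \<in> Obj C \<Longrightarrow> Idm C a \<in> carrier (Hom C a a)"
    and Cmp_bilinear: "\<lbrakk>a \<in> Obj C; b \<in> Obj C; c \<in> Obj C\<rbrakk> \<Longrightarrow>
      bilinear_map (Hom C b c) (Hom C a b) (Hom C a c) (Cmp C a b c)"
    and Idm_left: "\<lbrakk>a \<in> Obj C; b \<in> Obj C; f \<in> carrier (Hom C a b)\<rbrakk> \<Longrightarrow>
      Cmp C a b b (Idm C b) f = f"
    and Idm_right: "\<lbrakk>a \<in> Obj C; b \<in> Obj C; f \<in> carrier (Hom C a b)\<rbrakk> \<Longrightarrow>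
      Cmp C a a b f (Idm C a) = f"
    and Cmp_assoc: "\<lbrakk>a \<in> Obj C; b \<in> Obj C; c \<in> Obj C; d \<in> Obj C; f \<in> carrier (Hom C a b);
      g \<in> carrier (Hom C b c); h \<in> carrier (Hom C c d)\<rbrakk> \<Longrightarrow>
      Cmp C a b d (Cmp C b c d h g) f = Cmp C a c d h (Cmp C a b c g f)"
    and Unit_in_Obj: "Unit C \<in> Obj C"
    and TenO_in_Obj: "\<lbrakk>a \<in> Obj C; b \<in> Obj C\<rbrakk> \<Longrightarrow> TenO C a b \<in> Obj C"
    and TenO_Unit_left: "a \<in> Obj C \<Longrightarrow> TenO C (Unit C) a = a"
    and TenO_Unit_right: "a \<in> Obj C \<Longrightarrow> TenO C a (Unit C) = a"
    and TenO_assoc: "\<lbrakk>a \<in> Obj C; b \<in> Obj C; c \<in> Obj C\<rbrakk> \<Longrightarrow>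
      TenO C (TenO C a b) c = TenO C a (TenO C b c)"
    and TenM_bilinear: "\<lbrakk>a \<in> Obj C; b \<in> Obj C; a' \<in> Obj C; b' \<in> Obj C\<rbrakk> \<Longrightarrow>
      bilinear_map (Hom C a b) (Hom C a' b') (Hom C (TenO C a a') (TenO C b b')) (TenM C a b a' b')"
    and TenM_Idm: "\<lbrakk>a \<in> Obj C; b \<in> Obj C\<rbrakk> \<Longrightarrow>
      TenM C a a b b (Idm C a) (Idm C b) = Idm C (TenO C a b)"
    and TenM_Cmp: "\<lbrakk>a \<in> Obj C; b \<in> Obj C; c \<in> Obj C; a' \<in> Obj C; b' \<in> Obj C; c' \<in> Obj C;
      f \<in> carrier (Hom C a b); g \<in> carrier (Hom C b c);
      f' \<in> carrier (Hom C a' b'); g' \<in> carrier (Hom C b' c')\<rbrakk> \<Longrightarrow>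
      TenM C a c a' c' (Cmp C a b c g f) (Cmp C a' b' c' g' f') =
      Cmp C (TenO C a a') (TenO C b b') (TenO C c c') (TenM C b c b' c' g g') (TenM C a b a' b' f f')"
    and TenM_Unit_left: "\<lbrakk>a \<in> Obj C; b \<in> Obj C; f \<in> carrier (Hom C a b)\<rbrakk> \<Longrightarrow>
      TenM C (Unit C) (Unit C) a b (Idm C (Unit C)) f = f"
    and TenM_Unit_right: "\<lbrakk>a \<in> Obj C; b \<in> Obj C; f \<in> carrier (Hom C a b)\<rbrakk> \<Longrightarrow>
      TenM C a b (Unit C) (Unit C) f (Idm C (Unit C)) = f"
    and TenM_assoc: "\<lbrakk>a \<in> Obj C; b \<in> Obj C; a' \<in> Obj C; b' \<in> Obj C; a'' \<in> Obj C; b'' \<in> Obj C;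
      f \<in> carrier (Hom C a b); f' \<in> carrier (Hom C a' b'); f'' \<in> carrier (Hom C a'' b'')\<rbrakk> \<Longrightarrow>
      TenM C (TenO C a a') (TenO C b b') a'' b'' (TenM C a b a' b' f f') f'' =
      TenM C a b (TenO C a' a'') (TenO C b' b'') f (TenM C a' b' a'' b'' f' f'')"

locale strict_linear_monoidal_functor =
  fixes C :: "('o, 'm, 'k::idom) lmcat" and D :: "('p, 'n, 'k) lmcat"
    and FO :: "'o \<Rightarrow> 'p" and FM :: "'o \<Rightarrow> 'o \<Rightarrow> 'm \<Rightarrow> 'n"
  assumes FO_in_Obj: "a \<in> Obj C \<Longrightarrow> FO a \<in> Obj D"
    and FM_linear: "\<lbrakk>a \<in> Obj C; b \<in> Obj C\<rbrakk> \<Longrightarrow>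
      linear_map (Hom C a b) (Hom D (FO a) (FO b)) (FM a b)"
    and FM_Idm: "a \<in> Obj C \<Longrightarrow> FM a a (Idm C a) = Idm D (FO a)"
    and FM_Cmp: "\<lbrakk>a \<in> Obj C; b \<in> Obj C; c \<in> Obj C;
      f \<in> carrier (Hom C a b); g \<in> carrier (Hom C b c)\<rbrakk> \<Longrightarrow>
      FM a c (Cmp C a b c g f) = Cmp D (FO a) (FO b) (FO c) (FM b c g) (FM a b f)"
    and FO_Unit: "FO (Unit C) = Unit D"
    and FO_TenO: "\<lbrakk>a \<in> Obj C; b \<in> Obj C\<rbrakk> \<Longrightarrow> FO (TenO C a b) = TenO D (FO a) (FO b)"
    and FM_TenM: "\<lbrakk>a \<in> Obj C; b \<in> Obj C; a' \<in> Obj C; b' \<in> Obj C;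
      f \<in> carrier (Hom C a b); g \<in> carrier (Hom C a' b')\<rbrakk> \<Longrightarrow>
      FM (TenO C a a') (TenO C b b') (TenM C a b a' b' f g) =
      TenM D (FO a) (FO b) (FO a') (FO b') (FM a b f) (FM a' b' g)"

locale strict_linear_monoidal_isomorphism = strict_linear_monoidal_functor +
  assumes FO_bij: "bij_betw FO (Obj C) (Obj D)"
    and FM_bij: "\<lbrakk>a \<in> Obj C; b \<in> Obj C\<rbrakk> \<Longrightarrow>
      bij_betw (FM a b) (carrier (Hom C a b)) (carrier (Hom D (FO a) (FO b)))"


section \<open>Presentations by generators and relations\<close>

text \<open>
  The objects generated by \<open>'x\<close> are the words over \<open>'x\<close>. Morphisms are represented by
  formal expressions in the morphism generators \<open>'g\<close>.
\<close>

datatype ('x, 'g, 'k) expr =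
    Gen 'g
  | Ident "'x list"
  | Comp "('x, 'g, 'k) expr" "('x, 'g, 'k) expr"  (infixr "\<bullet>" 70)
  | Tens "('x, 'g, 'k) expr" "('x, 'g, 'k) expr"  (infixr "\<star>" 75)
  | Zero "'x list" "'x list"
  | Plus "('x, 'g, 'k) expr" "('x, 'g, 'k) expr"
  | Scale 'k "('x, 'g, 'k) expr"

inductive has_type :: "('g \<Rightarrow> 'x list \<times> 'x list) \<Rightarrow>
    ('x, 'g, 'k) expr \<Rightarrow> 'x list \<Rightarrow> 'x list \<Rightarrow> bool"
  for G :: "'g \<Rightarrow> 'x list \<times> 'x list" where
  "G x = (a, b) \<Longrightarrow> has_type G (Gen x) a b"
| "has_type G (Ident a) a a"
| "\<lbrakk>has_type G g b c; has_type G f a b\<rbrakk> \<Longrightarrow> has_type G (g \<bullet> f) a c"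
| "\<lbrakk>has_type G f a b; has_type G g a' b'\<rbrakk> \<Longrightarrow> has_type G (f \<star> g) (a @ a') (b @ b')"
| "has_type G (Zero a b) a b"
| "\<lbrakk>has_type G f a b; has_type G g a b\<rbrakk> \<Longrightarrow> has_type G (Plus f g) a b"
| "has_type G f a b \<Longrightarrow> has_type G (Scale r f) a b"

text \<open>
  \<open>eqv G R a b f g\<close>: the expressions \<open>f, g : a \<rightarrow> b\<close> are identified in every strict linear monoidal
  category in which the relations \<open>R\<close> hold, i.e. \<open>f = g\<close> is derivable from \<open>R\<close> and the axioms of
  a strict linear monoidal category.
\<close>

inductive eqv :: "('g \<Rightarrow> 'x list \<times> 'x list) \<Rightarrow>
    (('x, 'g, 'k::idom) expr \<times> ('x, 'g, 'k) expr) set \<Rightarrow>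
    'x list \<Rightarrow> 'x list \<Rightarrow> ('x, 'g, 'k) expr \<Rightarrow> ('x, 'g, 'k) expr \<Rightarrow> bool"
  for G :: "'g \<Rightarrow> 'x list \<times> 'x list"
    and R :: "(('x, 'g, 'k) expr \<times> ('x, 'g, 'k) expr) set" where
  relation: "\<lbrakk>(f, g) \<in> R; has_type G f a b; has_type G g a b\<rbrakk> \<Longrightarrow> eqv G R a b f g"

| refl: "has_type G f a b \<Longrightarrow> eqv G R a b f f"
| sym: "eqv G R a b f g \<Longrightarrow> eqv G R a b g f"
| trans: "\<lbrakk>eqv G R a b f g; eqv G R a b g h\<rbrakk> \<Longrightarrow> eqv G R a b f h"

| Comp_cong: "\<lbrakk>eqv G R b c g g'; eqv G R a b f f'\<rbrakk> \<Longrightarrow> eqv G R a c (g \<bullet> f) (g' \<bullet> f')"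
| Tens_cong: "\<lbrakk>eqv G R a b f f'; eqv G R c d g g'\<rbrakk> \<Longrightarrow>
    eqv G R (a @ c) (b @ d) (f \<star> g) (f' \<star> g')"
| Plus_cong: "\<lbrakk>eqv G R a b f f'; eqv G R a b g g'\<rbrakk> \<Longrightarrow> eqv G R a b (Plus f g) (Plus f' g')"
| Scale_cong: "eqv G R a b f f' \<Longrightarrow> eqv G R a b (Scale r f) (Scale r f')"

| Plus_assoc: "\<lbrakk>has_type G f a b; has_type G g a b; has_type G h a b\<rbrakk> \<Longrightarrow>
    eqv G R a b (Plus (Plus f g) h) (Plus f (Plus g h))"
| Plus_comm: "\<lbrakk>has_type G f a b; has_type G g a b\<rbrakk> \<Longrightarrow> eqv G R a b (Plus f g) (Plus g f)"
| Plus_Zero: "has_type G f a b \<Longrightarrow> eqv G R a b (Plus f (Zero a b)) f"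
| Plus_minus: "has_type G f a b \<Longrightarrow> eqv G R a b (Plus f (Scale (- 1) f)) (Zero a b)"
| Scale_Plus: "\<lbrakk>has_type G f a b; has_type G g a b\<rbrakk> \<Longrightarrow>
    eqv G R a b (Scale r (Plus f g)) (Plus (Scale r f) (Scale r g))"
| Scale_add: "has_type G f a b \<Longrightarrow>
    eqv G R a b (Scale (r + s) f) (Plus (Scale r f) (Scale s f))"
| Scale_Scale: "has_type G f a b \<Longrightarrow> eqv G R a b (Scale r (Scale s f)) (Scale (r * s) f)"
| Scale_one: "has_type G f a b \<Longrightarrow> eqv G R a b (Scale 1 f) f"

| Comp_Plus_left: "\<lbrakk>has_type G g b c; has_type G h b c; has_type G f a b\<rbrakk> \<Longrightarrow>
    eqv G R a c (Plus g h \<bullet> f) (Plus (g \<bullet> f) (h \<bullet> f))"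
| Comp_Plus_right: "\<lbrakk>has_type G h b c; has_type G f a b; has_type G g a b\<rbrakk> \<Longrightarrow>
    eqv G R a c (h \<bullet> Plus f g) (Plus (h \<bullet> f) (h \<bullet> g))"
| Comp_Scale_left: "\<lbrakk>has_type G g b c; has_type G f a b\<rbrakk> \<Longrightarrow>
    eqv G R a c (Scale r g \<bullet> f) (Scale r (g \<bullet> f))"
| Comp_Scale_right: "\<lbrakk>has_type G g b c; has_type G f a b\<rbrakk> \<Longrightarrow>
    eqv G R a c (g \<bullet> Scale r f) (Scale r (g \<bullet> f))"
| Tens_Plus_left: "\<lbrakk>has_type G f a b; has_type G g a b; has_type G h c d\<rbrakk> \<Longrightarrow>
    eqv G R (a @ c) (b @ d) (Plus f g \<star> h) (Plus (f \<star> h) (g \<star> h))"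
| Tens_Plus_right: "\<lbrakk>has_type G h a b; has_type G f c d; has_type G g c d\<rbrakk> \<Longrightarrow>
    eqv G R (a @ c) (b @ d) (h \<star> Plus f g) (Plus (h \<star> f) (h \<star> g))"
| Tens_Scale_left: "\<lbrakk>has_type G f a b; has_type G g c d\<rbrakk> \<Longrightarrow>
    eqv G R (a @ c) (b @ d) (Scale r f \<star> g) (Scale r (f \<star> g))"
| Tens_Scale_right: "\<lbrakk>has_type G f a b; has_type G g c d\<rbrakk> \<Longrightarrow>
    eqv G R (a @ c) (b @ d) (f \<star> Scale r g) (Scale r (f \<star> g))"

| Ident_left: "has_type G f a b \<Longrightarrow> eqv G R a b (Ident b \<bullet> f) f"
| Ident_right: "has_type G f a b \<Longrightarrow> eqv G R a b (f \<bullet> Ident a) f"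
| Comp_assoc: "\<lbrakk>has_type G h c d; has_type G g b c; has_type G f a b\<rbrakk> \<Longrightarrow>
    eqv G R a d ((h \<bullet> g) \<bullet> f) (h \<bullet> (g \<bullet> f))"
| Tens_unit_left: "has_type G f a b \<Longrightarrow> eqv G R a b (Ident [] \<star> f) f"
| Tens_unit_right: "has_type G f a b \<Longrightarrow> eqv G R a b (f \<star> Ident []) f"
| Tens_assoc: "\<lbrakk>has_type G f a b; has_type G g c d; has_type G h p q\<rbrakk> \<Longrightarrow>
    eqv G R (a @ c @ p) (b @ d @ q) ((f \<star> g) \<star> h) (f \<star> (g \<star> h))"
| Tens_Ident: "eqv G R (a @ b) (a @ b) (Ident a \<star> Ident b) (Ident (a @ b))"
| Interchange: "\<lbrakk>has_type G g b c; has_type G f a b; has_type G g' q r; has_type G f' p q\<rbrakk> \<Longrightarrow>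
    eqv G R (a @ p) (c @ r) ((g \<bullet> f) \<star> (g' \<bullet> f')) ((g \<star> g') \<bullet> (f \<star> f'))"

definition eqv_class :: "('g \<Rightarrow> 'x list \<times> 'x list) \<Rightarrow>
    (('x, 'g, 'k::idom) expr \<times> ('x, 'g, 'k) expr) set \<Rightarrow>
    'x list \<Rightarrow> 'x list \<Rightarrow> ('x, 'g, 'k) expr \<Rightarrow> ('x, 'g, 'k) expr set" where
  "eqv_class G R a b f = {g. eqv G R a b f g}"

definition presented_category :: "('g \<Rightarrow> 'x list \<times> 'x list) \<Rightarrow>
    (('x, 'g, 'k::idom) expr \<times> ('x, 'g, 'k) expr) set \<Rightarrow>
    ('x list, ('x, 'g, 'k) expr set, 'k) lmcat" where
  "presented_category G R = \<lparr>
     Obj = UNIV,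
     Hom = (\<lambda>a b. \<lparr>
       carrier = {eqv_class G R a b f | f. has_type G f a b},
       mult = undefined, one = undefined,
       zero = eqv_class G R a b (Zero a b),
       add = (\<lambda>X Y. \<Union>f\<in>X. \<Union>g\<in>Y. eqv_class G R a b (Plus f g)),
       smult = (\<lambda>r X. \<Union>f\<in>X. eqv_class G R a b (Scale r f))\<rparr>),
     Idm = (\<lambda>a. eqv_class G R a a (Ident a)),
     Cmp = (\<lambda>a b c X Y. \<Union>g\<in>X. \<Union>f\<in>Y. eqv_class G R a c (g \<bullet> f)),
     Unit = [],
     TenO = (@),
     TenM = (\<lambda>a b a' b' X Y. \<Union>f\<in>X. \<Union>g\<in>Y. eqv_class G R (a @ a') (b @ b') (f \<star> g))\<rparr>"


section \<open>The oriented Brauer category\<close>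

datatype letter = Up (\<open>\<up>\<close>) | Down (\<open>\<down>\<close>)

text \<open>Positions are counted from left to right, starting with 0.\<close>

datatype endpoint = Bot nat | Top nat

definition sources :: "letter list \<Rightarrow> letter list \<Rightarrow> endpoint set" where
  "sources a b = {Bot i | i. i < length a \<and> a ! i = \<up>} \<union> {Top j | j. j < length b \<and> b ! j = \<down>}"

definition targets :: "letter list \<Rightarrow> letter list \<Rightarrow> endpoint set" where
  "targets a b = {Top j | j. j < length b \<and> b ! j = \<up>} \<union> {Bot i | i. i < length a \<and> a ! i = \<down>}"

text \<open>
  An equivalence class of oriented Brauer diagrams with bubbles: the graph of the bijection it
  represents, and the number of bubbles.
\<close>

datatype diagram = Diagram (strands: "(endpoint \<times> endpoint) set") (bubbles: nat)

definition diagrams :: "letter list \<Rightarrow> letter list \<Rightarrow> diagram set" where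
  "diagrams a b = {D. \<exists>\<phi>. bij_betw \<phi> (sources a b) (targets a b) \<and>
     strands D = {(x, \<phi> x) | x. x \<in> sources a b}}"

definition id_diagram :: "letter list \<Rightarrow> diagram" where
  "id_diagram a = Diagram
     ({(Bot i, Top i) | i. i < length a \<and> a ! i = \<up>} \<union>
      {(Top i, Bot i) | i. i < length a \<and> a ! i = \<down>}) 0"

text \<open>
  When \<open>D'\<close> is stacked on top of \<open>D\<close>, the strands form a directed graph on the points of the
  lower, middle and upper line. Its maximal paths join points of the outer lines, and are the
  strands of the composite; its cycles run through the middle line only, and are the new bubbles.
\<close>

datatype point = Lower nat | Middle nat | Upper nat

fun in_bottom_part :: "endpoint \<Rightarrow> point" where
  "in_bottom_part (Bot i) = Lower i"
| "in_bottom_part (Top i) = Middle i"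

fun in_top_part :: "endpoint \<Rightarrow> point" where
  "in_top_part (Bot i) = Middle i"
| "in_top_part (Top i) = Upper i"

fun outer :: "endpoint \<Rightarrow> point" where
  "outer (Bot i) = Lower i"
| "outer (Top i) = Upper i"

definition stacked :: "diagram \<Rightarrow> diagram \<Rightarrow> (point \<times> point) set" where
  "stacked D' D = map_prod in_top_part in_top_part ` strands D' \<union>
     map_prod in_bottom_part in_bottom_part ` strands D"

definition closed_loops :: "('a \<times> 'a) set \<Rightarrow> 'a set set" where
  "closed_loops E = {E\<^sup>+ `` {p} | p. (p, p) \<in> E\<^sup>+}"

definition comp_diagram :: "diagram \<Rightarrow> diagram \<Rightarrow> diagram" where
  "comp_diagram D' D = Diagram
     {(x, y). (outer x, outer y) \<in> (stacked D' D)\<^sup>+}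
     (bubbles D' + bubbles D + card (closed_loops (stacked D' D)))"

fun shift :: "nat \<Rightarrow> nat \<Rightarrow> endpoint \<Rightarrow> endpoint" where
  "shift m n (Bot i) = Bot (m + i)"
| "shift m n (Top j) = Top (n + j)"

definition tens_diagram :: "letter list \<Rightarrow> letter list \<Rightarrow> diagram \<Rightarrow> diagram \<Rightarrow> diagram" where
  "tens_diagram a b D D' = Diagram
     (strands D \<union> map_prod (shift (length a) (length b)) (shift (length a) (length b)) ` strands D')
     (bubbles D + bubbles D')"

definition extend_bilinearly ::
    "('a \<Rightarrow> 'b \<Rightarrow> 'c) \<Rightarrow> ('a \<Rightarrow>\<^sub>0 'k::idom) \<Rightarrow> ('b \<Rightarrow>\<^sub>0 'k) \<Rightarrow> ('c \<Rightarrow>\<^sub>0 'k)" where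
  "extend_bilinearly op f g =
     (\<Sum>x\<in>Poly_Mapping.keys f. \<Sum>y\<in>Poly_Mapping.keys g.
        Poly_Mapping.single (op x y) (Poly_Mapping.lookup f x * Poly_Mapping.lookup g y))"

definition free_module :: "'a set \<Rightarrow> ('k::idom, 'a \<Rightarrow>\<^sub>0 'k) module" where
  "free_module S = \<lparr>
     carrier = {f. Poly_Mapping.keys f \<subseteq> S},
     mult = undefined, one = undefined, zero = 0, add = (+),
     smult = (\<lambda>r. Poly_Mapping.map ((*) r))\<rparr>"

definition OB :: "(letter list, diagram \<Rightarrow>\<^sub>0 'k::idom, 'k) lmcat" where
  "OB = \<lparr>
     Obj = UNIV,
     Hom = (\<lambda>a b. free_module (diagrams a b)),
     Idm = (\<lambda>a. Poly_Mapping.single (id_diagram a) 1),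
     Cmp = (\<lambda>a b c. extend_bilinearly comp_diagram),
     Unit = [],
     TenO = (@),
     TenM = (\<lambda>a b a' b'. extend_bilinearly (tens_diagram a b))\<rparr>"

definition cup :: "diagram \<Rightarrow>\<^sub>0 'k::idom" where
  "cup = Poly_Mapping.single (Diagram {(Top 1, Top 0)} 0) 1"

definition cap :: "diagram \<Rightarrow>\<^sub>0 'k::idom" where
  "cap = Poly_Mapping.single (Diagram {(Bot 1, Bot 0)} 0) 1"

definition crossing :: "diagram \<Rightarrow>\<^sub>0 'k::idom" where
  "crossing = Poly_Mapping.single (Diagram {(Bot 0, Top 1), (Bot 1, Top 0)} 0) 1"


section \<open>The generators and relations\<close>

datatype generator = Gc | Gd | Gs | Gt

fun generator_type :: "generator \<Rightarrow> letter list \<times> letter list" where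
  "generator_type Gc = ([], [\<up>, \<down>])"
| "generator_type Gd = ([\<down>, \<up>], [])"
| "generator_type Gs = ([\<up>, \<up>], [\<up>, \<up>])"
| "generator_type Gt = ([\<up>, \<down>], [\<down>, \<up>])"

abbreviation "cG \<equiv> Gen Gc"
abbreviation "dG \<equiv> Gen Gd"
abbreviation "sG \<equiv> Gen Gs"
abbreviation "tG \<equiv> Gen Gt"
abbreviation "upG \<equiv> Ident [\<up>]"
abbreviation "downG \<equiv> Ident [\<down>]"

text \<open>Invertibility of \<open>rotated_s\<close> is expressed by the generator \<open>t\<close> and the last two relations.\<close>

definition rotated_s :: "(letter, generator, 'k) expr" where
  "rotated_s = (dG \<star> upG \<star> downG) \<bullet> (downG \<star> sG \<star> downG) \<bullet> (downG \<star> upG \<star> cG)"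

definition OB_relations ::
    "((letter, generator, 'k) expr \<times> (letter, generator, 'k) expr) set" where
  "OB_relations = {
     ((upG \<star> dG) \<bullet> (cG \<star> upG), upG),
     ((dG \<star> downG) \<bullet> (downG \<star> cG), downG),
     (sG \<bullet> sG, upG \<star> upG),
     ((upG \<star> sG) \<bullet> (sG \<star> upG) \<bullet> (upG \<star> sG), (sG \<star> upG) \<bullet> (upG \<star> sG) \<bullet> (sG \<star> upG)),
     (tG \<bullet> rotated_s, downG \<star> upG),
     (rotated_s \<bullet> tG, upG \<star> downG)}"

definition OB_presented ::
    "(letter list, (letter, generator, 'k::idom) expr set, 'k) lmcat" where
  "OB_presented = presented_category generator_type OB_relations"

definition generator_class :: "generator \<Rightarrow> (letter, generator, 'k::idom) expr set" where
  "generator_class x =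
     eqv_class generator_type OB_relations (fst (generator_type x)) (snd (generator_type x)) (Gen x)"

end

theory Submission
  imports Defs
begin

text \<open>The functor sends a formal expression to the linear combination of diagrams that it
  draws (\<open>ev\<close>), and the point is that it is bijective on every space of morphisms. It
  is well defined because all derivable equations hold for diagrams (\<open>ev_sound\<close>).

  Diagrams are handled through one invariant. Let every strand carry a truth value. The weight of a
  diagram, for labels \<open>p\<close> along the bottom and \<open>q\<close> along the top, is 2 to
  the number of bubbles if the labels agree along every strand, and 0 otherwise. This is the matrix
  of the diagram acting on tensor powers of a space with two basis vectors. Stacking multiplies
  matrices (\<open>weight_comp\<close>): labels extend uniquely along paths and freely over each new
  closed loop. Juxtaposition is the Kronecker product (\<open>weight_tens\<close>), and a single
  diagram is determined by its weights (\<open>weight_eqD\<close>). The main category laws for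
  diagrams and the defining relations thus become identities between matrices.

  In the presented category, the crossing of two upward strands is rotated and inverted to give
  crossings of all orientations. The relations imply that these are mutually inverse and natural
  (\<open>cross_inverse\<close>, \<open>natural_cross\<close>), that cups and caps slide through
  strands (\<open>natural_eta\<close>, \<open>natural_eps\<close>), and that cups and caps of both
  orientations satisfy the zigzag identities (\<open>zag\<close>, \<open>zig\<close>). This is
  enough to simplify any composite of generators out of the empty word to some bubbles followed by
  cups, one cup for each pair of matched letters, added in a fixed order
  (\<open>monomial_normal_form\<close>). Normal forms, with their bubbles, are separated by their
  weights (\<open>nf_unique\<close>), and every diagram out of the empty word is drawn by one of
  them (\<open>nf_full\<close>).

  For an arbitrary source, the bottom line is bent up by duality (\<open>unbend_bend\<close>). Hence
  composites of generators from \<open>a\<close> to \<open>b\<close> correspond exactly to diagrams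
  from \<open>a\<close> to \<open>b\<close> (\<open>monomial_faithful\<close>,
  \<open>monomial_full\<close>). Every morphism is a linear combination of such composites, which
  are sent to basis elements of the free module, so coefficients can be compared: this gives
  \<open>evm_faithful\<close> and \<open>evm_full\<close>.\<close>

section \<open>Composition of diagrams counts labellings\<close>

lemma closed_loops_image: "closed_loops E = (\<lambda>p. E\<^sup>+ `` {p}) ` {p. (p, p) \<in> E\<^sup>+}"
  by (auto simp: closed_loops_def)

text \<open>An injective self-map of a finite set is surjective, and \<open>E\<close> restricted to
  \<open>F\<close> is such a map. This excludes paths that never end and closes cycles.\<close>

lemma finite_invariant_preimage:
  assumes "finite F" "single_valued (E\<inverse>)" "single_valued E" "F \<subseteq> Domain E" "E `` F \<subseteq> F" "y \<in> F"
  obtains z where "z \<in> F" "(z, y) \<in> E"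
proof -
  define f where "f x = (THE y. (x, y) \<in> E)" for x
  have f: "(x, f x) \<in> E" if "x \<in> F" for x
  proof -
    have "x \<in> Domain E" using that assms(4) by blast
    then obtain y where "(x, y) \<in> E" by blast
    then show ?thesis
      unfolding f_def using assms(3) by (auto simp: single_valued_def intro!: theI[of "\<lambda>y. (x, y) \<in> E"])
  qed
  have "inj_on f F"
    using f assms(2) by (auto simp: inj_on_def single_valued_def) (metis f)
  moreover have "f ` F \<subseteq> F" using f assms(5) by blast
  ultimately have "f ` F = F" using assms(1) by (simp add: endo_inj_surj)
  with assms(6) f that show thesis by (metis imageE)
qed

text \<open>
  The graph of two stacked diagrams: \<open>M\<close> is the middle line, \<open>A\<close> and \<open>B\<close> are the sources and
  targets of the composite.
\<close>

locale stacked_graph =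
  fixes E :: "('p \<times> 'p) set" and M A B :: "'p set"
  assumes fin: "finite E" and sv: "single_valued E" and svc: "single_valued (E\<inverse>)"
    and dom: "Domain E = M \<union> A" and ran: "Range E = M \<union> B"
    and disj: "A \<inter> M = {}" "B \<inter> M = {}" "A \<inter> B = {}"
begin

lemma forward_step: "(x, y) \<in> E \<Longrightarrow> (x, z) \<in> E\<^sup>+ \<Longrightarrow> (y, z) \<in> E\<^sup>*"
  using sv by (metis single_valuedD tranclD)

lemma backward_step: "(x, y) \<in> E \<Longrightarrow> (z, y) \<in> E\<^sup>+ \<Longrightarrow> (z, x) \<in> E\<^sup>*"
  using svc by (metis converseI single_valuedD tranclD2)

lemma trancl_domain: "(x, y) \<in> E\<^sup>+ \<Longrightarrow> x \<in> M \<union> A"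
  using dom by (metis DomainI tranclD)

lemma trancl_range: "(x, y) \<in> E\<^sup>+ \<Longrightarrow> y \<in> M \<union> B"
  using ran by (metis RangeI tranclD2)

text \<open>If the path from \<open>x\<close> never left the middle line, the points after
  \<open>x\<close> would form a finite invariant set. The first of them would then have a
  predecessor in this set; by injectivity that is \<open>x\<close>, which does not lie in
  \<open>M\<close>.\<close>

lemma path_exists:
  assumes "x \<in> A"
  shows "\<exists>y\<in>B. (x, y) \<in> E\<^sup>+"
proof (rule ccontr)
  assume "\<not> ?thesis"
  then have sub: "E\<^sup>+ `` {x} \<subseteq> M"
    using trancl_range by blast
  obtain y where y: "(x, y) \<in> E" using assms dom by blast
  obtain z where "z \<in> E\<^sup>+ `` {x}" "(z, y) \<in> E"
  proof (rule finite_invariant_preimage[of "E\<^sup>+ `` {x}" E y])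
    show "finite (E\<^sup>+ `` {x})"
      by (rule finite_subset[of _ "Range E"]) (use finite_Range[OF fin] in \<open>auto dest: tranclD2\<close>)
    show "E\<^sup>+ `` {x} \<subseteq> Domain E" using sub dom by blast
    show "E `` (E\<^sup>+ `` {x}) \<subseteq> E\<^sup>+ `` {x}" by (auto intro: trancl_into_trancl)
  qed (use sv svc y in auto)
  then have "x \<in> E\<^sup>+ `` {x}"
    using y svc by (metis converseI single_valuedD)
  then show False using sub assms disj by blast
qed

text \<open>Of two points reached from \<open>x\<close>, one is reached from the other, and a point
  of \<open>B\<close> has no outgoing edge.\<close>

lemma path_unique:
  assumes "(x, y) \<in> E\<^sup>+" "(x, y') \<in> E\<^sup>+" "y \<in> B" "y' \<in> B"
  shows "y = y'"
proof -
  have "(y, y') \<in> E\<^sup>* \<or> (y', y) \<in> E\<^sup>*"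
    using single_valued_confluent[OF sv] assms by (meson trancl_into_rtrancl)
  then show ?thesis
    using assms(3,4) disj dom by (metis DomainI Int_iff UnE converse_rtranclE empty_iff)
qed

lemma stacked_graph_converse: "stacked_graph (E\<inverse>) M B A"
  by unfold_locales (use fin sv svc dom ran disj in auto)

text \<open>Follow the edges backwards from \<open>m\<close>. If no source is met, going backwards
  is an injective self-map of the finite set of ancestors, so \<open>m\<close> itself is hit: some
  ancestor of \<open>m\<close> is also its successor.\<close>

lemma source_or_cycle:
  assumes "m \<in> M"
  shows "(m, m) \<in> E\<^sup>+ \<or> (\<exists>a\<in>A. (a, m) \<in> E\<^sup>*)"
proof (rule disjCI)
  assume no: "\<not> (\<exists>a\<in>A. (a, m) \<in> E\<^sup>*)"
  define P where "P = (E\<inverse>)\<^sup>* `` {m}"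
  have P: "z \<in> P \<longleftrightarrow> (z, m) \<in> E\<^sup>*" for z
    by (simp add: P_def rtrancl_converse)
  have sub: "P \<subseteq> M"
  proof
    fix z assume "z \<in> P"
    then have z: "(z, m) \<in> E\<^sup>*" by (simp add: P)
    then have "z \<in> Domain E \<or> z = m" by (metis DomainI converse_rtranclE)
    then show "z \<in> M" using no z assms dom by blast
  qed
  obtain z where "z \<in> P" "(z, m) \<in> E\<inverse>"
  proof (rule finite_invariant_preimage[of P "E\<inverse>" m])
    show "finite P"
      by (rule finite_subset[OF sub]) (use finite_Range[OF fin] ran in simp)
    show "P \<subseteq> Domain (E\<inverse>)" using sub ran by blast
    show "E\<inverse> `` P \<subseteq> P" by (auto simp: P intro: converse_rtrancl_into_rtrancl)
  qed (use sv svc in \<open>auto simp: P\<close>)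
  then show "(m, m) \<in> E\<^sup>+"
    by (auto simp: P intro: rtrancl_into_trancl2)
qed

lemma cycle_sym:
  assumes "(p, p) \<in> E\<^sup>+" "(p, z) \<in> E\<^sup>+"
  shows "(z, p) \<in> E\<^sup>+"
  using assms(2)
proof (induction rule: trancl_induct)
  case (base y)
  then have "(y, p) \<in> E\<^sup>*" using forward_step assms(1) by blast
  then show ?case using assms(1) base by (metis rtranclD)
next
  case (step y z)
  then have "(z, p) \<in> E\<^sup>*" using forward_step by blast
  then show ?case using assms(1) by (metis rtranclD)
qed

lemma cycle_class:
  assumes "(p, p) \<in> E\<^sup>+" "(p, z) \<in> E\<^sup>+"
  shows "E\<^sup>+ `` {p} = E\<^sup>+ `` {z}" "(z, z) \<in> E\<^sup>+"
  using cycle_sym[OF assms] assms(2) by (auto intro: trancl_trans)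

lemma source_not_cycle: "(a, z) \<in> E\<^sup>* \<Longrightarrow> a \<in> A \<Longrightarrow> (z, z) \<notin> E\<^sup>+"
proof (induction rule: rtrancl_induct)
  case base
  then show ?case using trancl_range disj by blast
next
  case (step y z)
  show ?case
  proof
    assume "(z, z) \<in> E\<^sup>+"
    then have "(z, y) \<in> E\<^sup>*" using backward_step step(2) by blast
    then have "(y, y) \<in> E\<^sup>+" using step(2) by (rule rtrancl_into_trancl2[rotated])
    then show False using step by blast
  qed
qed

text \<open>Agreement with \<open>l\<close> at every point off \<open>M\<close>, on the graph or
  not, makes a labelling determined by its values on the middle line, so that there are finitely
  many of them.\<close>

definition labellings :: "('p \<Rightarrow> bool) \<Rightarrow> ('p \<Rightarrow> bool) set" where
  "labellings l = {v. (\<forall>z. z \<notin> M \<longrightarrow> v z = l z) \<and> (\<forall>(x, y)\<in>E. v x = v y)}"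

lemma labelling_const:
  assumes "v \<in> labellings l"
  shows "(x, y) \<in> E\<^sup>* \<Longrightarrow> v x = v y"
  by (induction rule: rtrancl_induct) (use assms in \<open>auto simp: labellings_def\<close>)

lemma labellings_empty:
  assumes "x \<in> A" "y \<in> B" "(x, y) \<in> E\<^sup>+" "l x \<noteq> l y"
  shows "labellings l = {}"
proof -
  have False if v: "v \<in> labellings l" for v
  proof -
    have "v x = l x" "v y = l y"
      using v assms disj unfolding labellings_def by blast+
    then show False
      using labelling_const[OF v trancl_into_rtrancl[OF assms(3)]] assms(4) by simp
  qed
  then show ?thesis by blast
qed

text \<open>On a path the label is forced by the outer labels, which agree at both ends; on a closed
  loop it is constant and free. A labelling is therefore the choice of the loops on which it is
  true.\<close>

lemma labellings_bij:
  assumes con: "\<And>x y. x \<in> A \<Longrightarrow> y \<in> B \<Longrightarrow> (x, y) \<in> E\<^sup>+ \<Longrightarrow> l x = l y"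
  shows "bij_betw (\<lambda>v. {L \<in> closed_loops E. \<exists>z\<in>L. v z}) (labellings l) (Pow (closed_loops E))"
  unfolding bij_betw_def
proof
  let ?\<Phi> = "\<lambda>v. {L \<in> closed_loops E. \<exists>z\<in>L. v z}"
  have \<Phi>: "E\<^sup>+ `` {m} \<in> ?\<Phi> v \<longleftrightarrow> v m" if "(m, m) \<in> E\<^sup>+" "v \<in> labellings l" for m v
    using that labelling_const[OF that(2)] unfolding closed_loops_def
    by (auto intro: trancl_into_rtrancl)
  show "inj_on ?\<Phi> (labellings l)"
  proof (rule inj_onI, rule ext)
    fix v w z assume v: "v \<in> labellings l" and w: "w \<in> labellings l" and eq: "?\<Phi> v = ?\<Phi> w"
    have outer: "v z = w z" if "z \<notin> M" for z
      using v w that unfolding labellings_def by simp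
    show "v z = w z"
    proof (cases "z \<in> M")
      case True
      from source_or_cycle[OF this] show ?thesis
      proof
        assume z: "(z, z) \<in> E\<^sup>+"
        show ?thesis using \<Phi>[OF z v] \<Phi>[OF z w] unfolding eq by blast
      next
        assume "\<exists>a\<in>A. (a, z) \<in> E\<^sup>*"
        then obtain a where a: "a \<in> A" "(a, z) \<in> E\<^sup>*" by blast
        then show ?thesis
          using labelling_const[OF v a(2)] labelling_const[OF w a(2)] outer[of a] disj by blast
      qed
    qed (rule outer)
  qed
  show "?\<Phi> ` labellings l = Pow (closed_loops E)"
  proof (intro equalityI subsetI)
    fix S assume "S \<in> Pow (closed_loops E)"
    then have S: "S \<subseteq> closed_loops E" by blast
    \<comment> \<open>On a loop the value is read off from \<open>S\<close>, on a path it is the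
      label of the source in \<open>A\<close>, and points off the graph keep the label
      \<open>l\<close>.\<close>
    define v where "v z \<longleftrightarrow> (if z \<in> M \<union> A \<union> B then ((z, z) \<in> E\<^sup>+ \<and> E\<^sup>+ `` {z} \<in> S) \<or> (\<exists>a\<in>A. (a, z) \<in> E\<^sup>* \<and> l a) else l z)" for z
    have v_A: "v a = l a" if "a \<in> A" for a
    proof -
      have "(a, a) \<notin> E\<^sup>+" using source_not_cycle[of a a] that by blast
      moreover have "a' = a" if "(a', a) \<in> E\<^sup>*" for a'
        using that \<open>a \<in> A\<close> ran disj by (metis IntI RangeI UnE empty_iff rtranclE)
      ultimately show ?thesis using that unfolding v_def by auto
    qed
    have v_B: "v b = l b" if "b \<in> B" for b
    proof -
      have "(b, b) \<notin> E\<^sup>+" using trancl_domain that disj by blast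
      moreover obtain a where a: "a \<in> A" "(a, b) \<in> E\<^sup>+"
        using stacked_graph.path_exists[OF stacked_graph_converse \<open>b \<in> B\<close>] by (auto simp: trancl_converse)
      moreover have "l a' = l b" if "a' \<in> A" "(a', b) \<in> E\<^sup>*" for a'
        using that con \<open>b \<in> B\<close> disj by (metis IntI empty_iff rtranclD)
      ultimately show ?thesis using that unfolding v_def by (auto intro: trancl_into_rtrancl)
    qed
    have E: "v x = v y" if xy: "(x, y) \<in> E" for x y
    proof -
      have in_: "x \<in> M \<union> A \<union> B" "y \<in> M \<union> A \<union> B" using xy dom ran by blast+
      have 1: "(x, x) \<in> E\<^sup>+ \<longleftrightarrow> (y, y) \<in> E\<^sup>+"
        using cycle_class(2)[of x y] backward_step[OF xy, of y] xy
        by (meson r_into_trancl' rtrancl_into_trancl2)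
      have 2: "E\<^sup>+ `` {x} = E\<^sup>+ `` {y}" if "(x, x) \<in> E\<^sup>+"
        using cycle_class(1)[OF that] xy by blast
      have 3: "(\<exists>a\<in>A. (a, x) \<in> E\<^sup>* \<and> l a) \<longleftrightarrow> (\<exists>a\<in>A. (a, y) \<in> E\<^sup>* \<and> l a)"
      proof (intro bex_cong HOL.refl conj_cong)
        fix a assume "a \<in> A"
        show "(a, x) \<in> E\<^sup>* \<longleftrightarrow> (a, y) \<in> E\<^sup>*"
        proof
          assume "(a, y) \<in> E\<^sup>*"
          moreover have "a \<noteq> y" using \<open>a \<in> A\<close> xy ran disj by blast
          ultimately have "(a, y) \<in> E\<^sup>+" by (simp add: rtrancl_eq_or_trancl)
          then show "(a, x) \<in> E\<^sup>*" by (rule backward_step[OF xy])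
        qed (use xy in auto)
      qed
      have "(x, x) \<in> E\<^sup>+ \<and> E\<^sup>+ `` {x} \<in> S \<longleftrightarrow> (y, y) \<in> E\<^sup>+ \<and> E\<^sup>+ `` {y} \<in> S"
        using 1 2 by (cases "(x, x) \<in> E\<^sup>+") simp_all
      then show ?thesis unfolding v_def by (simp only: in_ 3 if_True)
    qed
    have v: "v \<in> labellings l"
      unfolding labellings_def using E v_A v_B by (auto simp: v_def)
    have "?\<Phi> v = S"
    proof (intro equalityI subsetI)
      fix L assume "L \<in> ?\<Phi> v"
      then obtain m where m: "(m, m) \<in> E\<^sup>+" "L = E\<^sup>+ `` {m}" "L \<in> ?\<Phi> v"
        unfolding closed_loops_def by blast
      then have "v m" using \<Phi>[OF m(1) v] by blast
      then show "L \<in> S"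
        using m source_not_cycle unfolding v_def by (auto split: if_splits dest: trancl_domain)
    next
      fix L assume "L \<in> S"
      then obtain m where m: "(m, m) \<in> E\<^sup>+" "L = E\<^sup>+ `` {m}"
        using S unfolding closed_loops_def by blast
      then have "v m" using \<open>L \<in> S\<close> trancl_domain[OF m(1)] unfolding v_def by auto
      then show "L \<in> ?\<Phi> v" using \<Phi>[OF m(1) v] m(2) by blast
    qed
    then show "S \<in> ?\<Phi> ` labellings l" using v by blast
  qed blast
qed

lemma finite_closed_loops: "finite (closed_loops E)"
proof -
  have "{p. (p, p) \<in> E\<^sup>+} \<subseteq> Range E" by (auto dest: tranclD2)
  then have "finite {p. (p, p) \<in> E\<^sup>+}"
    by (rule finite_subset) (simp add: fin finite_Range)
  then show ?thesis unfolding closed_loops_image by (rule finite_imageI)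
qed

text \<open>One factor 2 for each closed loop: here new bubbles turn into powers of 2.\<close>

lemma card_labellings:
  "card (labellings l) = (if \<forall>x\<in>A. \<forall>y\<in>B. (x, y) \<in> E\<^sup>+ \<longrightarrow> l x = l y then 2 ^ card (closed_loops E) else 0)"
proof (cases "\<forall>x\<in>A. \<forall>y\<in>B. (x, y) \<in> E\<^sup>+ \<longrightarrow> l x = l y")
  case True
  have "card (labellings l) = card (Pow (closed_loops E))"
    by (rule bij_betw_same_card[OF labellings_bij]) (use True in blast)
  then show ?thesis
    using True by (simp add: card_Pow finite_closed_loops)
next
  case False
  then obtain x y where "x \<in> A" "y \<in> B" "(x, y) \<in> E\<^sup>+" "l x \<noteq> l y" by blast
  from labellings_empty[OF this] show ?thesis using False by simp
qed

end

subsection \<open>Diagrams as bijections\<close>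

lemma finite_sources [simp]: "finite (sources a b)" and finite_targets [simp]: "finite (targets a b)"
  unfolding sources_def targets_def by auto

lemma sources_targets_disjoint: "sources a b \<inter> targets a b = {}"
  unfolding sources_def targets_def by auto

text \<open>Trades the bijection for conditions on its graph, which are easy to check for unions,
  images and sets of paths.\<close>

lemma diagrams_iff:
  "D \<in> diagrams a b \<longleftrightarrow> single_valued (strands D) \<and> single_valued ((strands D)\<inverse>) \<and>
     Domain (strands D) = sources a b \<and> Range (strands D) = targets a b"
proof
  assume "D \<in> diagrams a b"
  then obtain \<phi> where "bij_betw \<phi> (sources a b) (targets a b)" "strands D = {(x, \<phi> x) | x. x \<in> sources a b}"
    unfolding diagrams_def by blast
  moreover have "Range {(x, \<phi> x) | x. x \<in> sources a b} = \<phi> ` sources a b" by blast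
  ultimately show "single_valued (strands D) \<and> single_valued ((strands D)\<inverse>) \<and>
     Domain (strands D) = sources a b \<and> Range (strands D) = targets a b"
    unfolding bij_betw_def inj_on_def single_valued_def by auto
next
  assume *: "single_valued (strands D) \<and> single_valued ((strands D)\<inverse>) \<and>
     Domain (strands D) = sources a b \<and> Range (strands D) = targets a b"
  define \<phi> where "\<phi> x = (THE y. (x, y) \<in> strands D)" for x
  have \<phi>: "\<phi> x = y" if "(x, y) \<in> strands D" for x y
    unfolding \<phi>_def using * that by (auto simp: single_valued_def intro!: the_equality)
  have S: "strands D = {(x, \<phi> x) | x. x \<in> sources a b}"
  proof (intro equalityI subrelI)
    show "(x, y) \<in> {(x, \<phi> x) | x. x \<in> sources a b}" if "(x, y) \<in> strands D" for x y
      using \<phi>[OF that] that * by blast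
    show "(x, y) \<in> strands D" if "(x, y) \<in> {(x, \<phi> x) | x. x \<in> sources a b}" for x y
    proof -
      have "x \<in> Domain (strands D)" "y = \<phi> x" using that * by auto
      then show ?thesis using \<phi> by blast
    qed
  qed
  moreover have "bij_betw \<phi> (sources a b) (targets a b)"
    unfolding bij_betw_def
  proof
    show "inj_on \<phi> (sources a b)"
      using * unfolding inj_on_def single_valued_def S by blast
    show "\<phi> ` sources a b = targets a b"
      using * S by blast
  qed
  ultimately show "D \<in> diagrams a b" unfolding diagrams_def by blast
qed

lemma diagramsD:
  assumes "D \<in> diagrams a b"
  shows "single_valued (strands D)" "single_valued ((strands D)\<inverse>)"
    "Domain (strands D) = sources a b" "Range (strands D) = targets a b" "finite (strands D)"
proof -
  show *: "single_valued (strands D)" "single_valued ((strands D)\<inverse>)"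
    "Domain (strands D) = sources a b" "Range (strands D) = targets a b"
    using assms by (simp_all add: diagrams_iff)
  have "strands D \<subseteq> sources a b \<times> targets a b" unfolding *(3,4)[symmetric] by auto
  then show "finite (strands D)" by (rule finite_subset) simp
qed

lemma strand_in: "D \<in> diagrams a b \<Longrightarrow> (x, y) \<in> strands D \<Longrightarrow> x \<in> sources a b \<and> y \<in> targets a b"
  by (metis diagramsD(3,4) DomainI RangeI)

lemma single_valued_Un:
  "single_valued r \<Longrightarrow> single_valued s \<Longrightarrow> Domain r \<inter> Domain s = {} \<Longrightarrow> single_valued (r \<union> s)"
  unfolding single_valued_def by blast

lemma single_valued_map_prod: "inj f \<Longrightarrow> single_valued r \<Longrightarrow> single_valued (map_prod f f ` r)"
  unfolding single_valued_def inj_def by fastforce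

lemma Domain_map_prod: "Domain (map_prod f g ` r) = f ` Domain r"
  and Range_map_prod: "Range (map_prod f g ` r) = g ` Range r"
  and converse_map_prod: "(map_prod f g ` r)\<inverse> = map_prod g f ` (r\<inverse>)"
  by force+

lemma inj_in_top_part: "inj in_top_part" and inj_in_bottom_part: "inj in_bottom_part" and inj_outer: "inj outer"
  by (rule injI, case_tac x; case_tac y; simp)+

lemma inj_shift: "inj (shift m n)"
  by (rule injI, case_tac x; case_tac y; simp)

lemma image_sources: "f ` sources a b =
    {f (Bot i) | i. i < length a \<and> a ! i = \<up>} \<union> {f (Top j) | j. j < length b \<and> b ! j = \<down>}"
  and image_targets: "f ` targets a b =
    {f (Top j) | j. j < length b \<and> b ! j = \<up>} \<union> {f (Bot i) | i. i < length a \<and> a ! i = \<down>}"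
  unfolding sources_def targets_def by blast+

text \<open>On the middle line an up is a target of the lower and a source of the upper diagram, and
  a down is the reverse. So every middle point has exactly one incoming and one outgoing
  edge.\<close>

lemma stacked_graph_stacked:
  assumes "D \<in> diagrams a b" "D' \<in> diagrams b c"
  shows "stacked_graph (stacked D' D) (Middle ` {..<length b}) (outer ` sources a c) (outer ` targets a c)"
proof
  note D = diagramsD[OF assms(1)] and D' = diagramsD[OF assms(2)]
  have letters: "b ! i = \<up> \<or> b ! i = \<down>" for i by (cases "b ! i") auto
  show "finite (stacked D' D)" using D(5) D'(5) by (simp add: stacked_def)
  show "single_valued (stacked D' D)"
    unfolding stacked_def
  proof (rule single_valued_Un)
    show "Domain (map_prod in_top_part in_top_part ` strands D') \<inter>
        Domain (map_prod in_bottom_part in_bottom_part ` strands D) = {}"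
      unfolding Domain_map_prod D D' by (auto simp: sources_def)
  qed (intro single_valued_map_prod inj_in_top_part inj_in_bottom_part D D')+
  show "single_valued ((stacked D' D)\<inverse>)"
    unfolding stacked_def converse_Un converse_map_prod
  proof (rule single_valued_Un)
    show "Domain (map_prod in_top_part in_top_part ` (strands D')\<inverse>) \<inter>
        Domain (map_prod in_bottom_part in_bottom_part ` (strands D)\<inverse>) = {}"
      unfolding Domain_map_prod Domain_converse D D' by (auto simp: targets_def)
  qed (intro single_valued_map_prod inj_in_top_part inj_in_bottom_part D D')+
  show "Domain (stacked D' D) = Middle ` {..<length b} \<union> outer ` sources a c"
    unfolding stacked_def Domain_Un_eq Domain_map_prod D D'
    unfolding image_sources by auto (use letters in blast)+
  show "Range (stacked D' D) = Middle ` {..<length b} \<union> outer ` targets a c"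
    unfolding stacked_def Range_Un_eq Range_map_prod D D'
    unfolding image_targets by auto (use letters in blast)+
qed (auto simp: sources_def targets_def)

lemma outer_not_Middle [simp]: "outer x \<noteq> Middle i" "outer x \<notin> Middle ` I"
  by (cases x; auto)+

text \<open>A strand of the composite joins a source to the end of its path; the reversed graph is
  of the same kind and gives the inverse map.\<close>

lemma comp_diagram_in:
  assumes "D \<in> diagrams a b" "D' \<in> diagrams b c"
  shows "comp_diagram D' D \<in> diagrams a c"
proof -
  interpret stacked_graph "stacked D' D" "Middle ` {..<length b}" "outer ` sources a c" "outer ` targets a c"
    by (rule stacked_graph_stacked[OF assms])
  interpret C: stacked_graph "(stacked D' D)\<inverse>" "Middle ` {..<length b}" "outer ` targets a c" "outer ` sources a c"
    by (rule stacked_graph_converse)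
  have st: "x \<in> sources a c \<and> y \<in> targets a c" if "(outer x, outer y) \<in> (stacked D' D)\<^sup>+" for x y
    using trancl_domain[OF that] trancl_range[OF that] by (auto dest: injD[OF inj_outer])
  have "single_valued {(x, y). (outer x, outer y) \<in> (stacked D' D)\<^sup>+}"
    using path_unique st injD[OF inj_outer] unfolding single_valued_def by blast
  moreover have "single_valued ({(x, y). (outer x, outer y) \<in> (stacked D' D)\<^sup>+}\<inverse>)"
    using C.path_unique st injD[OF inj_outer] unfolding single_valued_def trancl_converse by blast
  moreover have "Domain {(x, y). (outer x, outer y) \<in> (stacked D' D)\<^sup>+} = sources a c"
    using st path_exists by blast
  moreover have "Range {(x, y). (outer x, outer y) \<in> (stacked D' D)\<^sup>+} = targets a c"
    using st C.path_exists unfolding trancl_converse by blast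
  ultimately show ?thesis by (simp add: diagrams_iff comp_diagram_def)
qed

subsection \<open>Weights\<close>

fun label :: "bool list \<Rightarrow> bool list \<Rightarrow> endpoint \<Rightarrow> bool" where
  "label p q (Bot i) = p ! i"
| "label p q (Top j) = q ! j"

text \<open>The matrix entry of the diagram acting on tensor powers of a space with basis
  \<open>True\<close>, \<open>False\<close>: strands act as identities, cups and caps as the
  standard pairing, and a bubble contributes the dimension 2. The values are natural numbers, so
  that powers of 2 stay distinct whatever the characteristic of \<open>'k\<close>.\<close>

definition weight :: "diagram \<Rightarrow> bool list \<Rightarrow> bool list \<Rightarrow> nat" where
  "weight D p q = (if \<forall>(x, y)\<in>strands D. label p q x = label p q y then 2 ^ bubbles D else 0)"

definition words :: "nat \<Rightarrow> bool list set" where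
  "words n = {q. length q = n}"

lemma finite_words [simp]: "finite (words n)"
  using finite_lists_length_eq[of "UNIV :: bool set" n] by (simp add: words_def)

lemma length_words: "q \<in> words n \<Longrightarrow> length q = n"
  by (simp add: words_def)

lemma sum_words_add: "(\<Sum>q\<in>words (m + n). f q) = (\<Sum>q\<in>words m. \<Sum>q'\<in>words n. f (q @ q'))"
proof -
  have "(\<Sum>q\<in>words (m + n). f q) = (\<Sum>(q, q')\<in>words m \<times> words n. f (q @ q'))"
    by (rule sum.reindex_bij_witness[of _ "\<lambda>(q, q'). q @ q'" "\<lambda>q. (take m q, drop m q)"])
      (auto simp: words_def)
  then show ?thesis by (simp add: sum.cartesian_product)
qed

lemma words_0 [simp]: "words 0 = {[]}"
  by (auto simp: words_def)

lemma sum_words_Suc: "(\<Sum>q\<in>words (Suc n). f q) = (\<Sum>q\<in>words n. f (True # q) + f (False # q))"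
proof -
  have "words (Suc n) = (#) True ` words n \<union> (#) False ` words n"
    by (auto simp: words_def length_Suc_conv image_iff)
  then have "sum f (words (Suc n)) = sum f ((#) True ` words n) + sum f ((#) False ` words n)"
    by (simp only:) (rule sum.union_disjoint, auto)
  then show ?thesis by (simp add: sum.reindex sum.distrib)
qed

text \<open>Matrix multiplication. A word \<open>q\<close> on the middle line contributes exactly
  when it extends \<open>p\<close> and \<open>r\<close> to a labelling of the stacked graph, and
  \<open>card_labellings\<close> counts these words.\<close>

lemma weight_comp:
  assumes "D \<in> diagrams a b" "D' \<in> diagrams b c"
  shows "weight (comp_diagram D' D) p r = (\<Sum>q\<in>words (length b). weight D' q r * weight D p q)"
proof -
  let ?E = "stacked D' D"
  interpret stacked_graph ?E "Middle ` {..<length b}" "outer ` sources a c" "outer ` targets a c"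
    by (rule stacked_graph_stacked[OF assms])
  \<comment> \<open>Middle points beyond the end of \<open>b\<close> get the value
    \<open>False\<close> for every \<open>q\<close>, as agreement with \<open>v []\<close> off the
    middle line requires.\<close>
  define v where "v q z = (case z of Lower i \<Rightarrow> p ! i
      | Middle i \<Rightarrow> if i < length b then q ! i else False | Upper i \<Rightarrow> r ! i)" for q z
  have l_outer: "v q (outer x) = label p r x" for q x
    by (cases x) (simp_all add: v_def)
  have top: "v q (in_top_part x) = label q r x" if "x \<in> sources b c \<union> targets b c" for q x
    using that by (auto simp: v_def sources_def targets_def)
  have bot: "v q (in_bottom_part x) = label p q x" if "x \<in> sources a b \<union> targets a b" for q x
    using that by (auto simp: v_def sources_def targets_def)
  let ?ok = "\<lambda>q. (\<forall>(x, y)\<in>strands D'. label q r x = label q r y) \<and> (\<forall>(x, y)\<in>strands D. label p q x = label p q y)"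
  have ok: "?ok q \<longleftrightarrow> (\<forall>(x, y)\<in>?E. v q x = v q y)" for q
  proof -
    have "(\<forall>(x, y)\<in>strands D'. label q r x = label q r y) \<longleftrightarrow>
        (\<forall>(x, y)\<in>strands D'. v q (in_top_part x) = v q (in_top_part y))"
      using strand_in[OF assms(2)] top by (intro ball_cong) auto
    moreover have "(\<forall>(x, y)\<in>strands D. label p q x = label p q y) \<longleftrightarrow>
        (\<forall>(x, y)\<in>strands D. v q (in_bottom_part x) = v q (in_bottom_part y))"
      using strand_in[OF assms(1)] bot by (intro ball_cong) auto
    ultimately show ?thesis
      by (auto simp: stacked_def ball_Un)
  qed
  have bij: "bij_betw v {q \<in> words (length b). ?ok q} (labellings (v []))"
    unfolding bij_betw_def
  proof
    show "inj_on v {q \<in> words (length b). ?ok q}"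
    proof (rule inj_onI, elim CollectE conjE)
      fix q q' assume q: "q \<in> words (length b)" "q' \<in> words (length b)" and eq: "v q = v q'"
      show "q = q'"
      proof (rule nth_equalityI)
        show "q ! i = q' ! i" if "i < length q" for i
          using fun_cong[OF eq, of "Middle i"] that length_words[OF q(1)] by (simp add: v_def)
      qed (use q in \<open>simp add: length_words\<close>)
    qed
    show "v ` {q \<in> words (length b). ?ok q} = labellings (v [])"
    proof (intro equalityI subsetI)
      fix w assume "w \<in> v ` {q \<in> words (length b). ?ok q}"
      then obtain q where "w = v q" "?ok q" by blast
      then show "w \<in> labellings (v [])"
        unfolding labellings_def ok by (auto simp: v_def split: point.split)
    next
      fix w assume w: "w \<in> labellings (v [])"
      define q where "q = map (\<lambda>i. w (Middle i)) [0..<length b]"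
      have "w z = v q z" for z
        using w by (cases z) (auto simp: labellings_def v_def q_def)
      then have "w = v q" by blast
      moreover have "q \<in> words (length b)" by (simp add: q_def words_def)
      moreover have "?ok q" unfolding ok using w \<open>w = v q\<close> by (simp add: labellings_def)
      ultimately show "w \<in> v ` {q \<in> words (length b). ?ok q}" by blast
    qed
  qed
  have "(\<Sum>q\<in>words (length b). weight D' q r * weight D p q) =
      (\<Sum>q\<in>words (length b). if ?ok q then 2 ^ (bubbles D' + bubbles D) else 0)"
    by (rule sum.cong) (auto simp: weight_def power_add)
  also have "\<dots> = 2 ^ (bubbles D' + bubbles D) * card {q \<in> words (length b). ?ok q}"
    by (simp add: sum.If_cases Int_def)
  also have "card {q \<in> words (length b). ?ok q} = card (labellings (v []))"
    by (rule bij_betw_same_card[OF bij])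
  also have "\<dots> = (if \<forall>x\<in>sources a c. \<forall>y\<in>targets a c. (outer x, outer y) \<in> ?E\<^sup>+ \<longrightarrow> label p r x = label p r y
      then 2 ^ card (closed_loops ?E) else 0)"
    unfolding card_labellings by (simp add: l_outer)
  also have "(\<forall>x\<in>sources a c. \<forall>y\<in>targets a c. (outer x, outer y) \<in> ?E\<^sup>+ \<longrightarrow> label p r x = label p r y) \<longleftrightarrow>
      (\<forall>(x, y)\<in>strands (comp_diagram D' D). label p r x = label p r y)"
    using strand_in[OF comp_diagram_in[OF assms]] by (auto simp: comp_diagram_def)
  finally show ?thesis
    by (simp add: weight_def comp_diagram_def power_add)
qed

text \<open>With all labels false only the power of 2 remains, which gives the number of bubbles.
  Labels that are true exactly at the two ends of a strand of \<open>D\<close> give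
  \<open>D\<close>, hence also \<open>D'\<close>, a nonzero weight, and this forces
  \<open>D'\<close> to join the same two points.\<close>

lemma weight_eqD:
  assumes D: "D \<in> diagrams a b" and D': "D' \<in> diagrams a b"
    and eq: "\<And>p q. length p = length a \<Longrightarrow> length q = length b \<Longrightarrow> weight D p q = weight D' p q"
  shows "D = D'"
proof -
  let ?F = "\<lambda>n. replicate n False"
  have F: "label (?F (length a)) (?F (length b)) x = False" if "x \<in> sources a b \<union> targets a b" for x
    using that by (auto simp: sources_def targets_def)
  have "weight D (?F (length a)) (?F (length b)) = 2 ^ bubbles D" if D: "D \<in> diagrams a b" for D
    using strand_in[OF D] F unfolding weight_def by fastforce
  from this[OF D] this[OF D'] have b: "bubbles D = bubbles D'"
    using eq[of "?F (length a)" "?F (length b)"] by simp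
  have sub: "strands D \<subseteq> strands D'"
    if D: "D \<in> diagrams a b" and D': "D' \<in> diagrams a b" and
      eq: "\<And>p q. length p = length a \<Longrightarrow> length q = length b \<Longrightarrow> weight D p q = weight D' p q" for D D'
  proof (rule subrelI)
    fix x y assume xy: "(x, y) \<in> strands D"
    define p q where "p = map (\<lambda>i. Bot i \<in> {x, y}) [0..<length a]" and "q = map (\<lambda>i. Top i \<in> {x, y}) [0..<length b]"
    have l: "label p q z \<longleftrightarrow> z \<in> {x, y}" if "z \<in> sources a b \<union> targets a b" for z
      using that by (auto simp: sources_def targets_def p_def q_def)
    have "label p q z = label p q w" if zw: "(z, w) \<in> strands D" for z w
    proof -
      have "z = x \<longleftrightarrow> w = y"
        using zw xy diagramsD(1,2)[OF D] unfolding single_valued_def by blast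
      then show ?thesis
        using l strand_in[OF D zw] strand_in[OF D xy] sources_targets_disjoint[of a b] by auto
    qed
    then have "weight D p q \<noteq> 0" by (auto simp: weight_def)
    then have "weight D' p q \<noteq> 0" using eq[of p q] by (simp add: p_def q_def)
    then have *: "label p q z = label p q w" if "(z, w) \<in> strands D'" for z w
      using that by (auto simp: weight_def split: if_splits)
    have "x \<in> Domain (strands D')" using strand_in[OF D xy] diagramsD(3)[OF D'] by simp
    then obtain w where w: "(x, w) \<in> strands D'" by blast
    then have "w \<in> {x, y}"
      using *[OF w] l strand_in[OF D' w] by auto
    moreover have "w \<noteq> x"
      using strand_in[OF D' w] sources_targets_disjoint[of a b] by blast
    ultimately show "(x, y) \<in> strands D'" using w by simp
  qed
  have "strands D = strands D'"
    using sub[OF D D' eq] sub[OF D' D eq[symmetric]] by blast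
  with b show ?thesis by (simp add: diagram.expand)
qed

lemma id_diagram_in: "id_diagram a \<in> diagrams a a"
  unfolding diagrams_iff
proof (intro conjI)
  show "single_valued (strands (id_diagram a))" "single_valued ((strands (id_diagram a))\<inverse>)"
    by (auto simp: id_diagram_def single_valued_def)
  show "Domain (strands (id_diagram a)) = sources a a" "Range (strands (id_diagram a)) = targets a a"
    unfolding id_diagram_def sources_def targets_def by auto
qed

lemma weight_id:
  assumes "length p = length a" "length q = length a"
  shows "weight (id_diagram a) p q = of_bool (p = q)"
proof -
  have "(\<forall>(x, y)\<in>strands (id_diagram a). label p q x = label p q y) \<longleftrightarrow>
      (\<forall>i. i < length a \<and> a ! i = \<up> \<longrightarrow> p ! i = q ! i) \<and> (\<forall>i. i < length a \<and> a ! i = \<down> \<longrightarrow> p ! i = q ! i)"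
    by (auto simp: id_diagram_def ball_Un setcompr_eq_image)
  also have "\<dots> \<longleftrightarrow> (\<forall>i<length a. p ! i = q ! i)"
    using letter.exhaust[of "a ! i" for i] by blast
  also have "\<dots> \<longleftrightarrow> p = q"
    using assms by (simp add: list_eq_iff_nth_eq)
  finally show ?thesis by (simp add: weight_def id_diagram_def)
qed

section \<open>Juxtaposition of diagrams\<close>

lemma sources_append: "sources (a @ a') (b @ b') = sources a b \<union> shift (length a) (length b) ` sources a' b'"
  (is "?L = ?R")
proof (intro equalityI subsetI)
  fix x assume x: "x \<in> ?L"
  show "x \<in> ?R"
  proof (cases x)
    case (Bot i)
    show ?thesis
    proof (cases "i < length a")
      case False
      then have "x = shift (length a) (length b) (Bot (i - length a))" "Bot (i - length a) \<in> sources a' b'"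
        using x Bot by (auto simp: sources_def nth_append)
      then show ?thesis by blast
    qed (use x Bot in \<open>simp add: sources_def nth_append\<close>)
  next
    case (Top j)
    show ?thesis
    proof (cases "j < length b")
      case False
      then have "x = shift (length a) (length b) (Top (j - length b))" "Top (j - length b) \<in> sources a' b'"
        using x Top by (auto simp: sources_def nth_append)
      then show ?thesis by blast
    qed (use x Top in \<open>simp add: sources_def nth_append\<close>)
  qed
next
  fix x assume "x \<in> ?R"
  then consider "x \<in> sources a b" | y where "y \<in> sources a' b'" "x = shift (length a) (length b) y" by blast
  then show "x \<in> ?L"
  proof cases
    case 1
    then show ?thesis by (cases x) (simp_all add: sources_def nth_append)
  next
    case (2 y)
    then show ?thesis by (cases y) (simp_all add: sources_def nth_append)
  qed
qed

lemma targets_append: "targets (a @ a') (b @ b') = targets a b \<union> shift (length a) (length b) ` targets a' b'"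
  (is "?L = ?R")
proof (intro equalityI subsetI)
  fix x assume x: "x \<in> ?L"
  show "x \<in> ?R"
  proof (cases x)
    case (Bot i)
    show ?thesis
    proof (cases "i < length a")
      case False
      then have "x = shift (length a) (length b) (Bot (i - length a))" "Bot (i - length a) \<in> targets a' b'"
        using x Bot by (auto simp: targets_def nth_append)
      then show ?thesis by blast
    qed (use x Bot in \<open>simp add: targets_def nth_append\<close>)
  next
    case (Top j)
    show ?thesis
    proof (cases "j < length b")
      case False
      then have "x = shift (length a) (length b) (Top (j - length b))" "Top (j - length b) \<in> targets a' b'"
        using x Top by (auto simp: targets_def nth_append)
      then show ?thesis by blast
    qed (use x Top in \<open>simp add: targets_def nth_append\<close>)
  qed
next
  fix x assume "x \<in> ?R"
  then consider "x \<in> targets a b" | y where "y \<in> targets a' b'" "x = shift (length a) (length b) y" by blast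
  then show "x \<in> ?L"
  proof cases
    case 1
    then show ?thesis by (cases x) (simp_all add: targets_def nth_append)
  next
    case (2 y)
    then show ?thesis by (cases y) (simp_all add: targets_def nth_append)
  qed
qed

lemma shift_disjoint:
  "sources a b \<inter> shift (length a) (length b) ` sources a' b' = {}"
  "targets a b \<inter> shift (length a) (length b) ` targets a' b' = {}"
  by (auto simp: sources_def targets_def)

lemma tens_diagram_in:
  assumes "D \<in> diagrams a b" "D' \<in> diagrams a' b'"
  shows "tens_diagram a b D D' \<in> diagrams (a @ a') (b @ b')"
proof -
  note D = diagramsD[OF assms(1)] and D' = diagramsD[OF assms(2)]
  show ?thesis
    unfolding diagrams_iff tens_diagram_def diagram.sel converse_Un converse_map_prod Domain_Un_eq Range_Un_eq
      Domain_map_prod Range_map_prod D D' sources_append targets_append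
    by (intro conjI single_valued_Un single_valued_map_prod inj_shift D D' HOL.refl)
      (simp_all add: Domain_map_prod D D' shift_disjoint)
qed

lemma weight_tens:
  assumes "D \<in> diagrams a b" "length p = length a" "length q = length b"
  shows "weight (tens_diagram a b D D') (p @ p') (q @ q') = weight D p q * weight D' p' q'"
proof -
  have l: "label (p @ p') (q @ q') x = label p q x" if "x \<in> sources a b \<union> targets a b" for x
    using that assms(2,3) by (auto simp: sources_def targets_def nth_append)
  have l': "label (p @ p') (q @ q') (shift (length a) (length b) x) = label p' q' x" for x
    using assms(2,3) by (cases x) (simp_all add: nth_append)
  have "(\<forall>(x, y)\<in>strands D. label (p @ p') (q @ q') x = label (p @ p') (q @ q') y) \<longleftrightarrow>
     (\<forall>(x, y)\<in>strands D. label p q x = label p q y)"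
    using strand_in[OF assms(1)] l by (intro ball_cong) auto
  then show ?thesis
    by (simp add: weight_def tens_diagram_def ball_Un l' power_add case_prod_unfold)
qed

subsection \<open>The category axioms for diagrams\<close>

lemma in_words: "q \<in> words n \<longleftrightarrow> length q = n"
  by (simp add: words_def)

lemma sum_words_delta:
  "p \<in> words n \<Longrightarrow> (\<Sum>q\<in>words n. f q * of_bool (p = q)) = (f p :: nat)"
  "p \<in> words n \<Longrightarrow> (\<Sum>q\<in>words n. of_bool (q = p) * f q) = (f p :: nat)"
proof -
  have "f q * of_bool (p = q) = (if p = q then f q else 0)" "of_bool (q = p) * f q = (if p = q then f q else 0)" for q
    by auto
  then show "p \<in> words n \<Longrightarrow> (\<Sum>q\<in>words n. f q * of_bool (p = q)) = f p"
    "p \<in> words n \<Longrightarrow> (\<Sum>q\<in>words n. of_bool (q = p) * f q) = f p"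
    by (simp_all only:) simp_all
qed

lemma comp_id_left:
  assumes "D \<in> diagrams a b"
  shows "comp_diagram (id_diagram b) D = D"
proof (rule weight_eqD[OF comp_diagram_in[OF assms id_diagram_in] assms])
  fix p q :: "bool list" assume l: "length p = length a" "length q = length b"
  have "weight (comp_diagram (id_diagram b) D) p q = (\<Sum>q'\<in>words (length b). of_bool (q' = q) * weight D p q')"
    unfolding weight_comp[OF assms id_diagram_in]
    by (rule sum.cong) (simp_all add: weight_id length_words l)
  then show "weight (comp_diagram (id_diagram b) D) p q = weight D p q"
    using l by (simp add: sum_words_delta in_words)
qed

lemma comp_id_right:
  assumes "D \<in> diagrams a b"
  shows "comp_diagram D (id_diagram a) = D"
proof (rule weight_eqD[OF comp_diagram_in[OF id_diagram_in assms] assms])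
  fix p q :: "bool list" assume l: "length p = length a" "length q = length b"
  have "weight (comp_diagram D (id_diagram a)) p q = (\<Sum>q'\<in>words (length a). weight D q' q * of_bool (p = q'))"
    unfolding weight_comp[OF id_diagram_in assms]
    by (rule sum.cong) (simp_all add: weight_id length_words l)
  then show "weight (comp_diagram D (id_diagram a)) p q = weight D p q"
    using l by (simp add: sum_words_delta in_words)
qed

text \<open>Associativity of matrix multiplication, transported by \<open>weight_eqD\<close>; no
  path through the threefold stack has to be followed.\<close>

lemma comp_diagram_assoc:
  assumes "D \<in> diagrams a b" "D' \<in> diagrams b c" "D'' \<in> diagrams c d"
  shows "comp_diagram (comp_diagram D'' D') D = comp_diagram D'' (comp_diagram D' D)"
proof (rule weight_eqD)
  note in' = comp_diagram_in[OF assms(1,2)] comp_diagram_in[OF assms(2,3)]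
  show "comp_diagram (comp_diagram D'' D') D \<in> diagrams a d" "comp_diagram D'' (comp_diagram D' D) \<in> diagrams a d"
    by (rule comp_diagram_in in' assms)+
  fix p q :: "bool list"
  show "weight (comp_diagram (comp_diagram D'' D') D) p q = weight (comp_diagram D'' (comp_diagram D' D)) p q"
    unfolding weight_comp[OF assms(1) in'(2)] weight_comp[OF in'(1) assms(3)] weight_comp[OF assms(1,2)]
      weight_comp[OF assms(2,3)] sum_distrib_left sum_distrib_right
    by (subst sum.swap) (simp add: mult.assoc)
qed

lemma append_splitE:
  assumes "length p = length (a @ a')"
  obtains p1 p2 where "p = p1 @ p2" "length p1 = length a" "length p2 = length a'"
  using assms that[of "take (length a) p" "drop (length a) p"] by simp

lemma tens_id: "tens_diagram a a (id_diagram a) (id_diagram b) = id_diagram (a @ b)"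
proof (rule weight_eqD[OF tens_diagram_in[OF id_diagram_in id_diagram_in] id_diagram_in])
  fix p q :: "bool list" assume "length p = length (a @ b)" "length q = length (a @ b)"
  then show "weight (tens_diagram a a (id_diagram a) (id_diagram b)) p q = weight (id_diagram (a @ b)) p q"
    by (elim append_splitE) (simp add: weight_tens[OF id_diagram_in] weight_id)
qed

text \<open>The mixed product rule for Kronecker products: the sum over words on the joint middle
  line splits into a double sum, which factors.\<close>

lemma tens_comp:
  assumes "D \<in> diagrams a b" "E \<in> diagrams b c" "D' \<in> diagrams a' b'" "E' \<in> diagrams b' c'"
  shows "tens_diagram a c (comp_diagram E D) (comp_diagram E' D') =
    comp_diagram (tens_diagram b c E E') (tens_diagram a b D D')"
proof (rule weight_eqD)
  note co = comp_diagram_in[OF assms(1,2)] comp_diagram_in[OF assms(3,4)]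
  note te = tens_diagram_in[OF assms(1,3)] tens_diagram_in[OF assms(2,4)]
  show "tens_diagram a c (comp_diagram E D) (comp_diagram E' D') \<in> diagrams (a @ a') (c @ c')"
    by (rule tens_diagram_in[OF co])
  show "comp_diagram (tens_diagram b c E E') (tens_diagram a b D D') \<in> diagrams (a @ a') (c @ c')"
    by (rule comp_diagram_in[OF te])
  fix p q :: "bool list" assume "length p = length (a @ a')" "length q = length (c @ c')"
  then show "weight (tens_diagram a c (comp_diagram E D) (comp_diagram E' D')) p q =
    weight (comp_diagram (tens_diagram b c E E') (tens_diagram a b D D')) p q"
  proof (elim append_splitE)
    fix p1 p2 q1 q2 :: "bool list"
    assume l: "p = p1 @ p2" "length p1 = length a" "length p2 = length a'"
      "q = q1 @ q2" "length q1 = length c" "length q2 = length c'"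
    have "weight (comp_diagram (tens_diagram b c E E') (tens_diagram a b D D')) p q =
      (\<Sum>r1\<in>words (length b). \<Sum>r2\<in>words (length b'). 
         (weight E r1 q1 * weight E' r2 q2) * (weight D p1 r1 * weight D' p2 r2))"
      unfolding weight_comp[OF te] length_append sum_words_add l
      by (intro sum.cong HOL.refl)
        (simp add: weight_tens[OF assms(1)] weight_tens[OF assms(2)] l length_words)
    also have "\<dots> = weight (comp_diagram E D) p1 q1 * weight (comp_diagram E' D') p2 q2"
      unfolding weight_comp[OF assms(1,2)] weight_comp[OF assms(3,4)] sum_product
      by (simp add: mult_ac)
    finally show ?thesis by (simp add: weight_tens[OF co(1)] l)
  qed
qed

lemma tens_unit_left: "tens_diagram [] [] (id_diagram []) D = D"
proof -
  have "shift 0 0 = (\<lambda>x. x)" by (rule ext, case_tac x) auto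
  then show ?thesis
    by (simp add: tens_diagram_def id_diagram_def map_prod_def case_prod_unfold)
qed

lemma tens_unit_right: "tens_diagram a b D (id_diagram []) = D"
  by (simp add: tens_diagram_def id_diagram_def)

lemma tens_diagram_assoc:
  "tens_diagram (a @ a') (b @ b') (tens_diagram a b D D') D'' = tens_diagram a b D (tens_diagram a' b' D' D'')"
proof -
  have "shift (m + m') (n + n') x = shift m n (shift m' n' x)" for m m' n n' x
    by (cases x) simp_all
  then show ?thesis
    by (simp add: tens_diagram_def image_Un image_image Un_assoc map_prod_def case_prod_unfold)
qed

section \<open>The oriented Brauer category is a strict linear monoidal category\<close>

lemma lookup_scale [simp]: "Poly_Mapping.lookup (Poly_Mapping.map ((*) r) f) k = (r :: 'k::idom) * Poly_Mapping.lookup f k"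
  by (simp add: Poly_Mapping.map.rep_eq "when_def")

lemma keys_scale: "Poly_Mapping.keys (Poly_Mapping.map ((*) (r :: 'k::idom)) f) \<subseteq> Poly_Mapping.keys f"
  by (auto simp: in_keys_iff)

text \<open>Keys off the support contribute zero. Summing over a common finite set makes additivity
  visible even though keys may cancel in a sum.\<close>

lemma extend_bilinearly_superset:
  assumes "finite X" "finite Y" "Poly_Mapping.keys f \<subseteq> X" "Poly_Mapping.keys g \<subseteq> Y"
  shows "extend_bilinearly op f g =
    (\<Sum>x\<in>X. \<Sum>y\<in>Y. Poly_Mapping.single (op x y) (Poly_Mapping.lookup f x * Poly_Mapping.lookup g y))"
proof -
  have "(\<Sum>y\<in>Poly_Mapping.keys g. Poly_Mapping.single (op x y) (Poly_Mapping.lookup f x * Poly_Mapping.lookup g y)) =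
      (\<Sum>y\<in>Y. Poly_Mapping.single (op x y) (Poly_Mapping.lookup f x * Poly_Mapping.lookup g y))" for x
    by (rule sum.mono_neutral_left) (use assms in \<open>auto simp: in_keys_iff\<close>)
  moreover have "(\<Sum>x\<in>Poly_Mapping.keys f. \<Sum>y\<in>Y. Poly_Mapping.single (op x y) (Poly_Mapping.lookup f x * Poly_Mapping.lookup g y)) =
     (\<Sum>x\<in>X. \<Sum>y\<in>Y. Poly_Mapping.single (op x y) (Poly_Mapping.lookup f x * Poly_Mapping.lookup g y))"
    by (rule sum.mono_neutral_left) (use assms in \<open>auto simp: in_keys_iff\<close>)
  ultimately show ?thesis by (simp add: extend_bilinearly_def)
qed

lemma extend_single [simp]:
  "extend_bilinearly op (Poly_Mapping.single x r) (Poly_Mapping.single y s) = Poly_Mapping.single (op x y) (r * s)"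
  by (subst extend_bilinearly_superset[of "{x}" "{y}"]) auto

lemma extend_add_left: "extend_bilinearly op (f + f') g = extend_bilinearly op f g + extend_bilinearly op f' g"
proof -
  let ?X = "Poly_Mapping.keys f \<union> Poly_Mapping.keys f'" and ?Y = "Poly_Mapping.keys g"
  have *: "finite ?X" "finite ?Y" "Poly_Mapping.keys f \<subseteq> ?X" "Poly_Mapping.keys f' \<subseteq> ?X"
    "Poly_Mapping.keys (f + f') \<subseteq> ?X" "?Y \<subseteq> ?Y"
    using Poly_Mapping.keys_add[of f f'] by auto
  show ?thesis
    unfolding extend_bilinearly_superset[OF *(1,2,3,6)] extend_bilinearly_superset[OF *(1,2,4,6)]
      extend_bilinearly_superset[OF *(1,2,5,6)]
    by (simp add: lookup_add distrib_right single_add sum.distrib)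
qed

lemma extend_add_right: "extend_bilinearly op f (g + g') = extend_bilinearly op f g + extend_bilinearly op f g'"
proof -
  let ?X = "Poly_Mapping.keys g \<union> Poly_Mapping.keys g'" and ?Y = "Poly_Mapping.keys f"
  have *: "finite ?Y" "finite ?X" "?Y \<subseteq> ?Y" "Poly_Mapping.keys g \<subseteq> ?X" "Poly_Mapping.keys g' \<subseteq> ?X"
    "Poly_Mapping.keys (g + g') \<subseteq> ?X"
    using Poly_Mapping.keys_add[of g g'] by auto
  show ?thesis
    unfolding extend_bilinearly_superset[OF *(1,2,3,4)] extend_bilinearly_superset[OF *(1,2,3,5)]
      extend_bilinearly_superset[OF *(1,2,3,6)]
    by (simp add: lookup_add distrib_left single_add sum.distrib)
qed

lemma scale_sum:
  "Poly_Mapping.map ((*) (r :: 'k::idom)) (\<Sum>x\<in>X. f x) = (\<Sum>x\<in>X. Poly_Mapping.map ((*) r) (f x))"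
  by (rule poly_mapping_eqI) (simp add: lookup_sum sum_distrib_left)

lemma extend_scale_left: "extend_bilinearly op (Poly_Mapping.map ((*) r) f) g = Poly_Mapping.map ((*) r) (extend_bilinearly op f g)"
  by (subst extend_bilinearly_superset[of "Poly_Mapping.keys f" "Poly_Mapping.keys g"])
    (simp_all add: keys_scale scale_sum extend_bilinearly_def mult_ac)

lemma extend_scale_right: "extend_bilinearly op f (Poly_Mapping.map ((*) r) g) = Poly_Mapping.map ((*) r) (extend_bilinearly op f g)"
  by (subst extend_bilinearly_superset[of "Poly_Mapping.keys f" "Poly_Mapping.keys g"])
    (simp_all add: keys_scale scale_sum extend_bilinearly_def mult_ac)

lemma extend_zero [simp]: "extend_bilinearly op 0 g = 0" "extend_bilinearly op f 0 = 0"
  by (simp_all add: extend_bilinearly_def)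

text \<open>Reduces multilinear identities, one argument at a time, to single basis
  elements.\<close>

lemma free_induct [consumes 1, case_names zero single add]:
  fixes f :: "'a \<Rightarrow>\<^sub>0 'k::idom"
  assumes "Poly_Mapping.keys f \<subseteq> S" "P 0"
    "\<And>x r. x \<in> S \<Longrightarrow> P (Poly_Mapping.single x r)" "\<And>f g. P f \<Longrightarrow> P g \<Longrightarrow> P (f + g)"
  shows "P f"
proof -
  have "f = (\<Sum>x\<in>Poly_Mapping.keys f. Poly_Mapping.single x (Poly_Mapping.lookup f x))"
    by (rule poly_mapping_eqI)
      (simp add: lookup_sum lookup_single "when_def" sum.delta' in_keys_iff)
  moreover have "P (\<Sum>x\<in>X. Poly_Mapping.single x (Poly_Mapping.lookup f x))" if "finite X" "X \<subseteq> S" for X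
    using that by (induction rule: finite_induct) (auto intro: assms(2-4))
  ultimately show ?thesis using assms(1) by (metis finite_keys)
qed

lemma extend_closed:
  assumes "Poly_Mapping.keys f \<subseteq> X" "Poly_Mapping.keys g \<subseteq> Y" "\<And>x y. x \<in> X \<Longrightarrow> y \<in> Y \<Longrightarrow> op x y \<in> Z"
  shows "Poly_Mapping.keys (extend_bilinearly op f g) \<subseteq> Z"
  using assms(1)
proof (induction rule: free_induct)
  case (single x r)
  show ?case
    using assms(2)
  proof (induction rule: free_induct)
    case (single y s)
    then show ?case using assms(3) \<open>x \<in> X\<close> by simp
  next
    case (add g g')
    then show ?case unfolding extend_add_right by (meson Poly_Mapping.keys_add Un_least order_trans)
  qed simp
next
  case (add f f')
  then show ?case unfolding extend_add_left by (meson Poly_Mapping.keys_add Un_least order_trans)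
qed simp

lemma extend_assoc:
  assumes "Poly_Mapping.keys f \<subseteq> X" "Poly_Mapping.keys g \<subseteq> Y" "Poly_Mapping.keys h \<subseteq> Z"
    "\<And>x y z. x \<in> X \<Longrightarrow> y \<in> Y \<Longrightarrow> z \<in> Z \<Longrightarrow> op1 (op2 x y) z = op3 x (op4 y z)"
  shows "extend_bilinearly op1 (extend_bilinearly op2 f g) h = extend_bilinearly op3 f (extend_bilinearly op4 g h)"
  using assms(1)
proof (induction rule: free_induct)
  case x: (single x r)
  show ?case
    using assms(2)
  proof (induction rule: free_induct)
    case y: (single y s)
    show ?case
      using assms(3)
      by (induction rule: free_induct) (simp_all add: extend_add_right assms(4) x y mult.assoc)
  qed (simp_all add: extend_add_left extend_add_right)
qed (simp_all add: extend_add_left)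

lemma extend_interchange:
  assumes "Poly_Mapping.keys f \<subseteq> X" "Poly_Mapping.keys g \<subseteq> Y" "Poly_Mapping.keys h \<subseteq> Z" "Poly_Mapping.keys k \<subseteq> W"
    "\<And>x y z w. x \<in> X \<Longrightarrow> y \<in> Y \<Longrightarrow> z \<in> Z \<Longrightarrow> w \<in> W \<Longrightarrow> op1 (op2 x y) (op3 z w) = op4 (op5 x z) (op6 y w)"
  shows "extend_bilinearly op1 (extend_bilinearly op2 f g) (extend_bilinearly op3 h k) =
    extend_bilinearly op4 (extend_bilinearly op5 f h) (extend_bilinearly op6 g k)"
  using assms(1)
proof (induction rule: free_induct)
  case x: (single x r)
  show ?case
    using assms(2)
  proof (induction rule: free_induct)
    case y: (single y s)
    show ?case
      using assms(3)
    proof (induction rule: free_induct)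
      case z: (single z t)
      show ?case
        using assms(4)
        by (induction rule: free_induct) (simp_all add: extend_add_right assms(5) x y z mult_ac)
    qed (simp_all add: extend_add_left extend_add_right)
  qed (simp_all add: extend_add_left extend_add_right)
qed (simp_all add: extend_add_left)

lemma extend_unit_left:
  assumes "Poly_Mapping.keys f \<subseteq> X" "\<And>x. x \<in> X \<Longrightarrow> op e x = x"
  shows "extend_bilinearly op (Poly_Mapping.single e 1) f = f"
  using assms(1) by (induction rule: free_induct) (simp_all add: assms(2) extend_add_right)

lemma extend_unit_right:
  assumes "Poly_Mapping.keys f \<subseteq> X" "\<And>x. x \<in> X \<Longrightarrow> op x e = x"
  shows "extend_bilinearly op f (Poly_Mapping.single e 1) = f"
  using assms(1) by (induction rule: free_induct) (simp_all add: assms(2) extend_add_left)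

lemma cring_scalars: "cring (scalars :: 'k::idom ring)"
proof (rule cringI)
  show "abelian_group (scalars :: 'k ring)"
    by (rule abelian_groupI) (auto simp: scalars_def algebra_simps intro: exI[of _ "- x" for x])
  show "comm_monoid (scalars :: 'k ring)"
    by (rule comm_monoidI) (auto simp: scalars_def mult_ac)
qed (simp add: scalars_def algebra_simps)

lemma module_free: "Module.module (scalars :: 'k::idom ring) (free_module S)"
proof (rule moduleI)
  show "cring (scalars :: 'k ring)" by (rule cring_scalars)
  show "abelian_group (free_module S :: ('k, 'a \<Rightarrow>\<^sub>0 'k) module)"
  proof (rule abelian_groupI)
    show "\<exists>y\<in>carrier (free_module S). y \<oplus>\<^bsub>free_module S\<^esub> x = \<zero>\<^bsub>free_module S\<^esub>"
      if "x \<in> carrier (free_module S)" for x :: "'a \<Rightarrow>\<^sub>0 'k"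
      using that by (intro bexI[of _ "- x"]) (auto simp: free_module_def)
  qed (use Poly_Mapping.keys_add in \<open>fastforce simp: free_module_def add_ac\<close>)+
qed (auto simp: free_module_def scalars_def lookup_add algebra_simps
    intro!: poly_mapping_eqI dest: subsetD[OF keys_scale])

lemma bilinear_extend:
  assumes "\<And>x y. x \<in> X \<Longrightarrow> y \<in> Y \<Longrightarrow> op x y \<in> Z"
  shows "bilinear_map (free_module X :: ('k::idom, 'a \<Rightarrow>\<^sub>0 'k) module) (free_module Y) (free_module Z) (extend_bilinearly op)"
proof -
  have "Poly_Mapping.keys (extend_bilinearly op f g) \<subseteq> Z"
    if "Poly_Mapping.keys f \<subseteq> X" "Poly_Mapping.keys g \<subseteq> Y" for f :: "'a \<Rightarrow>\<^sub>0 'k" and g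
    using that assms by (rule extend_closed)
  then show ?thesis
    by (simp add: bilinear_map_def linear_map_def free_module_def
      extend_add_left extend_add_right extend_scale_left extend_scale_right)
qed

text \<open>Each law is the law for single diagrams, extended multilinearly.\<close>

lemma OB_category: "strict_linear_monoidal_category (OB :: (letter list, diagram \<Rightarrow>\<^sub>0 'k::idom, 'k) lmcat)"
proof (rule strict_linear_monoidal_category.intro)
  fix a b c d a' b' c' a'' b'' :: "letter list" and f g h f' g' f'' :: "diagram \<Rightarrow>\<^sub>0 'k"
  let ?C = "OB :: (letter list, diagram \<Rightarrow>\<^sub>0 'k, 'k) lmcat"
  have hom: "f \<in> carrier (Hom ?C a b) \<longleftrightarrow> Poly_Mapping.keys f \<subseteq> diagrams a b" for f a b
    by (simp add: OB_def free_module_def)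
  show "Module.module scalars (Hom ?C a b)"
    by (simp add: OB_def module_free)
  show "Idm ?C a \<in> carrier (Hom ?C a a)"
    unfolding hom by (simp add: OB_def id_diagram_in)
  show "bilinear_map (Hom ?C b c) (Hom ?C a b) (Hom ?C a c) (Cmp ?C a b c)"
    by (simp add: OB_def bilinear_extend comp_diagram_in)
  show "bilinear_map (Hom ?C a b) (Hom ?C a' b') (Hom ?C (TenO ?C a a') (TenO ?C b b')) (TenM ?C a b a' b')"
    by (simp add: OB_def bilinear_extend tens_diagram_in)
  show "TenM ?C a a b b (Idm ?C a) (Idm ?C b) = Idm ?C (TenO ?C a b)"
    by (simp add: OB_def tens_id)
  {
    assume f: "f \<in> carrier (Hom ?C a b)"
    note f' = f[unfolded hom]
    show "Cmp ?C a b b (Idm ?C b) f = f" "Cmp ?C a a b f (Idm ?C a) = f"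
      "TenM ?C (Unit ?C) (Unit ?C) a b (Idm ?C (Unit ?C)) f = f"
      "TenM ?C a b (Unit ?C) (Unit ?C) f (Idm ?C (Unit ?C)) = f"
      using extend_unit_left[OF f', of comp_diagram "id_diagram b", OF comp_id_left]
        extend_unit_right[OF f', of comp_diagram "id_diagram a", OF comp_id_right]
        extend_unit_left[OF f', of "tens_diagram [] []", OF tens_unit_left]
        extend_unit_right[OF f', of "tens_diagram a b", OF tens_unit_right]
      by (simp_all add: OB_def)
    assume "f' \<in> carrier (Hom ?C a' b')" "f'' \<in> carrier (Hom ?C a'' b'')"
    then show "TenM ?C (TenO ?C a a') (TenO ?C b b') a'' b'' (TenM ?C a b a' b' f f') f'' =
      TenM ?C a b (TenO ?C a' a'') (TenO ?C b' b'') f (TenM ?C a' b' a'' b'' f' f'')"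
      using f unfolding hom by (simp add: OB_def extend_assoc tens_diagram_assoc)
  }
  {
    assume "f \<in> carrier (Hom ?C a b)" "g \<in> carrier (Hom ?C b c)" "h \<in> carrier (Hom ?C c d)"
    then show "Cmp ?C a b d (Cmp ?C b c d h g) f = Cmp ?C a c d h (Cmp ?C a b c g f)"
      unfolding hom by (simp add: OB_def) (rule extend_assoc, assumption+, rule comp_diagram_assoc)
  }
  {
    assume "f \<in> carrier (Hom ?C a b)" "g \<in> carrier (Hom ?C b c)"
      "f' \<in> carrier (Hom ?C a' b')" "g' \<in> carrier (Hom ?C b' c')"
    then show "TenM ?C a c a' c' (Cmp ?C a b c g f) (Cmp ?C a' b' c' g' f') =
      Cmp ?C (TenO ?C a a') (TenO ?C b b') (TenO ?C c c') (TenM ?C b c b' c' g g') (TenM ?C a b a' b' f f')"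
      unfolding hom by (simp add: OB_def) (rule extend_interchange, assumption+, rule tens_comp)
  }
qed (simp_all add: OB_def)

section \<open>Morphisms of the presented category\<close>

abbreviation typed :: "(letter, generator, 'k) expr \<Rightarrow> letter list \<Rightarrow> letter list \<Rightarrow> bool" where
  "typed \<equiv> has_type generator_type"

abbreviation OB_eqv :: "letter list \<Rightarrow> letter list \<Rightarrow>
    (letter, generator, 'k::idom) expr \<Rightarrow> (letter, generator, 'k) expr \<Rightarrow> bool" where
  "OB_eqv \<equiv> eqv generator_type OB_relations"

inductive_simps has_type_Gen: "has_type G (Gen x) a b"
inductive_simps has_type_Ident: "has_type G (Ident w) a b"
inductive_simps has_type_Comp: "has_type G (g \<bullet> f) a b"
inductive_simps has_type_Tens: "has_type G (f \<star> g) a b"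
inductive_simps has_type_Zero: "has_type G (Zero u v) a b"
inductive_simps has_type_Plus: "has_type G (Plus f g) a b"
inductive_simps has_type_Scale: "has_type G (Scale r f) a b"

lemmas has_type_simps = has_type_Gen has_type_Ident has_type_Comp has_type_Tens has_type_Zero
  has_type_Plus has_type_Scale

lemma has_type_unique:
  "has_type G e a b \<Longrightarrow> has_type G e a' b' \<Longrightarrow> a = a' \<and> b = b'"
proof (induction arbitrary: a' b' rule: has_type.induct)
  case (3 g b c f a)
  from 3(5) obtain m where "has_type G g m b'" "has_type G f a' m"
    unfolding has_type_Comp by blast
  then show ?case using 3(3,4) by blast
next
  case (4 f a b g c d)
  from 4(5) obtain a1 b1 a2 b2 where "a' = a1 @ a2" "b' = b1 @ b2"
      "has_type G f a1 b1" "has_type G g a2 b2"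
    unfolding has_type_Tens by blast
  then show ?case using 4(3,4) by blast
next
  case (6 f a b g)
  then show ?case unfolding has_type_Plus by blast
next
  case (7 f a b r)
  then show ?case unfolding has_type_Scale by blast
qed (simp_all add: has_type_simps)

lemma eqv_has_type: "eqv G R a b f g \<Longrightarrow> has_type G f a b \<and> has_type G g a b"
proof (induction rule: eqv.induct)
  case (Tens_assoc f a b g c d h p q)
  have "has_type G ((f \<star> g) \<star> h) ((a @ c) @ p) ((b @ d) @ q)"
    by (rule has_type.intros has_type.intros Tens_assoc)+
  moreover have  "has_type G (f \<star> (g \<star> h)) (a @ c @ p) (b @ d @ q)"
    by (rule has_type.intros has_type.intros Tens_assoc)+
  ultimately show ?case by (simp only: append_assoc)
next
  case (Tens_unit_left f a b)
  show ?case
    using has_type.intros(4)[OF has_type.intros(2)[of G "[]"] Tens_unit_left] Tens_unit_left by (simp only: append_Nil)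
next
  case (Tens_unit_right f a b)
  show ?case
    using has_type.intros(4)[OF Tens_unit_right has_type.intros(2)[of G "[]"]] Tens_unit_right by (simp only: append_Nil2)
next
  case (trans a b f g h)
  then show ?case by (elim conjE, intro conjI has_type.intros) (assumption+)
next
  case (Comp_cong b c g g' a f f')
  then show ?case by (elim conjE, intro conjI has_type.intros) (assumption+)
next
  case (Comp_assoc h c d g b f a)
  then show ?case by (intro conjI has_type.intros) (assumption+)
next
  case (Interchange g b c f a g' q r f' p)
  then show ?case
    by (meson has_type.intros(3,4))
next
  case (Comp_Plus_left g b c h f a)
  then show ?case by (intro conjI has_type.intros) (assumption+)
next
  case (Tens_Ident a b)
  then show ?case by (blast intro: has_type.intros)
next
  case (Ident_left f a b)
  then show ?case by (blast intro: has_type.intros)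
next
  case (Ident_right f a b)
  then show ?case by (blast intro: has_type.intros)
qed ((elim conjE)?, (intro conjI has_type.intros)?, assumption+)+

text \<open>
  Identifying all ill-typed expressions with each other turns composition and tensor product into
  total operations, for which the associativity laws hold without typing assumptions.
\<close>

definition same_mor ::
    "(letter, generator, 'k::idom) expr \<Rightarrow> (letter, generator, 'k) expr \<Rightarrow> bool" where
  "same_mor e f \<longleftrightarrow> (\<forall>a b. typed e a b \<longleftrightarrow> typed f a b) \<and> (\<forall>a b. typed e a b \<longrightarrow> OB_eqv a b e f)"

lemma same_morI:
  assumes "\<And>a b. typed e a b \<longleftrightarrow> typed f a b" "\<And>a b. typed e a b \<Longrightarrow> typed f a b \<Longrightarrow> OB_eqv a b e f"
  shows "same_mor e f"
  using assms unfolding same_mor_def by blast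

lemma same_morD:
  assumes "same_mor e f"
  shows "typed e a b \<Longrightarrow> typed f a b" "typed f a b \<Longrightarrow> typed e a b" "typed e a b \<Longrightarrow> OB_eqv a b e f"
  using assms unfolding same_mor_def by blast+

lemma same_mor_trans:
  assumes "same_mor e f" "same_mor f g"
  shows "same_mor e g"
proof -
  note D = same_morD[OF assms(1)] same_morD[OF assms(2)]
  show ?thesis
    by (rule same_morI) (use D in \<open>blast\<close>, use D eqv.trans in \<open>blast\<close>)
qed

quotient_type (overloaded) 'k mor = "(letter, generator, 'k::idom) expr" / same_mor
proof (rule equivpI)
  show "reflp same_mor" by (auto simp: reflp_def same_mor_def intro: eqv.refl)
  show "symp same_mor" by (auto simp: symp_def same_mor_def intro: eqv.sym)
  show "transp same_mor" by (blast intro: transpI same_mor_trans)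
qed

lift_definition arr :: "'k::idom mor \<Rightarrow> letter list \<Rightarrow> letter list \<Rightarrow> bool" is typed
  by (auto simp: same_mor_def)

lift_definition gen :: "generator \<Rightarrow> 'k::idom mor" is Gen .
lift_definition idm :: "letter list \<Rightarrow> 'k::idom mor" is Ident .
lift_definition zero :: "letter list \<Rightarrow> letter list \<Rightarrow> 'k::idom mor" is Zero .

lift_definition cmp :: "'k::idom mor \<Rightarrow> 'k mor \<Rightarrow> 'k mor" (infixr "\<cdot>" 70) is Comp
  subgoal premises prems for e e' f f'
  proof -
    note D = same_morD[OF prems(1)] same_morD[OF prems(2)]
    show ?thesis
      unfolding same_mor_def has_type_Comp by (blast intro: D eqv.Comp_cong)
  qed
  done

lift_definition tns :: "'k::idom mor \<Rightarrow> 'k mor \<Rightarrow> 'k mor" (infixr "\<parallel>" 75) is Tens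
  subgoal premises prems for e e' f f'
  proof -
    note D = same_morD[OF prems(1)] same_morD[OF prems(2)]
    show ?thesis
      unfolding same_mor_def has_type_Tens by (blast intro: D eqv.Tens_cong)
  qed
  done

lift_definition plus :: "'k::idom mor \<Rightarrow> 'k mor \<Rightarrow> 'k mor" is Plus
  subgoal premises prems for e e' f f'
  proof -
    note D = same_morD[OF prems(1)] same_morD[OF prems(2)]
    show ?thesis
      unfolding same_mor_def has_type_Plus by (blast intro: D eqv.Plus_cong)
  qed
  done

lift_definition scale :: "'k::idom \<Rightarrow> 'k mor \<Rightarrow> 'k mor" is Scale
  by (rule same_morI) (simp_all add: has_type_Scale eqv.Scale_cong same_mor_def)

lemma arr_unique: "arr f a b \<Longrightarrow> arr f a' b' \<Longrightarrow> a = a' \<and> b = b'"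
  by transfer (rule has_type_unique)

lemma arr_gen [simp, intro]: "generator_type x = (a, b) \<Longrightarrow> arr (gen x) a b"
  by transfer (rule has_type.intros)
lemma arr_idm [simp, intro]: "arr (idm a) a a"
  by transfer (rule has_type.intros)
lemma arr_zero [simp, intro]: "arr (zero a b) a b"
  by transfer (rule has_type.intros)
lemma arr_cmp [intro]: "arr g b c \<Longrightarrow> arr f a b \<Longrightarrow> arr (g \<cdot> f) a c"
  by transfer (rule has_type.intros)
lemma arr_tns [intro]: "arr f a b \<Longrightarrow> arr g c d \<Longrightarrow> arr (f \<parallel> g) (a @ c) (b @ d)"
  by transfer (rule has_type.intros)
lemma arr_plus [intro]: "arr f a b \<Longrightarrow> arr g a b \<Longrightarrow> arr (plus f g) a b"
  by transfer (rule has_type.intros)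
lemma arr_scale [intro]: "arr f a b \<Longrightarrow> arr (scale r f) a b"
  by transfer (rule has_type.intros)

lemma cmp_assoc: "(h \<cdot> g) \<cdot> f = h \<cdot> (g \<cdot> f)"
proof (transfer, rule same_morI)
  fix f g h :: "(letter, generator, 'k::idom) expr" and a b
  show "typed ((h \<bullet> g) \<bullet> f) a b = typed (h \<bullet> g \<bullet> f) a b"
    by (auto simp: has_type_Comp)
  show "OB_eqv a b ((h \<bullet> g) \<bullet> f) (h \<bullet> g \<bullet> f)" if "typed ((h \<bullet> g) \<bullet> f) a b"
    using that unfolding has_type_Comp by (blast intro: eqv.Comp_assoc)
qed

text \<open>Either side is typed exactly when all three factors are, and ill-typed expressions are
  all equal; hence there is no typing assumption.\<close>

lemma tns_assoc: "(f \<parallel> g) \<parallel> h = f \<parallel> (g \<parallel> h)"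
proof (transfer, rule same_morI)
  fix f g h :: "(letter, generator, 'k::idom) expr" and a b
  have *: "\<exists>a1 a2 a3 b1 b2 b3. a = a1 @ a2 @ a3 \<and> b = b1 @ b2 @ b3 \<and>
      typed f a1 b1 \<and> typed g a2 b2 \<and> typed h a3 b3"
    if "typed ((f \<star> g) \<star> h) a b \<or> typed (f \<star> g \<star> h) a b"
    using that unfolding has_type_Tens by fastforce
  have **: "typed ((f \<star> g) \<star> h) (a1 @ a2 @ a3) (b1 @ b2 @ b3)"
      "typed (f \<star> g \<star> h) (a1 @ a2 @ a3) (b1 @ b2 @ b3)"
    if "typed f a1 b1" "typed g a2 b2" "typed h a3 b3" for a1 a2 a3 b1 b2 b3
    unfolding append_assoc[symmetric, of a1] append_assoc[symmetric, of b1]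
    using that by (blast intro: has_type.intros)
      (unfold append_assoc, blast intro: that has_type.intros)
  show "typed ((f \<star> g) \<star> h) a b = typed (f \<star> g \<star> h) a b"
    using * ** by blast
  show "OB_eqv a b ((f \<star> g) \<star> h) (f \<star> g \<star> h)" if "typed ((f \<star> g) \<star> h) a b"
    using * that by (blast intro: eqv.Tens_assoc)
qed

text \<open>Types are unique, so one derivation at one type settles all types.\<close>

lemma same_mor_typedI:
  assumes "typed e a b" "OB_eqv a b e f"
  shows "same_mor e f"
proof (rule same_morI)
  have f: "typed f a b"
    using eqv_has_type[OF assms(2)] by blast
  show "typed e u v \<longleftrightarrow> typed f u v" for u v
    using has_type_unique assms(1) f by metis
  show "OB_eqv u v e f" if "typed e u v" for u v
    using has_type_unique[OF assms(1) that] assms(2) by simp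
qed

lemma idm_cmp [simp]: "arr f a b \<Longrightarrow> idm b \<cdot> f = f"
  by transfer (metis same_mor_typedI eqv.Ident_left eqv_has_type)

lemma cmp_idm [simp]: "arr f a b \<Longrightarrow> f \<cdot> idm a = f"
  by transfer (metis same_mor_typedI eqv.Ident_right eqv_has_type)

lemma idm_Nil_tns [simp]: "idm [] \<parallel> f = f"
proof (transfer, rule same_morI)
  fix f :: "(letter, generator, 'k::idom) expr" and a b
  show "typed (Ident [] \<star> f) a b = typed f a b"
    using has_type.intros(4)[OF has_type.intros(2)[of generator_type "[]"]]
    unfolding has_type_Tens has_type_Ident by fastforce
qed (rule eqv.Tens_unit_left)

lemma tns_idm_Nil [simp]: "f \<parallel> idm [] = f"
proof (transfer, rule same_morI)
  fix f :: "(letter, generator, 'k::idom) expr" and a b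
  show "typed (f \<star> Ident []) a b = typed f a b"
  proof
    show "typed (f \<star> Ident []) a b" if "typed f a b"
      using has_type.intros(4)[OF that has_type.intros(2)[of generator_type "[]"]] by simp
    show "typed f a b" if "typed (f \<star> Ident []) a b"
      using that unfolding has_type_Tens has_type_Ident by (elim exE conjE) simp
  qed
qed (rule eqv.Tens_unit_right)

lemma idm_tns_idm [simp]: "idm a \<parallel> idm b = idm (a @ b)"
proof transfer
  fix a b
  show "same_mor (Ident a \<star> Ident b :: (letter, generator, 'k::idom) expr) (Ident (a @ b))"
    by (rule same_mor_typedI[OF _ eqv.Tens_Ident]) (intro has_type.intros)
qed

lemma interchange:
  assumes "arr g b c" "arr f a b" "arr g' q r" "arr f' p q"
  shows "(g \<cdot> f) \<parallel> (g' \<cdot> f') = (g \<parallel> g') \<cdot> (f \<parallel> f')"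
  using assms
proof transfer
  fix g f g' f' :: "(letter, generator, 'k::idom) expr" and a b c p q r
  assume t: "typed g b c" "typed f a b" "typed g' q r" "typed f' p q"
  show "same_mor ((g \<bullet> f) \<star> (g' \<bullet> f')) ((g \<star> g') \<bullet> (f \<star> f'))" 
    by (rule same_mor_typedI[OF _ eqv.Interchange[OF t]])
      (rule has_type.intros(4)[OF has_type.intros(3)[OF t(1,2)] has_type.intros(3)[OF t(3,4)]])
qed

lemma cmp_subst: "g \<cdot> f = k \<Longrightarrow> g \<cdot> (f \<cdot> h) = k \<cdot> h"
  by (metis cmp_assoc)

section \<open>Whiskering: a morphism with identity strands on both sides\<close>

definition wh :: "letter list \<Rightarrow> 'k::idom mor \<Rightarrow> letter list \<Rightarrow> 'k mor" where
  "wh u f v = idm u \<parallel> f \<parallel> idm v"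

lemma arr_wh: "arr f a b \<Longrightarrow> arr (wh u f v) (u @ a @ v) (u @ b @ v)"
  unfolding wh_def by (intro arr_tns arr_idm)

lemma arr_whI: "arr f a b \<Longrightarrow> x = u @ a @ v \<Longrightarrow> y = u @ b @ v \<Longrightarrow> arr (wh u f v) x y"
  using arr_wh by blast

lemma wh_Nil [simp]: "wh [] f [] = f"
  by (simp add: wh_def)

lemma wh_wh [simp]: "wh u (wh u' f v') v = wh (u @ u') f (v' @ v)"
  unfolding wh_def by (metis tns_assoc idm_tns_idm)

lemma wh_idm [simp]: "wh u (idm w) v = idm (u @ w @ v)"
  by (simp add: wh_def)

lemma idm_tns: "idm u \<parallel> f = wh u f []"
  by (simp add: wh_def)

lemma tns_idm: "f \<parallel> idm v = wh [] f v"
  by (simp add: wh_def)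

lemma wh_cmp:
  assumes "arr g b c" "arr f a b"
  shows "wh u (g \<cdot> f) v = wh u g v \<cdot> wh u f v"
proof -
  have "(g \<cdot> f) \<parallel> (idm v \<cdot> idm v) = (g \<parallel> idm v) \<cdot> (f \<parallel> idm v)"
    by (rule interchange) (use assms in auto)
  moreover have "(idm u \<cdot> idm u) \<parallel> ((g \<parallel> idm v) \<cdot> (f \<parallel> idm v)) = wh u g v \<cdot> wh u f v"
    unfolding wh_def by (rule interchange) (use assms in \<open>auto intro!: arr_tns\<close>)
  ultimately show ?thesis
    by (simp add: wh_def idm_cmp[OF arr_idm])
qed

lemma tns_wh:
  assumes "arr f a b" "arr g c d"
  shows "f \<parallel> g = wh [] f d \<cdot> wh a g []" "f \<parallel> g = wh b g [] \<cdot> wh [] f c"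
proof -
  have "(f \<cdot> idm a) \<parallel> (idm d \<cdot> g) = (f \<parallel> idm d) \<cdot> (idm a \<parallel> g)"
       "(idm b \<cdot> f) \<parallel> (g \<cdot> idm c) = (idm b \<parallel> g) \<cdot> (f \<parallel> idm c)"
    by (rule interchange; use assms in auto)+
  then show "f \<parallel> g = wh [] f d \<cdot> wh a g []" "f \<parallel> g = wh b g [] \<cdot> wh [] f c"
    using assms by (simp_all add: wh_def)
qed

text \<open>Morphisms that act on disjoint blocks of letters, with \<open>v\<close> in between, can
  be applied in either order. This is the isotopy used throughout; it reduces to the interchange law
  for \<open>f\<close> and the whiskered \<open>g\<close>.\<close>

lemma wh_commute:
  assumes "arr f a b" "arr g c d"
  shows "wh u f (v @ d @ w) \<cdot> wh (u @ a @ v) g w = wh (u @ b @ v) g w \<cdot> wh u f (v @ c @ w)"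
proof -
  have g: "arr (wh v g w) (v @ c @ w) (v @ d @ w)"
    using assms(2) by (rule arr_wh)
  have 1: "wh [] f (v @ d @ w) \<cdot> wh a (wh v g w) [] = wh b (wh v g w) [] \<cdot> wh [] f (v @ c @ w)"
    using tns_wh[OF assms(1) g] by simp
  have "wh u (wh [] f (v @ d @ w) \<cdot> wh a (wh v g w) []) [] =
      wh u (wh [] f (v @ d @ w)) [] \<cdot> wh u (wh a (wh v g w) []) []"
    by (rule wh_cmp) (rule arr_whI[OF assms(1)] arr_whI[OF g] refl append_Nil append_Nil2 | simp)+
  moreover have "wh u (wh b (wh v g w) [] \<cdot> wh [] f (v @ c @ w)) [] =
      wh u (wh b (wh v g w) []) [] \<cdot> wh u (wh [] f (v @ c @ w)) []"
    by (rule wh_cmp) (rule arr_whI[OF assms(1)] arr_whI[OF g] refl append_Nil append_Nil2 | simp)+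
  ultimately show ?thesis
    using 1 by (metis wh_wh append_Nil append_Nil2 append_assoc)
qed

subsection \<open>Crossings, cups and caps\<close>

fun bar :: "letter \<Rightarrow> letter" where
  "bar \<up> = \<down>" | "bar \<down> = \<up>"

lemma bar_bar [simp]: "bar (bar x) = x"
  by (cases x) auto

lemma bar_neq [simp]: "bar x \<noteq> x" "x \<noteq> bar x"
  by (cases x; simp)+

lemma neq_bar: "x \<noteq> y \<Longrightarrow> y = bar x"
  by (cases x; cases y; simp)

text \<open>\<open>rot z B\<close> turns a crossing \<open>z \<up> \<rightarrow> \<up> z\<close> into a crossing \<open>\<down> z \<rightarrow> z \<down>\<close>.\<close>

definition rot :: "letter \<Rightarrow> 'k::idom mor \<Rightarrow> 'k mor" where
  "rot z B = wh [] (gen Gd) [z, \<down>] \<cdot> wh [\<down>] B [\<down>] \<cdot> wh [\<down>, z] (gen Gc) []"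

text \<open>\<open>cross y x\<close> runs from the word \<open>y\<close> \<open>x\<close> to the
  word \<open>x\<close> \<open>y\<close>. With a downward strand on the left it is obtained by
  rotation; the remaining mixed crossing is \<open>t\<close>, the formal inverse of the rotated
  \<open>s\<close>.\<close>

fun cross :: "letter \<Rightarrow> letter \<Rightarrow> 'k::idom mor" where
  "cross \<up> \<up> = gen Gs"
| "cross \<up> \<down> = gen Gt"
| "cross \<down> \<up> = rot \<up> (gen Gs)"
| "cross \<down> \<down> = rot \<down> (rot \<up> (gen Gs))"

text \<open>\<open>eta x\<close> creates \<open>bar x\<close> to the left of \<open>x\<close>. The
  presentation has a cup and a cap of one orientation each as generators; the other orientation is
  obtained by composing with the crossing \<open>t\<close>.\<close>

fun eta :: "letter \<Rightarrow> 'k::idom mor" where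
  "eta \<down> = gen Gc"
| "eta \<up> = gen Gt \<cdot> gen Gc"

fun eps :: "letter \<Rightarrow> 'k::idom mor" where
  "eps \<down> = gen Gd"
| "eps \<up> = gen Gd \<cdot> gen Gt"

lemma arr_rot: "arr B [z, \<up>] [\<up>, z] \<Longrightarrow> arr (rot z B) [\<down>, z] [z, \<down>]"
  unfolding rot_def
  by (rule arr_cmp[where b = "[\<down>, \<up>, z, \<down>]"] arr_cmp[where b = "[\<down>, z, \<up>, \<down>]"]
      arr_whI arr_gen | assumption | simp)+

lemma arr_cross: "arr (cross y x) [y, x] [x, y]"
  by (cases y; cases x) (auto intro!: arr_rot)

lemma arr_eta: "arr (eta x) [] [bar x, x]"
  by (cases x) (auto intro!: arr_cmp[where b = "[\<up>, \<down>]"])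

lemma arr_eps: "arr (eps x) [x, bar x] []"
  by (cases x) (auto intro!: arr_cmp[where b = "[\<down>, \<up>]"])

lemma idm_tns_idm_tns [simp]: "idm u \<parallel> (idm v \<parallel> f) = idm (u @ v) \<parallel> f"
  by (metis tns_assoc idm_tns_idm)


section \<open>The defining relations as equations between morphisms\<close>

lemma abs_mor_simps:
  "abs_mor (Gen x) = gen x" "abs_mor (Ident w) = idm w"
  "abs_mor (f \<bullet> g) = abs_mor f \<cdot> abs_mor g" "abs_mor (f \<star> g) = abs_mor f \<parallel> abs_mor g"
  by (simp_all add: gen.abs_eq idm.abs_eq cmp.abs_eq tns.abs_eq)

lemma arr_abs_mor: "arr (abs_mor f) a b \<longleftrightarrow> typed f a b"
  by (simp add: arr.abs_eq)

lemma rel_eq: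
  assumes "(f, g) \<in> OB_relations" "arr (abs_mor f) a b" "arr (abs_mor g) a b"
  shows "abs_mor f = abs_mor g"
  using assms(2,3) unfolding arr_abs_mor
  by (intro mor.abs_eq_iff[THEN iffD2] same_mor_typedI eqv.relation assms(1))

lemma abs_rotated_s: "abs_mor rotated_s = rot \<up> (gen Gs)"
  by (simp add: rotated_s_def rot_def abs_mor_simps wh_def)

lemma zigzag_up: "wh [\<up>] (eps \<down>) [] \<cdot> wh [] (eta \<down>) [\<up>] = idm [\<up>]"
proof -
  have "abs_mor ((upG \<star> dG) \<bullet> (cG \<star> upG)) = abs_mor (upG :: (letter, generator, 'k::idom) expr)"
    by (rule rel_eq[of _ _ "[\<up>]" "[\<up>]"])
      (auto simp: OB_relations_def abs_mor_simps idm_tns tns_idm intro!: arr_cmp[where b = "[\<up>, \<down>, \<up>]"] arr_whI)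
  then show ?thesis by (simp add: abs_mor_simps wh_def)
qed

lemma zigzag_down: "wh [] (eps \<down>) [\<down>] \<cdot> wh [\<down>] (eta \<down>) [] = idm [\<down>]"
proof -
  have "abs_mor ((dG \<star> downG) \<bullet> (downG \<star> cG)) = abs_mor (downG :: (letter, generator, 'k::idom) expr)"
    by (rule rel_eq[of _ _ "[\<down>]" "[\<down>]"])
      (auto simp: OB_relations_def abs_mor_simps idm_tns tns_idm intro!: arr_cmp[where b = "[\<down>, \<up>, \<down>]"] arr_whI)
  then show ?thesis by (simp add: abs_mor_simps wh_def)
qed

lemma cross_up_up: "cross \<up> \<up> \<cdot> cross \<up> \<up> = idm [\<up>, \<up>]"
proof -
  have "abs_mor (sG \<bullet> sG) = abs_mor (upG \<star> upG :: (letter, generator, 'k::idom) expr)"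
    by (rule rel_eq[of _ _ "[\<up>, \<up>]" "[\<up>, \<up>]"])
      (auto simp: OB_relations_def abs_mor_simps intro!: arr_cmp[where b = "[\<up>, \<up>]"] arr_gen)
  then show ?thesis by (simp add: abs_mor_simps)
qed

lemma braid_up:
  "wh [\<up>] (cross \<up> \<up>) [] \<cdot> (wh [] (cross \<up> \<up>) [\<up>] \<cdot> wh [\<up>] (cross \<up> \<up>) []) =
   wh [] (cross \<up> \<up>) [\<up>] \<cdot> (wh [\<up>] (cross \<up> \<up>) [] \<cdot> wh [] (cross \<up> \<up>) [\<up>])"
proof -
  have s: "arr (wh [\<up>] (gen Gs) []) [\<up>, \<up>, \<up>] [\<up>, \<up>, \<up>]"
    "arr (wh [] (gen Gs) [\<up>]) [\<up>, \<up>, \<up>] [\<up>, \<up>, \<up>]"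
    by (auto intro!: arr_whI arr_gen)
  have "abs_mor ((upG \<star> sG) \<bullet> (sG \<star> upG) \<bullet> (upG \<star> sG)) =
      abs_mor ((sG \<star> upG) \<bullet> (upG \<star> sG) \<bullet> (sG \<star> upG) :: (letter, generator, 'k::idom) expr)"
    by (rule rel_eq[of _ _ "[\<up>, \<up>, \<up>]" "[\<up>, \<up>, \<up>]"])
      (simp add: OB_relations_def,
       (unfold abs_mor_simps idm_tns tns_idm, (rule arr_cmp s)+))
  then show ?thesis by (simp add: abs_mor_simps wh_def)
qed

lemma cross_up_down: "cross \<up> \<down> \<cdot> cross \<down> \<up> = idm [\<down>, \<up>]"
proof -
  have "abs_mor (tG \<bullet> rotated_s) = abs_mor (downG \<star> upG :: (letter, generator, 'k::idom) expr)"
    by (rule rel_eq[of _ _ "[\<down>, \<up>]" "[\<down>, \<up>]"])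
      (auto simp: OB_relations_def abs_mor_simps abs_rotated_s
        intro!: arr_cmp[where b = "[\<up>, \<down>]"] arr_gen arr_rot)
  then show ?thesis by (simp add: abs_mor_simps abs_rotated_s)
qed

lemma cross_down_up: "cross \<down> \<up> \<cdot> cross \<up> \<down> = idm [\<up>, \<down>]"
proof -
  have "abs_mor (rotated_s \<bullet> tG) = abs_mor (upG \<star> downG :: (letter, generator, 'k::idom) expr)"
    by (rule rel_eq[of _ _ "[\<up>, \<down>]" "[\<up>, \<down>]"])
      (auto simp: OB_relations_def abs_mor_simps abs_rotated_s
        intro!: arr_cmp[where b = "[\<down>, \<up>]"] arr_gen arr_rot)
  then show ?thesis by (simp add: abs_mor_simps abs_rotated_s)
qed

text \<open>From now on the crossings are only used through their properties.\<close>

lemma cross_rot: "cross \<down> z = wh [] (eps \<down>) [z, \<down>] \<cdot> (wh [\<down>] (cross z \<up>) [\<down>] \<cdot> wh [\<down>, z] (eta \<down>) [])"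
  by (cases z) (simp_all add: rot_def)

lemma eta_up: "eta \<up> = cross \<up> \<down> \<cdot> eta \<down>" and eps_up: "eps \<up> = eps \<down> \<cdot> cross \<up> \<down>"
  by simp_all

declare cross.simps [simp del] eta.simps [simp del] eps.simps [simp del]

subsection \<open>Naturality\<close>

primrec slide :: "letter list \<Rightarrow> letter \<Rightarrow> 'k::idom mor" where
  "slide [] x = idm [x]"
| "slide (y # v) x = wh [] (cross y x) v \<cdot> wh [y] (slide v x) []"

lemma arr_slide: "arr (slide v x) (v @ [x]) (x # v)"
proof (induction v)
  case (Cons y v)
  show ?case
    unfolding slide.simps
    by (rule arr_cmp[where b = "y # x # v"])
      (rule arr_whI[OF arr_cross] arr_whI[OF Cons.IH]; simp)+
qed simp

declare slide.simps(2) [simp del]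

lemma wh_slide_Cons:
  "wh p (slide (y # v) x) q = (wh p (cross y x) (v @ q) \<cdot> wh (p @ [y]) (slide v x) q :: 'k::idom mor)"
proof -
  have "wh p (slide (y # v) x :: 'k mor) q = wh p (wh [] (cross y x) v) q \<cdot> wh p (wh [y] (slide v x) []) q"
    unfolding slide.simps by (rule wh_cmp[OF arr_wh[OF arr_cross] arr_whI[OF arr_slide]]) simp_all
  then show ?thesis by simp
qed

lemma slide_append: "slide (u @ v) x = (wh [] (slide u x) v \<cdot> wh u (slide v x) [] :: 'k::idom mor)"
proof (induction u)
  case Nil
  show ?case by (simp add: idm_cmp[OF arr_slide])
next
  case (Cons y u)
  have "wh [y] (slide (u @ v) x :: 'k mor) [] = wh [y] (slide u x) v \<cdot> wh (y # u) (slide v x) []"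
    unfolding Cons.IH
    by (subst wh_cmp[OF arr_whI[OF arr_slide] arr_wh[OF arr_slide]]) simp_all
  then show ?case
    by (simp add: wh_slide_Cons slide.simps(2)[of y "u @ v"] cmp_assoc)
qed

text \<open>A strand \<open>x\<close> that starts to the right of \<open>f\<close> and ends to its
  left may cross before or after \<open>f\<close> is applied.\<close>

definition natural :: "letter \<Rightarrow> 'k::idom mor \<Rightarrow> letter list \<Rightarrow> letter list \<Rightarrow> bool" where
  "natural x f a b \<longleftrightarrow> arr f a b \<and> slide b x \<cdot> wh [] f [x] = wh [x] f [] \<cdot> slide a x"

lemma natural_idm: "natural x (idm a) a a"
  by (simp add: natural_def cmp_idm[OF arr_slide] idm_cmp[OF arr_slide])

lemma natural_cmp:
  assumes "natural x g b c" "natural x f a b"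
  shows "natural x (g \<cdot> f) a c"
proof -
  have f: "arr f a b" "slide b x \<cdot> wh [] f [x] = wh [x] f [] \<cdot> slide a x"
    and g: "arr g b c" "slide c x \<cdot> wh [] g [x] = wh [x] g [] \<cdot> slide b x"
    using assms unfolding natural_def by auto
  show ?thesis
    unfolding natural_def wh_cmp[OF g(1) f(1)]
    by (simp add: cmp_assoc cmp_subst[OF g(2)] f arr_cmp[OF g(1) f(1)])
qed

text \<open>The strand passes \<open>v\<close>, then the letters of \<open>f\<close>, then
  \<open>u\<close>. Its passages over \<open>u\<close> and \<open>v\<close> act on letters disjoint
  from those of \<open>f\<close>, so only the middle passage uses the assumption.\<close>

lemma natural_wh:
  fixes f :: "'k::idom mor"
  assumes "natural x f a b"
  shows "natural x (wh u f v) (u @ a @ v) (u @ b @ v)"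
proof -
  have f: "arr f a b" "slide b x \<cdot> wh [] f [x] = wh [x] f [] \<cdot> slide a x"
    using assms unfolding natural_def by auto
  have "wh u (slide b x \<cdot> wh [] f [x]) v = wh u (slide b x) v \<cdot> wh u f (x # v)"
    by (subst wh_cmp[OF arr_slide arr_whI[OF f(1)]]) simp_all
  moreover have "wh u (wh [x] f [] \<cdot> slide a x) v = wh (u @ [x]) f v \<cdot> wh u (slide a x) v"
    by (subst wh_cmp[OF arr_whI[OF f(1)] arr_slide]) simp_all
  ultimately have 1: "wh u (slide b x) v \<cdot> wh u f (x # v) = wh (u @ [x]) f v \<cdot> wh u (slide a x) v"
    using f(2) by simp
  have 2: "wh u f (x # v) \<cdot> wh (u @ a) (slide v x) [] = wh (u @ b) (slide v x) [] \<cdot> wh u f (v @ [x])"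
    by (rule wh_commute[OF f(1) arr_slide[of v x], of u "[]" "[]", simplified])
  have 3: "wh [] (slide u x) (b @ v) \<cdot> wh (u @ [x]) f v = wh (x # u) f v \<cdot> wh [] (slide u x) (a @ v)"
    by (rule wh_commute[OF arr_slide[of u x] f(1), of "[]" "[]" v, simplified])
  have s: "(slide (u @ c @ v) x :: 'k mor) = wh [] (slide u x) (c @ v) \<cdot> (wh u (slide c x) v \<cdot> wh (u @ c) (slide v x) [])"
    for c :: "letter list"
    unfolding slide_append[of u] slide_append[of c]
    by (subst wh_cmp[OF arr_wh[OF arr_slide] arr_whI[OF arr_slide]]) simp_all
  show ?thesis
    unfolding natural_def s using f(1)
    by (auto intro: arr_wh simp: cmp_assoc 2[symmetric] cmp_subst[OF 1] cmp_subst[OF 3] 1 3)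
qed

text \<open>Multiply the naturality equation of \<open>f\<close> by \<open>g\<close> on both
  sides.\<close>

lemma natural_inverse:
  assumes "natural x f a b" "arr g b a" "f \<cdot> g = idm b" "g \<cdot> f = idm a"
  shows "natural x g b a"
proof -
  have f: "arr f a b" "slide b x \<cdot> wh [] f [x] = wh [x] f [] \<cdot> slide a x"
    using assms(1) unfolding natural_def by auto
  have 1: "wh [x] g [] \<cdot> wh [x] f [] = idm (x # a)" "wh [] f [x] \<cdot> wh [] g [x] = idm (b @ [x])"
    by (simp_all add: wh_cmp[symmetric, OF assms(2) f(1)] wh_cmp[symmetric, OF f(1) assms(2)] assms)
  have "slide a x \<cdot> wh [] g [x] = idm (x # a) \<cdot> slide a x \<cdot> wh [] g [x]"
    by (rule idm_cmp[symmetric]) (rule arr_cmp arr_slide arr_whI[OF assms(2)] refl | simp)+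
  also have "\<dots> = wh [x] g [] \<cdot> (wh [x] f [] \<cdot> slide a x) \<cdot> wh [] g [x]"
    by (simp add: 1[symmetric] cmp_assoc)
  also have "\<dots> = wh [x] g [] \<cdot> slide b x \<cdot> wh [] f [x] \<cdot> wh [] g [x]"
    by (simp add: f(2)[symmetric] cmp_assoc)
  also have "\<dots> = wh [x] g [] \<cdot> slide b x"
    by (simp add: 1 cmp_idm[OF arr_slide])
  finally show ?thesis using assms(2) by (simp add: natural_def)
qed

lemma wh_inverse:
  assumes "g \<cdot> f = idm a" "arr g b a" "arr f a b"
  shows "wh u g v \<cdot> wh u f v = idm (u @ a @ v)"
  by (simp add: wh_cmp[OF assms(2,3), symmetric] assms(1))

lemma cancel_left: "g \<cdot> f = idm b \<Longrightarrow> arr e b c \<Longrightarrow> e \<cdot> (g \<cdot> (f \<cdot> h)) = e \<cdot> h"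
  by (metis cmp_assoc cmp_idm)

lemma cancel: "g \<cdot> f = idm b \<Longrightarrow> arr h a b \<Longrightarrow> g \<cdot> (f \<cdot> h) = h"
  by (simp add: cmp_subst)

lemma cross_up: "cross \<up> z \<cdot> cross z \<up> = idm [z, \<up>]" "cross z \<up> \<cdot> cross \<up> z = idm [\<up>, z]"
  by (cases z; simp add: cross_up_up cross_up_down cross_down_up)+

lemma wh_zigzag_up: "wh (u @ [\<up>]) (eps \<down>) v \<cdot> wh u (eta \<down>) (\<up> # v) = (idm (u @ \<up> # v) :: 'k::idom mor)"
  using wh_cmp[OF arr_wh[OF arr_eps, of "[\<up>]" \<down> "[]"] arr_whI[OF arr_eta, of "[\<up>]" "[]" "[\<up>]" _ \<down>],
     unfolded zigzag_up, of u v, where 'a = 'k] by simp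

lemma wh_zigzag_down: "wh u (eps \<down>) (\<down> # v) \<cdot> wh (u @ [\<down>]) (eta \<down>) v = (idm (u @ \<down> # v) :: 'k::idom mor)"
  using wh_cmp[OF arr_wh[OF arr_eps, of "[]" \<down> "[\<down>]"] arr_whI[OF arr_eta, of "[\<down>]" "[\<down>]" "[]" _ \<down>],
     unfolded zigzag_down, of u v, where 'a = 'k] by simp

lemma slide_two: "slide [y, z] x = wh [] (cross y x) [z] \<cdot> wh [y] (cross z x) []"
  using cmp_idm[OF arr_whI[OF arr_cross, of "[y, z, x]" "[y]" z x "[]"]]
  by (simp add: slide.simps(2) wh_slide_Cons cmp_idm[OF arr_cross])

lemma slide_one: "slide [y] x = cross y x"
  by (simp add: slide.simps(2) cmp_idm[OF arr_cross])

lemma wh_natural: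
  assumes "natural x f a b"
  shows "wh u (slide b x) v \<cdot> wh u f (x # v) = wh (u @ [x]) f v \<cdot> wh u (slide a x) v"
proof -
  have f: "arr f a b" "slide b x \<cdot> wh [] f [x] = wh [x] f [] \<cdot> slide a x"
    using assms unfolding natural_def by auto
  have "wh u (slide b x \<cdot> wh [] f [x]) v = wh u (slide b x) v \<cdot> wh u f (x # v)"
    by (subst wh_cmp[OF arr_slide arr_whI[OF f(1)]]) simp_all
  moreover have "wh u (wh [x] f [] \<cdot> slide a x) v = wh (u @ [x]) f v \<cdot> wh u (slide a x) v"
    by (subst wh_cmp[OF arr_whI[OF f(1)] arr_slide]) simp_all
  ultimately show ?thesis
    using f(2) by simp
qed

lemma wh_slide_two: "wh u (slide [y, z] x) v = wh u (cross y x) (z # v) \<cdot> wh (u @ [y]) (cross z x) v"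
  unfolding slide_two
  by (subst wh_cmp[OF arr_wh[OF arr_cross] arr_whI[OF arr_cross]]) simp_all

lemma wh_cross_down:
  "wh u (cross \<down> z) v = (wh u (eps \<down>) (z # \<down> # v) \<cdot>
    (wh (u @ [\<down>]) (cross z \<up>) (\<down> # v) \<cdot> wh (u @ [\<down>, z]) (eta \<down>) v) :: 'k::idom mor)"
proof -
  have a: "arr (wh [\<down>] (cross z \<up>) [\<down>] :: 'k mor) [\<down>, z, \<up>, \<down>] [\<down>, \<up>, z, \<down>]"
    "arr (wh [\<down>, z] (eta \<down>) [] :: 'k mor) [\<down>, z] [\<down>, z, \<up>, \<down>]"
    "arr (wh [] (eps \<down>) [z, \<down>] :: 'k mor) [\<down>, \<up>, z, \<down>] [z, \<down>]"
    by (rule arr_whI[OF arr_cross] arr_whI[OF arr_eta] arr_whI[OF arr_eps]; simp)+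
  show ?thesis
    unfolding cross_rot wh_cmp[OF a(3) arr_cmp[OF a(1,2)]] wh_cmp[OF a(1,2)] by simp
qed

text \<open>The crossing of \<open>z\<close> with the downward leg is by construction a rotated
  crossing of \<open>z\<close> with an upward strand. A zigzag straightens the rotation and leaves
  two crossings of \<open>z\<close> with an upward strand, which are inverse to each other.\<close>

lemma natural_eta_down: "natural z (eta \<down> :: 'k::idom mor) [] [\<up>, \<down>]"
proof -
  note c1 = wh_commute[OF arr_eta[of \<down>] arr_eta[of \<down>], of "[]" "[z]" "[]", simplified]
  note c2 = wh_commute[OF arr_eta[of \<down>] arr_cross[of z \<up>], of "[]" "[]" "[\<down>]", simplified]
  have a: "arr (wh [] (cross \<up> z) [\<down>] :: 'k mor) [\<up>, z, \<down>] [z, \<up>, \<down>]"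
    "arr (wh [z] (eta \<down>) [] :: 'k mor) [z] [z, \<up>, \<down>]"
    by (rule arr_whI[OF arr_cross] arr_whI[OF arr_eta]; simp)+
  have "(wh [] (cross \<up> z) [\<down>] \<cdot> wh [\<up>] (cross \<down> z) []) \<cdot> wh [] (eta \<down>) [z] = 
    wh [] (cross \<up> z) [\<down>] \<cdot> (wh [] (cross z \<up>) [\<down>] \<cdot> (wh [z] (eta \<down>) [] :: 'k mor))"
    unfolding wh_cross_down
    by (simp only: cmp_assoc append.simps c1[symmetric] cmp_subst[OF c2[symmetric]] 
        cancel_left[OF wh_zigzag_up[of "[]", simplified] a(1)])
  also have "\<dots> = wh [z] (eta \<down>) []"
    by (rule cancel[OF wh_inverse[OF cross_up(1) arr_cross arr_cross]]) (use a(2) in simp)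
  finally show ?thesis
    using cmp_idm[OF a(2)] by (simp add: natural_def slide_two arr_eta[of \<down>, simplified])
qed

lemma natural_eps_down: "natural z (eps \<down> :: 'k::idom mor) [\<down>, \<up>] []"
proof -
  note c1 = wh_commute[OF arr_eps[of \<down>] arr_eps[of \<down>], of "[]" "[z]" "[]", simplified]
  note c2 = wh_commute[OF arr_cross[of z \<up>] arr_eps[of \<down>], of "[\<down>]" "[]" "[]", simplified]
  have a: "arr (wh [\<down>] (cross \<up> z) [] :: 'k mor) [\<down>, \<up>, z] [\<down>, z, \<up>]"
    "arr (wh [] (eps \<down>) [z] :: 'k mor) [\<down>, \<up>, z] [z]"
    by (rule arr_whI[OF arr_cross] arr_whI[OF arr_eps]; simp)+
  have "wh [z] (eps \<down>) [] \<cdot> (wh [] (cross \<down> z) [\<up>] \<cdot> (wh [\<down>] (cross \<up> z) [] :: 'k mor)) =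
    wh [] (eps \<down>) [z] \<cdot> (wh [\<down>] (cross z \<up>) [] \<cdot> wh [\<down>] (cross \<up> z) [])"
    unfolding wh_cross_down
    by (simp only: cmp_assoc append.simps cmp_subst[OF c1[symmetric]] cmp_subst[OF c2[symmetric]] 
        cancel[OF wh_zigzag_up[of "[\<down>, z]" "[]", simplified] a(1)])
  also have "\<dots> = wh [] (eps \<down>) [z]"
    using a(2) by (simp add: wh_inverse[OF cross_up(2) arr_cross arr_cross])
  finally show ?thesis
    using idm_cmp[OF a(2)] by (simp add: natural_def slide_two arr_eps[of \<down>, simplified])
qed

text \<open>The rotated crossing is a composite of a cup, a crossing and a cap, and naturality
  passes to composites.\<close>

lemma natural_cross_down:
  assumes "natural x (cross z \<up> :: 'k::idom mor) [z, \<up>] [\<up>, z]"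
  shows "natural x (cross \<down> z :: 'k mor) [\<down>, z] [z, \<down>]"
  unfolding cross_rot
  by (rule natural_cmp[OF natural_wh[OF natural_eps_down, of x "[]" "[z, \<down>]", simplified]
      natural_cmp[OF natural_wh[OF assms, of "[\<down>]" "[\<down>]", simplified]
        natural_wh[OF natural_eta_down, of x "[\<down>, z]" "[]", simplified]]])

text \<open>For two upward strands this is the braid relation. Rotation gives
  \<open>cross \<down> \<up>\<close>, inversion of that gives \<open>cross \<up> \<down>\<close>,
  and a second rotation gives \<open>cross \<down> \<down>\<close>.\<close>

lemma natural_up: "natural \<up> (cross y z :: 'k::idom mor) [y, z] [z, y]"
proof -
  have 1: "natural \<up> (cross \<up> \<up> :: 'k mor) [\<up>, \<up>] [\<up>, \<up>]"
    by (simp add: natural_def slide_two arr_cross cmp_assoc braid_up)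
  have 2: "natural \<up> (cross \<down> \<up> :: 'k mor) [\<down>, \<up>] [\<up>, \<down>]"
    by (rule natural_cross_down[OF 1])
  have 3: "natural \<up> (cross \<up> \<down> :: 'k mor) [\<up>, \<down>] [\<down>, \<up>]"
    by (rule natural_inverse[OF 2 arr_cross cross_down_up cross_up_down])
  show ?thesis
    using 1 2 3 natural_cross_down[OF 2] by (cases y; cases z; simp)
qed

lemma eta_down_past:
  "wh u (cross \<up> z) (\<down> # v) \<cdot> (wh (u @ [\<up>]) (cross \<down> z) v \<cdot> wh u (eta \<down>) (z # v)) =
   (wh (u @ [z]) (eta \<down>) v :: 'k::idom mor)"
proof -
  have "arr (wh (u @ [z]) (eta \<down>) v :: 'k mor) (u @ z # v) (u @ z # \<up> # \<down> # v)"
    by (rule arr_whI[OF arr_eta]) simp_all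
  then show ?thesis
    using wh_natural[OF natural_eta_down[where 'k = 'k], of u z v] by (simp add: wh_slide_two cmp_assoc)
qed

text \<open>This inverse is not among the relations. Beside a cup, the downward crossing turns into
  the rotated \<open>s\<close> on the other side of the cup (\<open>d_c\<close>), and applying it
  once more leads back to the start because \<open>s\<close> squares to the identity. So the square
  of the crossing is trivial after the left strand has been bent by a cup, and a zigzag bends it
  back.\<close>

lemma cross_down_down: "cross \<down> \<down> \<cdot> cross \<down> \<down> = (idm [\<down>, \<down>] :: 'k::idom mor)"
proof -
  let ?X = "\<lambda>u y z v. wh u (cross y z :: 'k mor) v"
  let ?c = "\<lambda>u v. wh u (eta \<down> :: 'k mor) v" and ?d = "\<lambda>u v. wh u (eps \<down> :: 'k mor) v"
  have arrX: "arr (?X u y z v) (u @ y # z # v) (u @ z # y # v)" for u y z v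
    by (rule arr_whI[OF arr_cross]) simp_all
  have arrc: "arr (?c u v) (u @ v) (u @ \<up> # \<down> # v)" for u v
    by (rule arr_whI[OF arr_eta]) simp_all
  have arrd: "arr (?d u v) (u @ \<down> # \<up> # v) (u @ v)" for u v
    by (rule arr_whI[OF arr_eps]) simp_all
  \<comment> \<open>Naturality of the cup, with the crossing of the upward leg carried to the other
    side by its inverse.\<close>
  have past: "?X (u @ [\<up>]) \<down> z v \<cdot> ?c u (z # v) = ?X u z \<up> (\<down> # v) \<cdot> ?c (u @ [z]) v"
    if "cross z \<up> \<cdot> cross \<up> z = (idm [\<up>, z] :: 'k mor)" for u z v
  proof -
    have "arr (?X (u @ [\<up>]) \<down> z v \<cdot> ?c u (z # v)) (u @ z # v) (u @ \<up> # z # \<down> # v)"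
      by (rule arr_cmp[OF arr_whI[OF arr_cross] arr_whI[OF arr_eta]]) simp_all
    then show ?thesis
      using cancel[OF wh_inverse[OF that arr_cross arr_cross], of _ _ u "\<down> # v"]
      unfolding eta_down_past[symmetric, of u z v] by simp
  qed
  have d_c: "?X [\<up>] \<down> \<down> [] \<cdot> ?c [] [\<down>] = ?X [] \<down> \<up> [\<down>] \<cdot> ?c [\<down>] []"
    using past[OF cross_down_up[where 'a = 'k], of "[]" "[]"] by simp
  have d_c': "?X [\<down>, \<up>, \<up>] \<down> \<down> [] \<cdot> ?c [\<down>, \<up>] [\<down>] = ?X [\<down>, \<up>] \<down> \<up> [\<down>] \<cdot> ?c [\<down>, \<up>, \<down>] []"
    using past[OF cross_down_up[where 'a = 'k], of "[\<down>, \<up>]" "[]"] by simp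
  have u_c': "?X [\<down>, \<up>] \<down> \<up> [\<down>] \<cdot> ?c [\<down>] [\<up>, \<down>] = ?X [\<down>] \<up> \<up> [\<down>, \<down>] \<cdot> ?c [\<down>, \<up>] [\<down>]"
    using past[OF cross_up_up[where 'a = 'k], of "[\<down>]" "[\<down>]"] by simp
  have r: "?X [] \<down> \<up> [\<down>] = ?d [] [\<up>, \<down>, \<down>] \<cdot> (?X [\<down>] \<up> \<up> [\<down>, \<down>] \<cdot> ?c [\<down>, \<up>] [\<down>])"
    using wh_cross_down[where 'k = 'k, of "[]" \<up> "[\<down>]"] by simp
  have 1: "?X [\<up>] \<down> \<down> [] \<cdot> (?X [] \<down> \<up> [\<down>] \<cdot> ?c [\<down>] []) = ?c [] [\<down>]"
  proof -
    have c1: "?X [\<up>] \<down> \<down> [] \<cdot> ?d [] [\<up>, \<down>, \<down>] = ?d [] [\<up>, \<down>, \<down>] \<cdot> ?X [\<down>, \<up>, \<up>] \<down> \<down> []"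
      by (rule wh_commute[OF arr_eps[of \<down>] arr_cross[of \<down> \<down>], of "[]" "[\<up>]" "[]", simplified, symmetric])
    have c2: "?X [\<down>, \<up>, \<up>] \<down> \<down> [] \<cdot> ?X [\<down>] \<up> \<up> [\<down>, \<down>] = ?X [\<down>] \<up> \<up> [\<down>, \<down>] \<cdot> ?X [\<down>, \<up>, \<up>] \<down> \<down> []"
      by (rule wh_commute[OF arr_cross[of \<up> \<up>] arr_cross[of \<down> \<down>], of "[\<down>]" "[]" "[]", simplified, symmetric])
    have c4: "?c [\<down>, \<up>, \<down>] [] \<cdot> ?c [\<down>] [] = ?c [\<down>] [\<up>, \<down>] \<cdot> ?c [\<down>] []"
      by (rule wh_commute[OF arr_eta[of \<down>] arr_eta[of \<down>], of "[\<down>]" "[]" "[]", simplified, symmetric])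
    have c5: "?d [] [\<up>, \<down>, \<down>] \<cdot> ?c [\<down>, \<up>] [\<down>] = ?c [] [\<down>] \<cdot> ?d [] [\<down>]"
      by (rule wh_commute[OF arr_eps[of \<down>] arr_eta[of \<down>], of "[]" "[]" "[\<down>]", simplified])
    have s: "?X [\<down>] \<up> \<up> [\<down>, \<down>] \<cdot> ?X [\<down>] \<up> \<up> [\<down>, \<down>] = idm [\<down>, \<up>, \<up>, \<down>, \<down>]"
      using wh_inverse[OF cross_up_up[where 'a = 'k] arr_cross arr_cross, of "[\<down>]" "[\<down>, \<down>]"] by simp
    have "?X [\<up>] \<down> \<down> [] \<cdot> (?X [] \<down> \<up> [\<down>] \<cdot> ?c [\<down>] []) =
      ?d [] [\<up>, \<down>, \<down>] \<cdot> (?X [\<down>] \<up> \<up> [\<down>, \<down>] \<cdot> (?X [\<down>] \<up> \<up> [\<down>, \<down>] \<cdot> (?c [\<down>, \<up>] [\<down>] \<cdot> ?c [\<down>] [])))"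
      unfolding r
      by (simp only: cmp_assoc cmp_subst[OF c1] cmp_subst[OF c2] cmp_subst[OF d_c'] c4 cmp_subst[OF u_c'])
    \<comment> \<open>The first \<open>s\<close> comes from the rotated crossing, the second from
      moving the cup past it; they cancel.\<close>
    also have "\<dots> = ?d [] [\<up>, \<down>, \<down>] \<cdot> (?c [\<down>, \<up>] [\<down>] \<cdot> ?c [\<down>] [])"
      by (rule cancel_left[OF s]) (rule arrd[of "[]", simplified])
    also have "\<dots> = ?c [] [\<down>] \<cdot> (?d [] [\<down>] \<cdot> ?c [\<down>] [])"
      by (simp only: cmp_subst[OF c5] cmp_assoc)
    also have "\<dots> = ?c [] [\<down>]"
      using arrc[of "[]" "[\<down>]"] zigzag_down[where 'a = 'k] by (simp add: cmp_idm)
    finally show ?thesis .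
  qed
  have 2: "?X [\<up>] \<down> \<down> [] \<cdot> (?X [\<up>] \<down> \<down> [] \<cdot> ?c [] [\<down>]) = ?c [] [\<down>]"
    by (simp only: d_c 1)
  have "wh [\<down>] (?X [\<up>] \<down> \<down> [] \<cdot> (?X [\<up>] \<down> \<down> [] \<cdot> ?c [] [\<down>])) [] =
     ?X [\<down>, \<up>] \<down> \<down> [] \<cdot> (?X [\<down>, \<up>] \<down> \<down> [] \<cdot> ?c [\<down>] [\<down>])"
    using wh_cmp[OF arrX[of "[\<up>]" \<down> \<down> "[]", simplified] arr_cmp[OF arrX[of "[\<up>]" \<down> \<down> "[]", simplified] arrc[of "[]" "[\<down>]", simplified]], of "[\<down>]" "[]"]
     wh_cmp[OF arrX[of "[\<up>]" \<down> \<down> "[]", simplified]  arrc[of "[]" "[\<down>]", simplified], of "[\<down>]" "[]"]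
    by simp
  then have 3: "?X [\<down>, \<up>] \<down> \<down> [] \<cdot> (?X [\<down>, \<up>] \<down> \<down> [] \<cdot> ?c [\<down>] [\<down>]) = ?c [\<down>] [\<down>]"
    unfolding 2 by simp
  have c6: "cross \<down> \<down> \<cdot> ?d [] [\<down>, \<down>] = ?d [] [\<down>, \<down>] \<cdot> ?X [\<down>, \<up>] \<down> \<down> []"
    by (rule wh_commute[OF arr_eps[of \<down>] arr_cross[of \<down> \<down>], of "[]" "[]" "[]", simplified, symmetric])
  have zz: "?d [] [\<down>, \<down>] \<cdot> ?c [\<down>] [\<down>] = idm [\<down>, \<down>]"
    using wh_zigzag_down[where 'k = 'k, of "[]" "[\<down>]"] by simp
  have "cross \<down> \<down> \<cdot> cross \<down> \<down> = cross \<down> \<down> \<cdot> (cross \<down> \<down> \<cdot> (?d [] [\<down>, \<down>] \<cdot> ?c [\<down>] [\<down>]))"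
    unfolding zz by (simp add: cmp_idm[OF arr_cross])
  also have "\<dots> = ?d [] [\<down>, \<down>] \<cdot> (?X [\<down>, \<up>] \<down> \<down> [] \<cdot> (?X [\<down>, \<up>] \<down> \<down> [] \<cdot> ?c [\<down>] [\<down>]))"
    by (simp only: cmp_subst[OF c6] cmp_assoc)
  also have "\<dots> = idm [\<down>, \<down>]"
    by (simp only: 3 zz)
  finally show ?thesis by simp
qed

lemma cross_inverse: "cross x y \<cdot> cross y x = idm [y, x]"
  by (cases x; cases y; simp add: cross_up_up cross_up_down cross_down_up cross_down_down)

lemmas wh_cross_inverse = wh_inverse[OF cross_inverse arr_cross arr_cross, simplified]

text \<open>Naturality of a crossing is the Yang-Baxter equation for the three letters.\<close>

lemma natural_cross_cross:
  "natural x (cross y z :: 'k::idom mor) [y, z] [z, y] \<longleftrightarrow>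
    (wh [] (cross z x :: 'k mor) [y] \<cdot> (wh [z] (cross y x) [] \<cdot> wh [] (cross y z) [x])) =
    wh [x] (cross y z) [] \<cdot> (wh [] (cross y x) [z] \<cdot> wh [y] (cross z x) [])"
  by (simp add: natural_def slide_two cmp_assoc arr_cross)

text \<open>Multiplying the Yang-Baxter equation on both sides by the inverse of the crossing of
  \<open>x\<close> and \<open>z\<close> exchanges the roles of these two letters. In this way
  naturality in the upward strand yields naturality in the downward one.\<close>

lemma natural_cross_flip:
  assumes "natural x (cross y z :: 'k::idom mor) [y, z] [z, y]"
  shows "natural z (cross y x :: 'k mor) [y, x] [x, y]"
proof -
  let ?X = "\<lambda>u y z v. wh u (cross y z :: 'k mor) v"
  have "?X [x] y z [] \<cdot> (?X [] y x [z] \<cdot> ?X [y] z x []) = ?X [] z x [y] \<cdot> (?X [z] y x [] \<cdot> ?X [] y z [x])"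
    using assms unfolding natural_cross_cross by simp
  then have "?X [] x z [y] \<cdot> (?X [x] y z [] \<cdot> (?X [] y x [z] \<cdot> ?X [y] z x [])) \<cdot> ?X [y] x z [] =
    ?X [] x z [y] \<cdot> (?X [] z x [y] \<cdot> (?X [z] y x [] \<cdot> ?X [] y z [x])) \<cdot> ?X [y] x z []"
    by simp
  also have "\<dots> = ?X [z] y x [] \<cdot> (?X [] y z [x] \<cdot> ?X [y] x z [])"
    unfolding cmp_assoc
    by (rule cancel[OF wh_cross_inverse]) (rule arr_cmp arr_whI[OF arr_cross] | simp)+
  also have "?X [] x z [y] \<cdot> (?X [x] y z [] \<cdot> (?X [] y x [z] \<cdot> ?X [y] z x [])) \<cdot> ?X [y] x z [] =
    ?X [] x z [y] \<cdot> (?X [x] y z [] \<cdot> (?X [] y x [z]))"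
    by (simp add: cmp_assoc wh_cross_inverse cmp_idm[OF arr_whI[OF arr_cross]])
  finally show ?thesis
    unfolding natural_cross_cross by simp
qed

lemma natural_down: "natural \<down> (cross y z :: 'k::idom mor) [y, z] [z, y]"
proof -
  have 1: "natural \<down> (cross \<up> \<up> :: 'k mor) [\<up>, \<up>] [\<up>, \<up>]"
    by (rule natural_cross_flip[OF natural_up])
  have 2: "natural \<down> (cross \<down> \<up> :: 'k mor) [\<down>, \<up>] [\<up>, \<down>]"
    by (rule natural_cross_down[OF 1])
  have 3: "natural \<down> (cross \<up> \<down> :: 'k mor) [\<up>, \<down>] [\<down>, \<up>]"
    by (rule natural_inverse[OF 2 arr_cross cross_down_up cross_up_down])
  show ?thesis
    using 1 2 3 natural_cross_down[OF 2] by (cases y; cases z; simp)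
qed

lemma natural_cross: "natural x (cross y z) [y, z] [z, y]"
  by (cases x) (simp_all add: natural_up natural_down)

section \<open>Cups and caps of both orientations\<close>

lemma cross_eta: "cross (bar x) x \<cdot> eta x = eta (bar x)"
  using cancel[OF cross_inverse[of \<down> \<up>] arr_eta[of \<down>, simplified]] by (cases x) (simp_all add: eta_up)

lemma cross_eps: "eps x \<cdot> cross (bar x) x = eps (bar x)"
  using cancel_left[OF cross_inverse[of \<up> \<down>] arr_eps[of \<down>, simplified], of "idm [\<up>, \<down>]"]
  by (cases x) (simp_all add: eps_up cmp_assoc cross_inverse cmp_idm[OF arr_eps, of \<down>, simplified])

lemma natural_eta: "natural z (eta x) [] [bar x, x]"
  by (cases x) (auto simp: eta_up natural_eta_down intro: natural_cmp[OF natural_cross])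

lemma natural_eps: "natural z (eps x) [x, bar x] []"
  by (cases x) (auto simp: eps_up natural_eps_down intro: natural_cmp[OF _ natural_cross])

lemma wh_eps_cross: "wh u (eps x) v \<cdot> wh u (cross (bar x) x) v = wh u (eps (bar x)) v"
  by (simp add: wh_cmp[OF arr_eps arr_cross[of "bar x" x], symmetric] cross_eps)

lemma wh_cross_eta: "wh u (cross (bar x) x) v \<cdot> wh u (eta x) v = wh u (eta (bar x)) v"
  by (simp add: wh_cmp[OF arr_cross[of "bar x" x] arr_eta, symmetric] cross_eta)

lemma arr_wh_cross: "arr (wh u (cross y z) v) (u @ y # z # v) (u @ z # y # v)"
  by (rule arr_whI[OF arr_cross]) simp_all

lemma arr_wh_eta: "arr (wh u (eta x) v) (u @ v) (u @ bar x # x # v)"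
  by (rule arr_whI[OF arr_eta]) simp_all

lemma arr_wh_eps: "arr (wh u (eps x) v) (u @ x # bar x # v) (u @ v)"
  by (rule arr_whI[OF arr_eps]) simp_all

lemma eta_natural:
  "wh u (cross (bar x) z) (x # v) \<cdot> (wh (u @ [bar x]) (cross x z) v \<cdot> wh u (eta x) (z # v)) =
   (wh (u @ [z]) (eta x) v :: 'k::idom mor)"
  using cmp_idm[OF arr_wh_eta[where 'a = 'k, of "u @ [z]" x v]] wh_natural[OF natural_eta[where 'a = 'k], of u x z v]
  by (simp add: wh_slide_two cmp_assoc)

text \<open>\<open>eta_natural\<close> read backwards, its two crossings being moved to the other
  side as their inverses.\<close>

lemma eta_past:
  "wh (u @ [bar x]) (cross y x) v \<cdot> (wh u (cross y (bar x)) (x # v) \<cdot> wh (u @ [y]) (eta x) v) =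
   (wh u (eta x) (y # v) :: 'k::idom mor)"
proof -
  let ?e = "wh u (eta x) (y # v) :: 'k mor"
  have a: "arr ?e (u @ y # v) (u @ [bar x] @ x # y # v)"
    by (rule arr_whI[OF arr_eta]) simp_all
  have b: "arr (wh (u @ [bar x]) (cross x y) v \<cdot> ?e) (u @ y # v) (u @ [bar x] @ y # x # v)"
    by (rule arr_cmp[OF arr_whI[OF arr_cross] a]) simp_all
  show ?thesis
    unfolding eta_natural[symmetric, of u y x v]
    using cancel[OF wh_cross_inverse[where 'a = 'k, of u y "bar x" "x # v"], of "wh (u @ [bar x]) (cross x y) v \<cdot> ?e"] b
      cancel[OF wh_cross_inverse[where 'a = 'k, of "u @ [bar x]" y x v], of ?e] a
    by simp
qed

lemma eps_natural:
  "wh (u @ [z]) (eps x) v \<cdot> (wh u (cross x z) (bar x # v) \<cdot> wh (u @ [x]) (cross (bar x) z) v) =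
   (wh u (eps x) (z # v) :: 'k::idom mor)"
  using idm_cmp[OF arr_wh_eps[where 'a = 'k, of u x "z # v"]] wh_natural[OF natural_eps[where 'a = 'k], of u z v x]
  by (simp add: wh_slide_two cmp_assoc)

lemma eps_past:
  "wh u (eps x) (y # v) \<cdot> wh (u @ [x]) (cross y (bar x)) v =
   (wh (u @ [y]) (eps x) v \<cdot> wh u (cross x y) (bar x # v) :: 'k::idom mor)"
  unfolding eps_natural[symmetric, of u x y v] cmp_assoc wh_cross_inverse
  using cmp_idm[OF arr_wh_cross[where 'a = 'k, of u x y "bar x # v"]] by simp

text \<open>The upward cup is the downward cup followed by a crossing, the upward cap is the
  downward cap preceded by one. Yang-Baxter and naturality move the free strand across, where the
  crossings cancel or are absorbed, and one of the given zigzags remains.\<close>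

lemma zig_zag_up:
  "wh [] (eps \<up>) [\<up>] \<cdot> wh [\<up>] (eta \<up>) [] = (idm [\<up>] :: 'k::idom mor)"
  "wh [\<down>] (eps \<up>) [] \<cdot> wh [] (eta \<up>) [\<down>] = (idm [\<down>] :: 'k::idom mor)"
proof -
  let ?X = "\<lambda>u y z v. wh u (cross y z :: 'k mor) v"
  let ?c = "\<lambda>u v. wh u (eta \<down> :: 'k mor) v" and ?d = "\<lambda>u v. wh u (eps \<down> :: 'k mor) v"
  have e: "wh u (eta \<up>) v = ?X u \<up> \<down> v \<cdot> ?c u v" "wh u (eps \<up>) v = ?d u v \<cdot> ?X u \<up> \<down> v" for u v
    using wh_cross_eta[where 'a = 'k, of u \<down> v] wh_eps_cross[where 'a = 'k, of u \<down> v] by simp_all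
  have n1: "?X [] \<up> \<down> [\<up>] \<cdot> (?X [\<up>] \<up> \<down> [] \<cdot> ?X [] \<up> \<up> [\<down>]) =
      ?X [\<down>] \<up> \<up> [] \<cdot> (?X [] \<up> \<down> [\<up>] \<cdot> ?X [\<up>] \<up> \<down> [])"
    using natural_cross[of \<down> \<up> \<up>, where 'a = 'k] unfolding natural_cross_cross .
  have n2: "?X [] \<down> \<down> [\<up>] \<cdot> (?X [\<down>] \<up> \<down> [] \<cdot> ?X [] \<up> \<down> [\<down>]) =
      ?X [\<down>] \<up> \<down> [] \<cdot> (?X [] \<up> \<down> [\<down>] \<cdot> ?X [\<up>] \<down> \<down> [])"
    using natural_cross[of \<down> \<up> \<down>, where 'a = 'k] unfolding natural_cross_cross .
  have p1: "?c [\<up>] [] = ?X [] \<up> \<up> [\<down>] \<cdot> (?X [\<up>] \<down> \<up> [] \<cdot> ?c [] [\<up>])"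
    using eta_natural[where 'k = 'k, of "[]" \<down> \<up> "[]"] by simp
  have p2: "?c [\<down>] [] = ?X [] \<up> \<down> [\<down>] \<cdot> (?X [\<up>] \<down> \<down> [] \<cdot> ?c [] [\<down>])"
    using eta_natural[where 'k = 'k, of "[]" \<down> \<down> "[]"] by simp
  have q1: "?d [] [\<up>] \<cdot> ?X [\<down>] \<up> \<up> [] = ?d [\<up>] [] \<cdot> ?X [] \<down> \<up> [\<up>]"
    using eps_past[where 'k = 'k, of "[]" \<down> \<up> "[]"] by simp
  have q2: "?d [\<down>] [] \<cdot> (?X [] \<down> \<down> [\<up>] \<cdot> ?X [\<down>] \<up> \<down> []) = ?d [] [\<down>]"
    using eps_natural[where 'k = 'k, of "[]" \<down> \<down> "[]"] by simp
  have a: "arr (?c [] [\<up>]) [\<up>] [\<up>, \<down>, \<up>]" "arr (?c [] [\<down>]) [\<down>] [\<up>, \<down>, \<down>]"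
    "arr (?X [] \<up> \<down> [\<up>]) [\<up>, \<down>, \<up>] [\<down>, \<up>, \<up>]" "arr (?d [\<up>] []) [\<up>, \<down>, \<up>] [\<up>]"
    by (rule arr_whI[OF arr_cross] arr_whI[OF arr_eta] arr_whI[OF arr_eps]; simp)+
  note inv = wh_cross_inverse[where 'a = 'k]
  have "wh [] (eps \<up>) [\<up>] \<cdot> wh [\<up>] (eta \<up>) [] =
      ?d [] [\<up>] \<cdot> (?X [] \<up> \<down> [\<up>] \<cdot> (?X [\<up>] \<up> \<down> [] \<cdot> ?c [\<up>] []))"
    unfolding e by (simp only: cmp_assoc)
  also have "\<dots> = ?d [] [\<up>] \<cdot> ((?X [] \<up> \<down> [\<up>] \<cdot> (?X [\<up>] \<up> \<down> [] \<cdot> ?X [] \<up> \<up> [\<down>])) \<cdot> (?X [\<up>] \<down> \<up> [] \<cdot> ?c [] [\<up>]))"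
    unfolding p1 by (simp only: cmp_assoc)
  also have "\<dots> = ?d [\<up>] [] \<cdot> (?X [] \<down> \<up> [\<up>] \<cdot> (?X [] \<up> \<down> [\<up>] \<cdot> (?X [\<up>] \<up> \<down> [] \<cdot> (?X [\<up>] \<down> \<up> [] \<cdot> ?c [] [\<up>]))))"
    unfolding n1 by (simp only: cmp_assoc cmp_subst[OF q1])
  also have "\<dots> = ?d [\<up>] [] \<cdot> (?X [] \<down> \<up> [\<up>] \<cdot> (?X [] \<up> \<down> [\<up>] \<cdot> ?c [] [\<up>]))"
    using cancel[OF inv[of "[\<up>]" \<up> \<down> "[]"], of "?c [] [\<up>]"] a(1) by simp
  also have "\<dots> = ?d [\<up>] [] \<cdot> ?c [] [\<up>]"
    using cancel[OF inv[of "[]" \<down> \<up> "[\<up>]"], of "?c [] [\<up>]"] a(1) by simp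
  finally show "wh [] (eps \<up>) [\<up>] \<cdot> wh [\<up>] (eta \<up>) [] = (idm [\<up>] :: 'k::idom mor)"
    using zigzag_up[where 'a = 'k] by simp
  have "?X [] \<down> \<down> [\<up>] \<cdot> (?X [\<down>] \<up> \<down> [] \<cdot> ?X [] \<up> \<down> [\<down>]) \<cdot> ?X [\<up>] \<down> \<down> [] = 
     ?X [\<down>] \<up> \<down> [] \<cdot> (?X [] \<up> \<down> [\<down>] \<cdot> (?X [\<up>] \<down> \<down> [] \<cdot> ?X [\<up>] \<down> \<down> []))"
    by (simp only: cmp_assoc[symmetric] n2[unfolded cmp_assoc[symmetric]])
  also have "\<dots> = ?X [\<down>] \<up> \<down> [] \<cdot> ?X [] \<up> \<down> [\<down>]"
    unfolding inv using cmp_idm[OF arr_wh_cross[where 'a = 'k, of "[]" \<up> \<down> "[\<down>]"]] by simp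
  finally have n3: "?X [\<down>] \<up> \<down> [] \<cdot> ?X [] \<up> \<down> [\<down>] = 
    ?X [] \<down> \<down> [\<up>] \<cdot> (?X [\<down>] \<up> \<down> [] \<cdot> ?X [] \<up> \<down> [\<down>]) \<cdot> ?X [\<up>] \<down> \<down> []" ..
  have "wh [\<down>] (eps \<up>) [] \<cdot> wh [] (eta \<up>) [\<down>] = 
      ?d [\<down>] [] \<cdot> ((?X [\<down>] \<up> \<down> [] \<cdot> ?X [] \<up> \<down> [\<down>]) \<cdot> ?c [] [\<down>])"
    unfolding e by (simp only: cmp_assoc)
  also have "\<dots> = ?d [\<down>] [] \<cdot> (?X [] \<down> \<down> [\<up>] \<cdot> (?X [\<down>] \<up> \<down> [] \<cdot> ?c [\<down>] []))"
    by (subst n3) (simp only: cmp_assoc p2)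
  also have "\<dots> = ?d [] [\<down>] \<cdot> ?c [\<down>] []"
    using q2 by (simp only: cmp_assoc[symmetric])
  finally show "wh [\<down>] (eps \<up>) [] \<cdot> wh [] (eta \<up>) [\<down>] = (idm [\<down>] :: 'k::idom mor)"
    using zigzag_down[where 'a = 'k] by simp
qed

lemma zag: "wh [] (eps x) [x] \<cdot> wh [x] (eta x) [] = idm [x]"
  by (cases x) (simp_all add: zig_zag_up zigzag_down)

lemma zig: "wh [bar x] (eps x) [] \<cdot> wh [] (eta x) [bar x] = idm [bar x]"
  by (cases x) (simp_all add: zig_zag_up zigzag_up)

lemma wh_zag: "wh u (eps x) (x # v) \<cdot> wh (u @ [x]) (eta x) v = (idm (u @ x # v) :: 'k::idom mor)"
  using wh_cmp[OF arr_wh_eps[where 'a = 'k, of "[]" x "[x]", simplified] arr_wh_eta[where 'a = 'k, of "[x]" x "[]", simplified], of u v] 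
  by (simp add: zag)

lemma wh_zig: "wh (u @ [bar x]) (eps x) v \<cdot> wh u (eta x) (bar x # v) = (idm (u @ bar x # v) :: 'k::idom mor)"
  using wh_cmp[OF arr_wh_eps[where 'a = 'k, of "[bar x]" x "[]", simplified] arr_wh_eta[where 'a = 'k, of "[]" x "[bar x]", simplified], of u v] 
  by (simp add: zig)

primrec rho :: "letter \<Rightarrow> letter list \<Rightarrow> 'k::idom mor" where
  "rho x [] = idm [x]"
| "rho x (y # v) = wh [y] (rho x v) [] \<cdot> wh [] (cross x y) v"

lemma arr_rho: "arr (rho x v) (x # v) (v @ [x])"
proof (induction v)
  case (Cons y v)
  show ?case
    unfolding rho.simps
    by (rule arr_cmp[where b = "y # x # v"])
      (rule arr_whI[OF arr_cross] arr_whI[OF Cons.IH]; simp)+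
qed simp

lemma wh_rho_Cons:
  "wh p (rho x (y # v)) q = (wh (p @ [y]) (rho x v) q \<cdot> wh p (cross x y) (v @ q) :: 'k::idom mor)"
proof -
  have "wh p (rho x (y # v) :: 'k mor) q = wh p (wh [y] (rho x v) []) q \<cdot> wh p (wh [] (cross x y) v) q"
    unfolding rho.simps by (rule wh_cmp[OF arr_whI[OF arr_rho] arr_wh[OF arr_cross]]) simp_all
  then show ?thesis by simp
qed

text \<open>The right leg of a cap passed leftwards over \<open>v\<close> can equally be left in
  place while the left leg passes rightwards; letter by letter this is
  \<open>eps_past\<close>.\<close>

lemma eps_slide:
  "wh u (eps x) (v @ q) \<cdot> wh (u @ [x]) (slide v (bar x)) q =
   (wh (u @ v) (eps x) q \<cdot> wh u (rho x v) (bar x # q) :: 'k::idom mor)"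
proof (induction v arbitrary: u)
  case (Cons y v)
  note c = wh_commute[OF arr_cross[of x y] arr_slide[of v "bar x"], of u "[]" q, simplified]
  note IH = Cons.IH[of "u @ [y]", simplified]
  show ?case
    by (simp add: wh_slide_Cons wh_rho_Cons del: rho.simps)
      (simp only: cmp_assoc cmp_subst[OF eps_past] c cmp_subst[OF IH])
qed (simp add: cmp_idm[OF arr_wh_eps])

subsection \<open>Normal forms of morphisms out of the unit object\<close>

text \<open>Adds to \<open>N\<close> a cup joining the new last letter to a new letter between
  \<open>u\<close> and \<open>v\<close>: the cup is created at the right end, and its left leg
  \<open>bar x\<close> is slid over \<open>v\<close>.\<close>

definition attach :: "letter list \<Rightarrow> letter list \<Rightarrow> letter \<Rightarrow> 'k::idom mor \<Rightarrow> 'k mor" where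
  "attach u v x N = wh u (slide v (bar x)) [x] \<cdot> (wh (u @ v) (eta x) [] \<cdot> N)"

text \<open>A diagram without bubbles out of the empty word is a perfect matching of the positions
  of \<open>w\<close>. Removing the strand at the last position, again and again, fixes an order in
  which its cups are drawn.\<close>

inductive nf :: "letter list \<Rightarrow> 'k::idom mor \<Rightarrow> bool" where
  nf_Nil: "nf [] (idm [])"
| nf_attach: "nf (u @ v) N \<Longrightarrow> nf (u @ bar x # v @ [x]) (attach u v x N)"

lemma arr_attach: "arr N [] (u @ v) \<Longrightarrow> arr (attach u v x N) [] (u @ bar x # v @ [x])"
  unfolding attach_def
  by (rule arr_cmp[OF arr_whI[OF arr_slide] arr_cmp[OF arr_wh_eta]]) simp_all

lemma arr_nf: "nf w N \<Longrightarrow> arr N [] w"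
  by (induction rule: nf.induct) (auto intro: arr_attach)

lemma attach_left:
  assumes "arr f a b"
  shows "wh p f (u @ bar x # v @ [x]) \<cdot> attach (p @ a @ u) v x N = attach (p @ b @ u) v x (wh p f (u @ v) \<cdot> N)"
proof -
  note c1 = wh_commute[OF assms arr_slide[of v "bar x"], of p u "[x]"]
  note c2 = wh_commute[OF assms arr_eta[of x], of p "u @ v" "[]"]
  show ?thesis
    using c1 c2 by (simp add: attach_def cmp_assoc cmp_subst[OF c1[simplified]] cmp_subst[OF c2[simplified]])
qed

text \<open>Unlike in \<open>attach_left\<close>, the sliding leg crosses the letters on which
  \<open>f\<close> acts, hence the naturality assumption.\<close>

lemma attach_right:
  assumes "natural (bar x) f a b"
  shows "wh (u @ bar x # v1) f (v2 @ [x]) \<cdot> attach u (v1 @ a @ v2) x N =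
    attach u (v1 @ b @ v2) x (wh (u @ v1) f v2 \<cdot> N)"
proof -
  have f: "arr f a b" using assms by (simp add: natural_def)
  note c1 = wh_natural[OF natural_wh[OF assms, of v1 v2], of u "[x]", simplified]
  note c2 = wh_commute[OF f arr_eta[of x], of "u @ v1" v2 "[]", simplified]
  show ?thesis
    by (simp only: attach_def cmp_assoc cmp_subst[OF c1[symmetric]] cmp_subst[OF c2] append_assoc)
qed

lemma slide_snoc: "wh u (slide (v @ [y]) x) q = (wh u (slide v x) (y # q) \<cdot> wh (u @ v) (cross y x) q :: 'k::idom mor)"
  unfolding slide_append slide_one
  by (subst wh_cmp[OF arr_wh[OF arr_slide] arr_whI[OF arr_cross]]) simp_all

lemma attach_snoc:
  "attach u (v @ [y]) x N =
    wh u (slide v (bar x)) [y, x] \<cdot> (wh (u @ v) (cross y (bar x)) [x] \<cdot> (wh (u @ v @ [y]) (eta x) [] \<cdot> N))"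
  by (simp add: attach_def slide_snoc cmp_assoc)

lemma snoc_cases:
  assumes "u @ z # v = p @ q"
  obtains us where "u = p @ us" "q = us @ z # v"
  | vs where "p = u @ z # vs" "v = vs @ q"
  using assms by (auto simp: append_eq_append_conv2 Cons_eq_append_conv)

text \<open>A cup at the right end is one more \<open>attach\<close>. Any other cup lies to the left
  of the foot of the last strand, or between foot and last letter; it commutes past that strand and
  is inserted into the smaller normal form.\<close>

lemma nf_eta: "nf w N \<Longrightarrow> w = p @ q \<Longrightarrow> nf (p @ bar z # z # q) (wh p (eta z) q \<cdot> N)"
proof (induction arbitrary: p q rule: nf.induct)
  case nf_Nil
  have "nf ([] @ bar z # [] @ [z]) (attach [] [] z (idm []))"
    by (rule nf.nf_attach) (simp add: nf.nf_Nil)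
  with nf_Nil show ?case
    by (simp add: attach_def cmp_idm[OF arr_eta] idm_cmp[OF arr_eta])
next
  case (nf_attach u v N x)
  show ?case
  proof (cases q rule: rev_cases)
    case Nil
    have "nf p (attach u v x N)"
      using nf.nf_attach[OF nf_attach(1), of x] nf_attach(3) Nil by simp
    then have "nf (p @ bar z # [] @ [z]) (attach p [] z (attach u v x N))"
      by (intro nf.nf_attach) simp
    moreover have "arr (wh p (eta z) [] \<cdot> attach u v x N) [] (p @ bar z # [z])"
      using arr_cmp[OF arr_wh_eta[of p z "[]"] arr_nf] \<open>nf p _\<close> by simp
    ultimately show ?thesis
      using Nil by (simp add: attach_def[of p])
  next
    case (snoc q' x')
    have "(u @ bar x # v) @ [x] = (p @ q') @ [x']"
      using nf_attach(3) by (simp only: snoc append_assoc append_Cons append_Nil)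
    then have x: "x' = x" and xe: "u @ bar x # v = p @ q'"
      unfolding append1_eq_conv by blast+
    from xe show ?thesis
    proof (cases rule: snoc_cases)
      case (1 us)
      have "nf ((p @ bar z # z # us) @ v) (wh p (eta z) (us @ v) \<cdot> N)"
        using nf_attach(2)[of p "us @ v"] 1 by simp
      from nf.nf_attach[OF this] show ?thesis
        using attach_left[OF arr_eta[of z], of p us x v N] 1 snoc x by simp
    next
      case (2 vs)
      have "nf (u @ (vs @ bar z # z # q')) (wh (u @ vs) (eta z) q' \<cdot> N)"
        using nf_attach(2)[of "u @ vs" q'] 2 by simp
      from nf.nf_attach[OF this] show ?thesis
        using attach_right[OF natural_eta[of "bar x" z], of u vs q' N] 2 snoc x by simp
    qed
  qed
qed


text \<open>The length \<open>n\<close> and the untouched tail \<open>q\<close> are kept as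
  parameters because the lemma is applied inside the induction for \<open>nf_cross\<close>, where
  only crossings away from the tail, in words of that length, are under control.\<close>

lemma slide_closed:
  fixes N :: "'k::idom mor"
  assumes "\<And>p y z q' (N :: 'k mor). length (p @ y # z # q' @ q) = n \<Longrightarrow> nf (p @ y # z # q' @ q) N \<Longrightarrow>
      nf (p @ z # y # q' @ q) (wh p (cross y z) (q' @ q) \<cdot> N)"
    and "length (p @ v @ x # q) = n" and "nf (p @ v @ x # q) N"
  shows "nf (p @ x # v @ q) (wh p (slide v x) q \<cdot> N)"
  using assms(2,3)
proof (induction v arbitrary: p)
  case Nil
  then show ?case using idm_cmp[OF arr_nf[OF Nil.prems(2)]] by simp
next
  case (Cons y v)
  have "nf ((p @ [y]) @ x # v @ q) (wh (p @ [y]) (slide v x) q \<cdot> N)"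
    using Cons.prems by (intro Cons.IH) simp_all
  then show ?case
    using assms(1)[of p y x v] Cons.prems by (simp add: wh_slide_Cons cmp_assoc)
qed

lemma rho_closed:
  fixes N :: "'k::idom mor"
  assumes "\<And>p y z q' (N :: 'k mor). nf (p @ y # z # q' @ q) N \<Longrightarrow>
      nf (p @ z # y # q' @ q) (wh p (cross y z) (q' @ q) \<cdot> N)"
    and "nf (p @ x # v @ q) N"
  shows "nf (p @ v @ x # q) (wh p (rho x v) q \<cdot> N)"
  using assms(2)
proof (induction v arbitrary: p N)
  case Nil
  then show ?case using idm_cmp[OF arr_nf[OF Nil.prems]] by simp
next
  case (Cons y v)
  have "nf (p @ y # x # v @ q) (wh p (cross x y) (v @ q) \<cdot> N)"
    using Cons.prems assms(1) by simp
  from Cons.IH[of "p @ [y]", simplified, OF this] show ?case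
    by (simp add: wh_rho_Cons cmp_assoc del: rho.simps)
qed

lemma attach_cross_here: "wh p (cross y (bar x)) (v @ [x]) \<cdot> attach (p @ [y]) v x N = attach p (y # v) x N"
  by (simp add: attach_def wh_slide_Cons cmp_assoc)

text \<open>The last letter is not crossed, so only the foot \<open>bar x\<close> of the last strand
  matters. A crossing at the foot lengthens or shortens the slide by one; any other crossing
  commutes into the normal form \<open>M\<close> of a shorter word.\<close>

lemma nf_cross_aux:
  fixes N :: "'k::idom mor"
  assumes IH: "\<And>w p y z q (N :: 'k mor). length w < n \<Longrightarrow> nf w N \<Longrightarrow> w = p @ y # z # q \<Longrightarrow>
      nf (p @ z # y # q) (wh p (cross y z) q \<cdot> N)"
    and "nf w N" "length w = n" "w = p @ y # z # q" "q \<noteq> []"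
  shows "nf (p @ z # y # q) (wh p (cross y z) q \<cdot> N)"
  using assms(2)
proof (cases rule: nf.cases)
  case nf_Nil
  then show ?thesis using assms(4) by simp
next
  case (nf_attach u v M x)
  obtain q' where q: "q = q' @ [x]" "u @ bar x # v = p @ y # z # q'"
  proof (cases q rule: rev_cases)
    case (snoc q' x')
    have "(u @ bar x # v) @ [x] = (p @ y # z # q') @ [x']"
      using nf_attach(1) assms(4) by (simp only: snoc append_assoc append_Cons append_Nil)
    then have "x' = x" "u @ bar x # v = p @ y # z # q'"
      unfolding append1_eq_conv by blast+
    with snoc that show ?thesis by simp
  qed (use assms(5) in simp)
  have len: "length (u @ v) < n"
    using assms(3) nf_attach(1) by simp
  from q(2) show ?thesis
  proof (cases rule: snoc_cases)
    case (1 us)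
    consider "us = []" | "us = [y]" | us' where "us = y # z # us'"
      using 1(2) by (cases us; cases "tl us") auto
    then show ?thesis
    proof cases
      \<comment> \<open>The foot stands directly to the left of \<open>z\<close>, so the crossing
        undoes the final crossing of the slide.\<close>
      case a: 1
      then have e: "y = bar x" "v = z # q'" "u = p" using 1 by simp_all
      have "nf ((u @ [z]) @ bar x # q' @ [x]) (attach (u @ [z]) q' x M)"
        by (rule nf.nf_attach) (use nf_attach(3) e in simp)
      moreover have "wh p (cross y z) q \<cdot> N = attach (u @ [z]) q' x M"
      proof -
        have "arr (attach (u @ [z]) q' x M) [] (u @ z # bar x # (q' @ [x]))"
          using arr_attach[of M "u @ [z]" q' x] arr_nf[OF nf_attach(3)] e by simp
        from cancel[OF wh_cross_inverse this] show ?thesis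
          using attach_cross_here[of u z x q' M] nf_attach(2) e q by simp
      qed
      ultimately show ?thesis using e q by simp
    next
      case a: 2
      then have e: "z = bar x" "v = q'" "u = p @ [y]" using 1 by simp_all
      have "nf (p @ bar x # (y # v) @ [x]) (attach p (y # v) x M)"
        by (rule nf.nf_attach) (use nf_attach(3) e in simp)
      then show ?thesis
        using attach_cross_here[of p y x v M] nf_attach(2) e q by simp
    next
      case a: 3
      have "nf ((p @ z # y # us') @ v) (wh p (cross y z) (us' @ v) \<cdot> M)"
        using IH[OF len nf_attach(3), of p y z "us' @ v"] 1 a by simp
      from nf.nf_attach[OF this, of x] show ?thesis
        using attach_left[OF arr_cross[of y z], of p us' x v M] 1 a q nf_attach(2) by simp
    qed
  next
    case (2 vs)
    have "nf (u @ (vs @ z # y # q')) (wh (u @ vs) (cross y z) q' \<cdot> M)"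
      using IH[OF len nf_attach(3), of "u @ vs" y z q'] 2 by simp
    from nf.nf_attach[OF this, of x] show ?thesis
      using attach_right[OF natural_cross[of "bar x" y z], of u vs q' M] 2 q nf_attach(2) by simp
  qed
qed

text \<open>New here is the crossing of the last two letters. If they are the ends of one strand, it
  reverses the orientation of a cup. Otherwise \<open>y\<close> is pushed across both legs of the
  cup, which then stands before \<open>y\<close>. The result is a slide applied to \<open>M\<close>
  with a cup inserted, and the crossings of this slide avoid the last letter, so that
  \<open>aux\<close> applies.\<close>

lemma nf_cross:
  "nf w (N :: 'k::idom mor) \<Longrightarrow> w = p @ y # z # q \<Longrightarrow> nf (p @ z # y # q) (wh p (cross y z) q \<cdot> N)"
proof (induction "length w" arbitrary: w N p y z q rule: less_induct)
  case less
  have aux: "nf (p @ z # y # q) (wh p (cross y z) q \<cdot> N)"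
    if "nf (p @ y # z # q) N" "length (p @ y # z # q) = length w" "q \<noteq> []" for p y z q and N :: "'k mor"
    using nf_cross_aux[OF less(1) that(1,2) HOL.refl that(3)] by simp
  show ?case
  proof (cases "q = []")
    case False
    then show ?thesis using aux less(2,3) by simp
  next
    case True
    from less(2) show ?thesis
    proof (cases rule: nf.cases)
      case nf_Nil
      then show ?thesis using less(3) by simp
    next
      case (nf_attach u v M x)
      have "(u @ bar x # v) @ [x] = (p @ [y]) @ [z]"
        using nf_attach(1) less(3) by (simp only: True append_assoc append_Cons append_Nil)
      then have e: "z = x" "u @ bar x # v = p @ [y]"
        unfolding append1_eq_conv by blast+
      show ?thesis
      proof (cases v rule: rev_cases)
        case Nil
        then have "y = bar x" "p = u" using e(2) by simp_all
        moreover have "nf (u @ bar (bar x) # [] @ [bar x]) (attach u [] (bar x) M)"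
          by (rule nf.nf_attach) (use nf_attach(3) Nil in simp)
        moreover have "wh u (cross (bar x) x) [] \<cdot> attach u [] x M = attach u [] (bar x) M"
          using arr_nf[OF nf_attach(3)] Nil 
            arr_cmp[OF arr_wh_eta[of u x "[]", simplified], of M "[]"]
            arr_cmp[OF arr_wh_eta[of u "bar x" "[]", simplified], of M "[]"]
          by (simp add: attach_def cmp_subst[OF wh_cross_eta])
        ultimately show ?thesis
          using nf_attach(2) Nil e True by simp
      next
        case (snoc v' y')
        then have e2: "y' = y" "p = u @ bar x # v'" using e(2) by simp_all
        have 1: "nf ((u @ v') @ bar x # x # [y]) (wh (u @ v') (eta x) [y] \<cdot> M)"
          by (rule nf_eta[OF nf_attach(3)]) (use snoc e2 in simp)
        have "nf (u @ bar x # v' @ [x, y]) (wh u (slide v' (bar x)) [x, y] \<cdot> (wh (u @ v') (eta x) [y] \<cdot> M))"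
        proof (rule slide_closed[where n = "length w"])
          show "nf (p @ z # y' # q @ [x, y]) (wh p (cross y' z) (q @ [x, y]) \<cdot> N)"
            if "length (p @ y' # z # q @ [x, y]) = length w" "nf (p @ y' # z # q @ [x, y]) N"
            for p y' z q and N :: "'k mor"
            using aux[OF that(2,1)] by simp
        qed (use nf_attach(1) snoc 1 in simp_all)
        moreover have "wh p (cross y z) [] \<cdot> N =
            wh u (slide v' (bar x)) [x, y] \<cdot> (wh (u @ v') (eta x) [y] \<cdot> M)"
        proof -
          note c = wh_commute[OF arr_slide[of v' "bar x"] arr_cross[of y x], of u "[]" "[]", simplified]
          show ?thesis
            unfolding nf_attach(2) snoc e2 e attach_snoc
            by (simp only: cmp_subst[OF c[symmetric]] cmp_assoc
                eta_past[of "u @ v'" x y "[]", simplified, THEN cmp_subst, unfolded cmp_assoc])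
        qed
        ultimately show ?thesis
          using True e e2 by simp
      qed
    qed
  qed
qed

lemma nf_slide: "nf (p @ v @ x # q) (N :: 'k::idom mor) \<Longrightarrow> nf (p @ x # v @ q) (wh p (slide v x) q \<cdot> N)"
  by (rule slide_closed[OF _ HOL.refl]) (simp_all add: nf_cross[OF _ HOL.refl])

lemma nf_rho: "nf (p @ x # v @ q) (N :: 'k::idom mor) \<Longrightarrow> nf (p @ v @ x # q) (wh p (rho x v) q \<cdot> N)"
  by (rule rho_closed) (simp_all add: nf_cross[OF _ HOL.refl])

section \<open>Bubbles, and caps applied to normal forms\<close>

definition bub :: "'k::idom mor" where
  "bub = eps \<up> \<cdot> eta \<down>"

primrec bubs :: "nat \<Rightarrow> 'k::idom mor" where
  "bubs 0 = idm []"
| "bubs (Suc k) = bub \<cdot> bubs k"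

lemma arr_bub: "arr bub [] []"
  unfolding bub_def
  by (rule arr_cmp[OF arr_eps[of \<up>, simplified] arr_eta[of \<down>, simplified]])

lemma arr_bubs: "arr (bubs k) [] []"
  by (induction k) (auto intro: arr_cmp arr_bub)

lemma bubs_add: "bubs k \<cdot> bubs l = bubs (k + l)"
  by (induction k) (simp_all add: cmp_assoc idm_cmp[OF arr_bubs])

text \<open>A loop of either orientation is the generating cup, the crossing \<open>t\<close> and
  the generating cap in a row, so the orientation of a bubble is immaterial.\<close>

lemma eps_eta: "eps (bar x) \<cdot> eta x = bub"
  by (cases x) (simp_all add: bub_def eta_up eps_up cmp_assoc)

lemma wh_bub:
  fixes N :: "'k::idom mor"
  assumes "arr N [] w"
  shows "wh w bub [] \<cdot> N = N \<cdot> bub"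
  using tns_wh[OF assms arr_bub] by simp

text \<open>The cap forms a zigzag with the attached cup; once it is straightened, the letter
  \<open>x\<close> has moved to the right end.\<close>

lemma eps_attach:
  fixes N :: "'k::idom mor"
  assumes "arr N [] (p @ x # v)"
  shows "wh p (eps x) (v @ [x]) \<cdot> attach (p @ [x]) v x N = wh p (rho x v) [] \<cdot> N"
proof -
  have a: "arr (wh p (rho x v) [] \<cdot> N) [] (p @ v @ x # [])"
    by (rule arr_cmp[OF arr_whI[OF arr_rho] assms]) simp_all
  note c = wh_commute[OF arr_rho[of x v] arr_eta[of x], of p "[]" "[]", simplified]
  have "wh p (eps x) (v @ [x]) \<cdot> attach (p @ [x]) v x N =
     wh (p @ v) (eps x) [x] \<cdot> (wh ((p @ v) @ [x]) (eta x) [] \<cdot> (wh p (rho x v) [] \<cdot> N))"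
    by (simp only: attach_def cmp_subst[OF eps_slide] cmp_assoc cmp_subst[OF c] append_assoc append_Cons append_Nil)
  also have "\<dots> = wh p (rho x v) [] \<cdot> N"
    by (rule cancel[OF wh_zag]) (use a in simp)
  finally show ?thesis .
qed

text \<open>A cap on both ends of the last strand closes a bubble. A cap on one of its ends
  straightens it into the continuation of another strand, which amounts to a slide or a
  \<open>rho\<close> applied to \<open>N\<close>. Any other cap is passed on to \<open>N\<close>.
  Bubbles collect at the bottom.\<close>

lemma nf_eps:
  "nf w (N :: 'k::idom mor) \<Longrightarrow> w = p @ z # bar z # q \<Longrightarrow>
    \<exists>N' k. nf (p @ q) N' \<and> wh p (eps z) q \<cdot> N = N' \<cdot> bubs k"
proof (induction arbitrary: p q rule: nf.induct)
  case (nf_attach u v N x)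
  have no_bubs: ?case if "nf (p @ q) (wh p (eps z) q \<cdot> attach u v x N)"
    using that by (intro exI[of _ "wh p (eps z) q \<cdot> attach u v x N"] exI[of _ 0])
      (simp add: cmp_idm[OF arr_nf[OF that]])
  show ?case
  proof (cases q rule: rev_cases)
    case Nil
    have "(u @ bar x # v) @ [x] = (p @ [z]) @ [bar z]"
      using nf_attach(3) by (simp only: Nil append_assoc append_Cons append_Nil)
    then have e: "x = bar z" "u @ bar x # v = p @ [z]"
      unfolding append1_eq_conv by blast+
    then have x: "z = bar x" by simp
    show ?thesis
    proof (cases v rule: rev_cases)
      case v: Nil
      then have "p = u" using e(2) by simp
      have N: "arr N [] u" using arr_nf[OF nf_attach(1)] v by simp
      have "wh u (eps (bar x)) [] \<cdot> attach u [] x N = wh u bub [] \<cdot> N"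
        using arr_cmp[OF arr_wh_eta[of u x "[]", simplified] N]
        by (simp add: attach_def wh_cmp[OF arr_eps[of "bar x", simplified] arr_eta[of x], symmetric, THEN cmp_subst] eps_eta)
      then have "wh p (eps z) [] \<cdot> attach u v x N = N \<cdot> bubs 1"
        unfolding wh_bub[OF N] using v x \<open>p = u\<close> by (simp add: cmp_idm[OF arr_bub])
      then show ?thesis
        using nf_attach(1) v Nil \<open>p = u\<close> by (intro exI[of _ N] exI[of _ 1]) simp
    next
      case (snoc v' y)
      then have e2: "y = bar x" "p = u @ bar x # v'"
        using e(2) x by simp_all
      note c = wh_commute[OF arr_slide[of v' "bar x"] arr_eps[of "bar x"], of u "[]" "[]", simplified]
      \<comment> \<open>\<open>eps_past\<close> carries the crossing to the cup, where it reverses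
        the orientation; what remains is a zigzag.\<close>
      have E: "wh ((u @ v') @ [bar x]) (eps (bar x)) [] \<cdot> (wh (u @ v') (cross (bar x) (bar x)) [x] \<cdot>
          (wh ((u @ v') @ [bar x]) (eta x) [] \<cdot> N)) = N"
      proof -
        have 1: "wh ((u @ v') @ [bar x]) (eps (bar x) :: 'k mor) [] \<cdot> wh (u @ v') (cross (bar x) (bar x)) [x] =
          wh (u @ v') (eps (bar x)) [bar x] \<cdot> wh ((u @ v') @ [bar x]) (cross (bar x) x) []"
          using eps_past[where 'k = 'k, of "u @ v'" "bar x" "bar x" "[]"] by simp
        have 2: "wh ((u @ v') @ [bar x]) (cross (bar x) x) [] \<cdot> wh ((u @ v') @ [bar x]) (eta x) [] =
            wh ((u @ v') @ [bar x]) (eta (bar x)) []"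
          by (rule wh_cross_eta)
        show ?thesis
          by (simp only: cmp_subst[OF 1] cmp_assoc cmp_subst[OF 2])
            (rule cancel[OF wh_zag[of "u @ v'" "bar x" "[]"]],
              use arr_nf[OF nf_attach(1)] snoc e2 in simp)
      qed
      have "wh p (eps z) q \<cdot> attach u v x N = wh u (slide v' (bar x)) [] \<cdot>
          (wh ((u @ v') @ [bar x]) (eps (bar x)) [] \<cdot> (wh (u @ v') (cross (bar x) (bar x)) [x] \<cdot>
          (wh ((u @ v') @ [bar x]) (eta x) [] \<cdot> N)))"
        unfolding snoc e2 x Nil attach_snoc
        by (simp only: cmp_subst[OF c[symmetric]] cmp_assoc append_assoc append_Cons append_Nil)
      also have "\<dots> = wh u (slide v' (bar x)) [] \<cdot> N"
        by (simp only: E)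
      finally have "wh p (eps z) q \<cdot> attach u v x N = wh u (slide v' (bar x)) [] \<cdot> N" .
      moreover have "nf (p @ q) (wh u (slide v' (bar x)) [] \<cdot> N)"
        using nf_slide[of u v' "bar x" "[]" N] nf_attach(1) snoc e2 Nil by simp
      ultimately show ?thesis
        using no_bubs by simp
    qed
  next
    case (snoc q' x')
    have "(u @ bar x # v) @ [x] = (p @ z # bar z # q') @ [x']"
      using nf_attach(3) by (simp only: snoc append_assoc append_Cons append_Nil)
    then have x: "x' = x" and xe: "u @ bar x # v = p @ z # bar z # q'"
      unfolding append1_eq_conv by blast+
    from xe show ?thesis
    proof (cases rule: snoc_cases)
      case (1 us)
      consider "us = []" | "us = [z]" | us' where "us = z # bar z # us'"
        using 1(2) by (cases us; cases "tl us") auto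
      then show ?thesis
      proof cases
        case a: 1
        then have e: "z = bar x" "v = x # q'" "u = p" using 1 by auto
        have N: "nf (p @ x # q') N" using nf_attach(1) e by simp
        have "wh p (eps z) q \<cdot> attach u v x N = wh p (eps x) (q' @ [x]) \<cdot> attach (p @ [x]) q' x N"
          using wh_eps_cross[of p "bar x" "q' @ [x]", THEN cmp_subst] e snoc x
          by (simp add: attach_cross_here[symmetric])
        then show ?thesis
          using no_bubs nf_rho[of p x q' "[]" N] N snoc x by (simp add: eps_attach[OF arr_nf[OF N]])
      next
        case a: 2
        then have e: "z = x" "v = q'" "u = p @ [x]" using 1 by (auto dest: arg_cong[of _ _ bar])
        have N: "nf (p @ x # q') N" using nf_attach(1) e by simp
        then show ?thesis
          using no_bubs nf_rho[of p x q' "[]" N] N snoc x e by (simp add: eps_attach[OF arr_nf[OF N]])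
      next
        case a: 3
        obtain M k where M: "nf ((p @ us') @ v) M" "wh p (eps z) (us' @ v) \<cdot> N = M \<cdot> bubs k"
          using nf_attach(2)[of p "us' @ v"] 1 a by auto
        have "wh p (eps z) q \<cdot> attach u v x N = attach (p @ us') v x M \<cdot> bubs k"
          using attach_left[OF arr_eps[of z], of p us' x v N] 1 a snoc x M(2)
          by (simp add: attach_def cmp_assoc)
        then show ?thesis
          using nf.nf_attach[OF M(1), of x] 1 a snoc x by auto
      qed
    next
      case (2 vs)
      obtain M k where M: "nf (u @ (vs @ q')) M" "wh (u @ vs) (eps z) q' \<cdot> N = M \<cdot> bubs k"
        using nf_attach(2)[of "u @ vs" q'] 2 by auto
      have "wh p (eps z) q \<cdot> attach u v x N = attach u (vs @ q') x M \<cdot> bubs k"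
        using attach_right[OF natural_eps[of "bar x" z], of u vs q' N] 2 snoc x M(2)
        by (simp add: attach_def cmp_assoc)
      then show ?thesis
        using nf.nf_attach[OF M(1), of x] 2 snoc x by auto
    qed
  qed
qed simp


section \<open>Composites of generators and their normal form\<close>

inductive monomial :: "'k::idom mor \<Rightarrow> letter list \<Rightarrow> letter list \<Rightarrow> bool" where
  monomial_gen: "generator_type x = (a, b) \<Longrightarrow> monomial (gen x) a b"
| monomial_idm: "monomial (idm a) a a"
| monomial_cmp: "monomial g b c \<Longrightarrow> monomial f a b \<Longrightarrow> monomial (g \<cdot> f) a c"
| monomial_tns: "monomial f a b \<Longrightarrow> monomial g c d \<Longrightarrow> monomial (f \<parallel> g) (a @ c) (b @ d)"

lemma arr_mono: "monomial f a b \<Longrightarrow> arr f a b"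
  by (induction rule: monomial.induct) (auto intro: arr_cmp arr_tns)

lemma monomial_wh: "monomial f a b \<Longrightarrow> x = u @ a @ v \<Longrightarrow> y = u @ b @ v \<Longrightarrow> monomial (wh u f v) x y"
  unfolding wh_def by (auto intro: monomial.intros)

lemma monomial_eta: "monomial (eta x) [] [bar x, x]"
  by (cases x) (auto simp: eta.simps intro!: monomial_gen monomial_cmp[of _ "[\<up>, \<down>]"])

lemma monomial_eps: "monomial (eps x) [x, bar x] []"
  by (cases x) (auto simp: eps.simps intro!: monomial_gen monomial_cmp[of _ "[\<down>, \<up>]"])

lemma monomial_cross: "monomial (cross y x) [y, x] [x, y]"
proof -
  have rot: "monomial (rot z B) [\<down>, z] [z, \<down>]" if "monomial B [z, \<up>] [\<up>, z]" for z and B :: "'k::idom mor"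
    unfolding rot_def
    by (rule monomial_cmp[where b = "[\<down>, \<up>, z, \<down>]"] monomial_cmp[where b = "[\<down>, z, \<up>, \<down>]"]
        monomial_wh monomial_gen that | simp)+
  show ?thesis
    by (cases y; cases x) (auto simp: cross.simps intro!: rot monomial_gen)
qed

lemma monomial_slide: "monomial (slide v x) (v @ [x]) (x # v)"
proof (induction v)
  case (Cons y v)
  show ?case
    unfolding slide.simps
    by (rule monomial_cmp[where b = "y # x # v"])
      (rule monomial_wh[OF monomial_cross] monomial_wh[OF Cons.IH]; simp)+
qed (simp add: monomial_idm)

lemma monomial_attach: "monomial N [] (u @ v) \<Longrightarrow> monomial (attach u v x N) [] (u @ bar x # v @ [x])"
  unfolding attach_def
  by (rule monomial_cmp[OF monomial_wh[OF monomial_slide] monomial_cmp[OF monomial_wh[OF monomial_eta]]]) simp_all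

lemma monomial_nf: "nf w N \<Longrightarrow> monomial N [] w"
  by (induction rule: nf.induct) (auto intro: monomial_idm monomial_attach)

lemma monomial_bubs: "monomial (bubs k) [] []"
proof (induction k)
  case (Suc k)
  have "monomial bub [] []"
    unfolding bub_def
    by (rule monomial_cmp[OF monomial_eps[of \<up>, simplified] monomial_eta[of \<down>, simplified]])
  then show ?case using Suc by (auto intro: monomial_cmp)
qed (simp add: monomial_idm)

text \<open>Every generator is a cup, a cap or a crossing, for which the claim has been shown. A
  tensor product acts by its right factor first and then by its left one, and the bubbles of the two
  steps add up.\<close>

lemma monomial_nf_closed:
  "monomial (f :: 'k::idom mor) a b \<Longrightarrow> nf (p @ a @ q) N \<Longrightarrow>
    \<exists>N' k. nf (p @ b @ q) N' \<and> wh p f q \<cdot> N = N' \<cdot> bubs k"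
proof (induction arbitrary: p q N rule: monomial.induct)
  case (monomial_gen x a b)
  have no_bubs: ?case if "nf (p @ b @ q) (wh p (gen x) q \<cdot> N)"
    using that by (intro exI[of _ "wh p (gen x) q \<cdot> N"] exI[of _ 0])
      (simp add: cmp_idm[OF arr_nf[OF that]])
  show ?case
  proof (cases x)
    case Gc
    then show ?thesis
      using no_bubs nf_eta[OF monomial_gen(2), of p q \<down>] monomial_gen(1) by (auto simp: eta.simps)
  next
    case Gd
    then show ?thesis
      using nf_eps[OF monomial_gen(2), of p \<down> q] monomial_gen(1) by (auto simp: eps.simps)
  next
    case Gs
    then show ?thesis
      using no_bubs nf_cross[OF monomial_gen(2), of p \<up> \<up> q] monomial_gen(1) by (auto simp: cross.simps)
  next
    case Gt
    then show ?thesis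
      using no_bubs nf_cross[OF monomial_gen(2), of p \<up> \<down> q] monomial_gen(1) by (auto simp: cross.simps)
  qed
next
  case (monomial_idm a)
  then show ?case
    by (intro exI[of _ N] exI[of _ 0]) (simp add: cmp_idm[OF arr_nf] idm_cmp[OF arr_nf])
next
  case (monomial_cmp g b c f a)
  obtain M k where M: "nf (p @ b @ q) M" "wh p f q \<cdot> N = M \<cdot> bubs k"
    using monomial_cmp.IH(2)[OF monomial_cmp.prems] by blast
  obtain L l where L: "nf (p @ c @ q) L" "wh p g q \<cdot> M = L \<cdot> bubs l"
    using monomial_cmp.IH(1)[OF M(1)] by blast
  have "wh p (g \<cdot> f) q \<cdot> N = L \<cdot> bubs (l + k)"
    using monomial_cmp.hyps[THEN arr_mono]
    by (simp add: wh_cmp cmp_assoc M(2) cmp_subst[OF L(2)] bubs_add)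
  then show ?case using L(1) by blast
next
  case (monomial_tns f a b g c d)
  obtain M k where M: "nf (p @ a @ d @ q) M" "wh (p @ a) g q \<cdot> N = M \<cdot> bubs k"
    using monomial_tns.IH(2)[of "p @ a" q N] monomial_tns.prems by auto
  obtain L l where L: "nf (p @ b @ d @ q) L" "wh p f (d @ q) \<cdot> M = L \<cdot> bubs l"
    using monomial_tns.IH(1)[of p "d @ q" M] M(1) by auto
  note a = monomial_tns.hyps[THEN arr_mono]
  have "wh p (f \<parallel> g) q = wh p (wh [] f d) q \<cdot> wh p (wh a g []) q"
    unfolding tns_wh(1)[OF a] by (rule wh_cmp[OF arr_wh[OF a(1)] arr_whI[OF a(2)]]) simp_all
  then have "wh p (f \<parallel> g) q \<cdot> N = L \<cdot> bubs (l + k)"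
    by (simp add: cmp_assoc M(2) cmp_subst[OF L(2)] bubs_add)
  then show ?case using L(1) by auto
qed

lemma monomial_normal_form:
  assumes "monomial f [] w"
  obtains N k where "nf w N" "f = N \<cdot> bubs k"
proof -
  have "nf ([] @ [] @ []) (idm [])" by (simp add: nf_Nil)
  from monomial_nf_closed[OF assms this] obtain N k where "nf w N" "f \<cdot> idm [] = N \<cdot> bubs k"
    by auto
  then show thesis
    using that by (simp add: cmp_idm[OF arr_mono[OF assms]])
qed

subsection \<open>Bending the bottom line up\<close>

definition dual :: "letter list \<Rightarrow> letter list" where
  "dual a = rev (map bar a)"

lemma dual_simps [simp]: "dual [] = []" "dual (x # a) = dual a @ [bar x]"
  by (simp_all add: dual_def)

primrec coev :: "letter list \<Rightarrow> 'k::idom mor" where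
  "coev [] = idm []"
| "coev (x # a) = wh [x] (coev a) [bar x] \<cdot> eta (bar x)"

primrec eval :: "letter list \<Rightarrow> 'k::idom mor" where
  "eval [] = idm []"
| "eval (x # a) = eval a \<cdot> wh (dual a) (eps (bar x)) a"

lemma monomial_coev: "monomial (coev a) [] (a @ dual a)"
proof (induction a)
  case (Cons x a)
  show ?case
    unfolding coev.simps
    by (rule monomial_cmp[OF monomial_wh[OF Cons.IH] monomial_eta]) simp_all
qed (simp add: monomial_idm)

lemma monomial_eval: "monomial (eval a) (dual a @ a) []"
proof (induction a)
  case (Cons x a)
  show ?case
    unfolding eval.simps
    by (rule monomial_cmp[OF Cons.IH monomial_wh[OF monomial_eps]]) simp_all
qed (simp add: monomial_idm)

text \<open>The outermost cup and cap, belonging to \<open>x\<close>, are brought together past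
  \<open>coev a\<close> and cancel by a zigzag; the remainder is the claim for
  \<open>a\<close>.\<close>

lemma snake: "wh a (eval a) [] \<cdot> wh [] (coev a) a = (idm a :: 'k::idom mor)"
proof (induction a)
  case (Cons x a)
  note co = arr_mono[OF monomial_coev[of a]] and ev = arr_mono[OF monomial_eval[of a]]
  note c = wh_commute[OF co arr_eps[of "bar x"], of "[x]" "[]" a, simplified]
  have 1: "wh (x # a) (eval (x # a) :: 'k mor) [] = wh (x # a) (eval a) [] \<cdot> wh (x # a @ dual a) (eps (bar x)) a"
    unfolding eval.simps by (subst wh_cmp[OF ev arr_whI[OF arr_eps]]) simp_all
  have 2: "wh [] (coev (x # a) :: 'k mor) (x # a) = wh [x] (coev a) (bar x # x # a) \<cdot> wh [] (eta (bar x)) (x # a)"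
    unfolding coev.simps by (subst wh_cmp[OF arr_whI[OF co] arr_eta]) simp_all
  have 3: "wh [x] (eps (bar x)) a \<cdot> wh [] (eta (bar x)) (x # a) = (idm (x # a) :: 'k mor)"
    using wh_zig[where 'k = 'k, of "[]" "bar x" a] by simp
  have "wh [x] (wh a (eval a) [] \<cdot> wh [] (coev a) a) [] = wh (x # a) (eval a) [] \<cdot> (wh [x] (coev a) a :: 'k mor)"
    by (subst wh_cmp[OF arr_whI[OF ev] arr_whI[OF co]]) simp_all
  then have 4: "wh (x # a) (eval a) [] \<cdot> (wh [x] (coev a) a :: 'k mor) = idm (x # a)"
    unfolding Cons.IH by simp
  have a: "arr (wh [x] (coev a :: 'k mor) a) (x # a) (x # a @ dual a @ a)"
    by (rule arr_whI[OF co]) simp_all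
  show ?case
    unfolding 1 2
    by (simp only: cmp_assoc cmp_subst[OF c[symmetric]] 3 cmp_idm[OF a] 4)
qed (simp add: idm_cmp[OF arr_idm])

text \<open>Duality turns morphisms from \<open>a\<close> to \<open>b\<close> into morphisms from
  the empty word to \<open>b @ dual a\<close>.\<close>

definition bend :: "letter list \<Rightarrow> 'k::idom mor \<Rightarrow> 'k mor" where
  "bend a f = wh [] f (dual a) \<cdot> coev a"

definition unbend :: "letter list \<Rightarrow> letter list \<Rightarrow> 'k::idom mor \<Rightarrow> 'k mor" where
  "unbend a b g = wh b (eval a) [] \<cdot> wh [] g a"

lemma monomial_bend: "monomial f a b \<Longrightarrow> monomial (bend a f) [] (b @ dual a)"
  unfolding bend_def by (rule monomial_cmp[OF monomial_wh monomial_coev]) simp_all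

lemma monomial_unbend: "monomial g [] (b @ dual a) \<Longrightarrow> monomial (unbend a b g) a b"
  unfolding unbend_def by (rule monomial_cmp[OF monomial_wh[OF monomial_eval] monomial_wh]) simp_all

text \<open>\<open>f\<close> acts on letters disjoint from those of \<open>eval a\<close>, so it can
  be applied last; below it the nested zigzag remains.\<close>

lemma unbend_bend:
  fixes f :: "'k::idom mor"
  assumes "arr f a b"
  shows "unbend a b (bend a f) = f"
proof -
  note co = arr_mono[OF monomial_coev[of a, where 'a = 'k]] and ev = arr_mono[OF monomial_eval[of a, where 'a = 'k]]
  have 1: "wh [] (bend a f) a = wh [] f (dual a @ a) \<cdot> wh [] (coev a) a"
    unfolding bend_def by (subst wh_cmp[OF arr_whI[OF assms] co]) simp_all
  note c = wh_commute[OF assms ev, of "[]" "[]" "[]", simplified]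
  show ?thesis
    unfolding unbend_def 1 using cmp_idm[OF assms]
    by (simp add: cmp_subst[OF c[symmetric]] cmp_assoc snake)
qed

section \<open>Evaluation of expressions in the oriented Brauer category\<close>

text \<open>\<open>src\<close> and \<open>tgt\<close> let \<open>ev\<close> read the shift in a
  tensor product off the expression, without a typing derivation; they have the intended meaning on
  typed expressions.\<close>

primrec src :: "(letter, generator, 'k) expr \<Rightarrow> letter list" where
  "src (Gen x) = fst (generator_type x)"
| "src (Ident w) = w"
| "src (g \<bullet> f) = src f"
| "src (f \<star> g) = src f @ src g"
| "src (Zero a b) = a"
| "src (Plus f g) = src f"
| "src (Scale r f) = src f"

primrec tgt :: "(letter, generator, 'k) expr \<Rightarrow> letter list" where
  "tgt (Gen x) = snd (generator_type x)"
| "tgt (Ident w) = w"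
| "tgt (g \<bullet> f) = tgt g"
| "tgt (f \<star> g) = tgt f @ tgt g"
| "tgt (Zero a b) = b"
| "tgt (Plus f g) = tgt f"
| "tgt (Scale r f) = tgt f"

lemma typed_src_tgt: "typed e a b \<Longrightarrow> src e = a \<and> tgt e = b"
  by (induction rule: has_type.induct) auto

fun gen_diagram :: "generator \<Rightarrow> diagram" where
  "gen_diagram Gc = Diagram {(Top 1, Top 0)} 0"
| "gen_diagram Gd = Diagram {(Bot 1, Bot 0)} 0"
| "gen_diagram Gs = Diagram {(Bot 0, Top 1), (Bot 1, Top 0)} 0"
| "gen_diagram Gt = Diagram {(Bot 0, Top 1), (Top 0, Bot 1)} 0"

primrec ev :: "(letter, generator, 'k::idom) expr \<Rightarrow> diagram \<Rightarrow>\<^sub>0 'k" where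
  "ev (Gen x) = Poly_Mapping.single (gen_diagram x) 1"
| "ev (Ident w) = Poly_Mapping.single (id_diagram w) 1"
| "ev (g \<bullet> f) = extend_bilinearly comp_diagram (ev g) (ev f)"
| "ev (f \<star> g) = extend_bilinearly (tens_diagram (src f) (tgt f)) (ev f) (ev g)"
| "ev (Zero a b) = 0"
| "ev (Plus f g) = ev f + ev g"
| "ev (Scale r f) = Poly_Mapping.map ((*) r) (ev f)"

lemma sources_explicit:
  "sources [] [] = {}" "sources (\<up> # a) [] = insert (Bot 0) (shift 1 0 ` sources a [])"
  "sources (\<down> # a) [] = shift 1 0 ` sources a []"
  "sources a (\<up> # b) = shift 0 1 ` sources a b"
  "sources a (\<down> # b) = insert (Top 0) (shift 0 1 ` sources a b)"
proof -
  have "sources [\<up>] [] = {Bot 0}" "sources [\<down>] [] = {}" "sources [] [\<up>] = {}" "sources [] [\<down>] = {Top 0}" 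
    "sources [] [] = {}"
    by (auto simp: sources_def)
  then show "sources [] [] = {}" "sources (\<up> # a) [] = insert (Bot 0) (shift 1 0 ` sources a [])"
  "sources (\<down> # a) [] = shift 1 0 ` sources a []"
  "sources a (\<up> # b) = shift 0 1 ` sources a b"
  "sources a (\<down> # b) = insert (Top 0) (shift 0 1 ` sources a b)"
    using sources_append[of "[\<up>]" a "[]" "[]"] sources_append[of "[\<down>]" a "[]" "[]"]
      sources_append[of "[]" a "[\<up>]" b] sources_append[of "[]" a "[\<down>]" b] by simp_all
qed

lemma targets_explicit:
  "targets [] [] = {}" "targets (\<down> # a) [] = insert (Bot 0) (shift 1 0 ` targets a [])"
  "targets (\<up> # a) [] = shift 1 0 ` targets a []"
  "targets a (\<down> # b) = shift 0 1 ` targets a b"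
  "targets a (\<up> # b) = insert (Top 0) (shift 0 1 ` targets a b)"
proof -
  have "targets [\<down>] [] = {Bot 0}" "targets [\<up>] [] = {}" "targets [] [\<down>] = {}" "targets [] [\<up>] = {Top 0}" 
    "targets [] [] = {}"
    by (auto simp: targets_def)
  then show "targets [] [] = {}" "targets (\<down> # a) [] = insert (Bot 0) (shift 1 0 ` targets a [])"
  "targets (\<up> # a) [] = shift 1 0 ` targets a []"
  "targets a (\<down> # b) = shift 0 1 ` targets a b"
  "targets a (\<up> # b) = insert (Top 0) (shift 0 1 ` targets a b)"
    using targets_append[of "[\<up>]" a "[]" "[]"] targets_append[of "[\<down>]" a "[]" "[]"]
      targets_append[of "[]" a "[\<up>]" b] targets_append[of "[]" a "[\<down>]" b] by simp_all
qed

lemma gen_diagram_in: "generator_type x = (a, b) \<Longrightarrow> gen_diagram x \<in> diagrams a b"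
  unfolding diagrams_iff
  by (cases x) (auto simp: sources_explicit targets_explicit single_valued_def)

lemma keys_ev: "typed e a b \<Longrightarrow> Poly_Mapping.keys (ev e) \<subseteq> diagrams a b"
proof (induction rule: has_type.induct)
  case (1 x a b)
  then show ?case by (simp add: gen_diagram_in)
next
  case (2 a)
  then show ?case by (simp add: id_diagram_in)
next
  case (3 g b c f a)
  then show ?case using extend_closed[OF 3(3,4), of comp_diagram] comp_diagram_in by auto
next
  case (4 f a b g c d)
  then show ?case using extend_closed[OF 4(3,4), of "tens_diagram a b"] tens_diagram_in typed_src_tgt[OF 4(1)] by auto
next
  case (6 f a b g)
  then show ?case using Poly_Mapping.keys_add[of "ev f" "ev g"] by auto
next
  case (7 f a b r)
  then show ?case using keys_scale[of r "ev f"] by auto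
qed simp

section \<open>The relations hold between diagrams\<close>

lemma weight_gen:
  "weight (gen_diagram Gc) [] [x, y] = of_bool (x = y)"
  "weight (gen_diagram Gd) [x, y] [] = of_bool (x = y)"
  "weight (gen_diagram Gs) [x, y] [z, w] = of_bool (z = y \<and> w = x)"
  "weight (gen_diagram Gt) [x, y] [z, w] = of_bool (z = y \<and> w = x)"
  by (auto simp: weight_def)

declare gen_diagram.simps [simp del]

lemmas diagram_in [simp] = gen_diagram_in[of Gc, simplified] gen_diagram_in[of Gd, simplified]
  gen_diagram_in[of Gs, simplified] gen_diagram_in[of Gt, simplified] id_diagram_in

lemma tens_in: "D \<in> diagrams a b \<Longrightarrow> D' \<in> diagrams a' b' \<Longrightarrow> x = a @ a' \<Longrightarrow> y = b @ b' \<Longrightarrow>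
    tens_diagram a b D D' \<in> diagrams x y"
  using tens_diagram_in by simp

lemma weight_tens_take:
  assumes "D \<in> diagrams a b" "length a \<le> length p" "length b \<le> length q"
  shows "weight (tens_diagram a b D D') p q =
    weight D (take (length a) p) (take (length b) q) * weight D' (drop (length a) p) (drop (length b) q)"
  using weight_tens[OF assms(1), of "take (length a) p" "take (length b) q" D' "drop (length a) p" "drop (length b) q"]
    assms(2,3) by simp

lemma length_Suc_0E: "length p = Suc 0 \<Longrightarrow> (\<And>x. p = [x] \<Longrightarrow> thesis) \<Longrightarrow> thesis"
  by (auto simp: length_Suc_conv)

lemma zigzag_up_diagram:
  "comp_diagram (tens_diagram [\<up>] [\<up>] (id_diagram [\<up>]) (gen_diagram Gd))
    (tens_diagram [] [\<up>, \<down>] (gen_diagram Gc) (id_diagram [\<up>])) = id_diagram [\<up>]" (is "comp_diagram ?D' ?D = _")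
proof (rule weight_eqD[OF comp_diagram_in id_diagram_in])
  show i: "?D \<in> diagrams [\<up>] [\<up>, \<down>, \<up>]" "?D' \<in> diagrams [\<up>, \<down>, \<up>] [\<up>]"
    by (rule tens_in diagram_in; simp)+
  fix p q :: "bool list"
  assume "length p = length [\<up>]" "length q = length [\<up>]"
  then obtain x y where pq: "p = [x]" "q = [y]" by (auto elim!: length_Suc_0E)
  show "weight (comp_diagram ?D' ?D) p q = weight (id_diagram [\<up>]) p q"
    unfolding weight_comp[OF i] pq
    by (cases x; cases y; simp add: sum_words_Suc weight_tens_take weight_gen weight_id)
qed

lemma zigzag_down_diagram:
  "comp_diagram (tens_diagram [\<down>, \<up>] [] (gen_diagram Gd) (id_diagram [\<down>]))
    (tens_diagram [\<down>] [\<down>] (id_diagram [\<down>]) (gen_diagram Gc)) = id_diagram [\<down>]" (is "comp_diagram ?D' ?D = _")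
proof (rule weight_eqD[OF comp_diagram_in id_diagram_in])
  show i: "?D \<in> diagrams [\<down>] [\<down>, \<up>, \<down>]" "?D' \<in> diagrams [\<down>, \<up>, \<down>] [\<down>]"
    by (rule tens_in diagram_in; simp)+
  fix p q :: "bool list"
  assume "length p = length [\<down>]" "length q = length [\<down>]"
  then obtain x y where pq: "p = [x]" "q = [y]" by (auto elim!: length_Suc_0E)
  show "weight (comp_diagram ?D' ?D) p q = weight (id_diagram [\<down>]) p q"
    unfolding weight_comp[OF i] pq
    by (cases x; cases y; simp add: sum_words_Suc weight_tens_take weight_gen weight_id)
qed

text \<open>A diagram without cups transports the labels of the top line to those of the bottom line.\<close>

lemma weight_comp_fun:
  assumes "D \<in> diagrams a b" "D' \<in> diagrams b c" "length (h p) = length b"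
    and "\<And>q. length q = length b \<Longrightarrow> weight D p q = of_bool (q = h p)"
  shows "weight (comp_diagram D' D) p r = weight D' (h p) r"
proof -
  have "weight (comp_diagram D' D) p r = (\<Sum>q\<in>words (length b). weight D' q r * of_bool (h p = q))"
    unfolding weight_comp[OF assms(1,2)] using assms(4) by (intro sum.cong) (auto simp: in_words)
  then show ?thesis using assms(3) by (simp add: sum_words_delta in_words)
qed

lemma swap_diagram:
  assumes "length p = 2" "length q = 2" "x = Gs \<or> x = Gt"
  shows "weight (gen_diagram x) p q = of_bool (q = rev p)"
  using assms by (auto simp: numeral_2_eq_2 length_Suc_conv weight_gen)

lemma crossing_sq: "comp_diagram (gen_diagram Gs) (gen_diagram Gs) = id_diagram [\<up>, \<up>]"
proof (rule weight_eqD[OF comp_diagram_in id_diagram_in])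
  show i: "gen_diagram Gs \<in> diagrams [\<up>, \<up>] [\<up>, \<up>]" "gen_diagram Gs \<in> diagrams [\<up>, \<up>] [\<up>, \<up>]"
    by simp_all
  fix p q :: "bool list"
  assume "length p = length [\<up>, \<up>]" "length q = length [\<up>, \<up>]"
  then show "weight (comp_diagram (gen_diagram Gs) (gen_diagram Gs)) p q = weight (id_diagram [\<up>, \<up>]) p q"
    by (subst weight_comp_fun[OF i, of rev]) (auto simp: swap_diagram weight_id)
qed

text \<open>The diagram drawn by \<open>rotated_s\<close>. Its weights show that it transposes two
  labels, as the diagram of \<open>t\<close> does, so the two are mutually inverse.\<close>

definition rot_diagram :: diagram where
  "rot_diagram = comp_diagram
     (tens_diagram [\<down>, \<up>] [] (gen_diagram Gd) (id_diagram [\<up>, \<down>]))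
     (comp_diagram (tens_diagram [\<down>] [\<down>] (id_diagram [\<down>]) (tens_diagram [\<up>, \<up>] [\<up>, \<up>] (gen_diagram Gs) (id_diagram [\<down>])))
       (tens_diagram [\<down>] [\<down>] (id_diagram [\<down>]) (tens_diagram [\<up>] [\<up>] (id_diagram [\<up>]) (gen_diagram Gc))))"

lemma rot_diagram_in: "rot_diagram \<in> diagrams [\<down>, \<up>] [\<up>, \<down>]"
  and weight_rot_diagram: "length p = 2 \<Longrightarrow> length q = 2 \<Longrightarrow> weight rot_diagram p q = of_bool (q = rev p)"
proof -
  let ?D1 = "tens_diagram [\<down>] [\<down>] (id_diagram [\<down>]) (tens_diagram [\<up>] [\<up>] (id_diagram [\<up>]) (gen_diagram Gc))"
  let ?D2 = "tens_diagram [\<down>] [\<down>] (id_diagram [\<down>]) (tens_diagram [\<up>, \<up>] [\<up>, \<up>] (gen_diagram Gs) (id_diagram [\<down>]))"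
  let ?D3 = "tens_diagram [\<down>, \<up>] [] (gen_diagram Gd) (id_diagram [\<up>, \<down>])"
  have t: "tens_diagram [\<up>] [\<up>] (id_diagram [\<up>]) (gen_diagram Gc) \<in> diagrams [\<up>] [\<up>, \<up>, \<down>]"
    "tens_diagram [\<up>, \<up>] [\<up>, \<up>] (gen_diagram Gs) (id_diagram [\<down>]) \<in> diagrams [\<up>, \<up>, \<down>] [\<up>, \<up>, \<down>]"
    by (rule tens_in diagram_in; simp)+
  have i: "?D1 \<in> diagrams [\<down>, \<up>] [\<down>, \<up>, \<up>, \<down>]" "?D2 \<in> diagrams [\<down>, \<up>, \<up>, \<down>] [\<down>, \<up>, \<up>, \<down>]"
      "?D3 \<in> diagrams [\<down>, \<up>, \<up>, \<down>] [\<up>, \<down>]"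
    by (rule tens_in[OF diagram_in(5) t(1)] tens_in[OF diagram_in(5) t(2)] tens_in[OF diagram_in(2,5)]; simp)+
  have c: "comp_diagram ?D2 ?D1 \<in> diagrams [\<down>, \<up>] [\<down>, \<up>, \<up>, \<down>]"
    by (rule comp_diagram_in[OF i(1,2)])
  show "rot_diagram \<in> diagrams [\<down>, \<up>] [\<up>, \<down>]"
    unfolding rot_diagram_def by (rule comp_diagram_in[OF c i(3)])
  assume "length p = 2" "length q = 2"
  then obtain x y z w where pq: "p = [x, y]" "q = [z, w]"
    by (auto simp: numeral_2_eq_2 length_Suc_conv)
  have 1: "weight (comp_diagram ?D2 ?D1) [x, y] [k, l, m, n] = of_bool (k = x \<and> m = y \<and> l = n)" for x y k l m n
    unfolding weight_comp[OF i(1,2)]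
    by (cases x; cases y; simp add: sum_words_Suc weight_tens_take weight_gen weight_id) blast+
  show "weight rot_diagram p q = of_bool (q = rev p)"
    unfolding rot_diagram_def weight_comp[OF c i(3)] pq
    by (cases x; cases y; simp add: sum_words_Suc weight_tens_take weight_gen weight_id 1; blast?)
qed

lemma rot_inverse:
  "comp_diagram (gen_diagram Gt) rot_diagram = id_diagram [\<down>, \<up>]" (is ?A)
  "comp_diagram rot_diagram (gen_diagram Gt) = id_diagram [\<up>, \<down>]" (is ?B)
proof -
  have t: "gen_diagram Gt \<in> diagrams [\<up>, \<down>] [\<down>, \<up>]" by simp
  show ?A
  proof (rule weight_eqD[OF comp_diagram_in[OF rot_diagram_in t] id_diagram_in])
    fix p q :: "bool list"
    assume "length p = length [\<down>, \<up>]" "length q = length [\<down>, \<up>]"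
    then show "weight (comp_diagram (gen_diagram Gt) rot_diagram) p q = weight (id_diagram [\<down>, \<up>]) p q"
      by (subst weight_comp_fun[OF rot_diagram_in t, of rev]) (auto simp: swap_diagram weight_rot_diagram weight_id)
  qed
  show ?B
  proof (rule weight_eqD[OF comp_diagram_in[OF t rot_diagram_in] id_diagram_in])
    fix p q :: "bool list"
    assume "length p = length [\<up>, \<down>]" "length q = length [\<up>, \<down>]"
    then show "weight (comp_diagram rot_diagram (gen_diagram Gt)) p q = weight (id_diagram [\<up>, \<down>]) p q"
      by (subst weight_comp_fun[OF t rot_diagram_in, of rev]) (auto simp: swap_diagram weight_rot_diagram weight_id)
  qed
qed

text \<open>\<open>L\<close> and \<open>R\<close> transport labels by the adjacent transpositions
  \<open>hL\<close> and \<open>hR\<close>, which satisfy the braid relation.\<close>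

lemma braid_diagram:
  fixes L R defines "L \<equiv> tens_diagram [\<up>, \<up>] [\<up>, \<up>] (gen_diagram Gs) (id_diagram [\<up>])"
    and "R \<equiv> tens_diagram [\<up>] [\<up>] (id_diagram [\<up>]) (gen_diagram Gs)"
  shows "comp_diagram R (comp_diagram L R) = comp_diagram L (comp_diagram R L)"
proof (rule weight_eqD)
  have i: "L \<in> diagrams [\<up>, \<up>, \<up>] [\<up>, \<up>, \<up>]" "R \<in> diagrams [\<up>, \<up>, \<up>] [\<up>, \<up>, \<up>]"
    unfolding L_def R_def by (rule tens_in diagram_in; simp)+
  note c = comp_diagram_in[OF i(1,2)] comp_diagram_in[OF i(2,1)]
  show "comp_diagram R (comp_diagram L R) \<in> diagrams [\<up>, \<up>, \<up>] [\<up>, \<up>, \<up>]"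
    "comp_diagram L (comp_diagram R L) \<in> diagrams [\<up>, \<up>, \<up>] [\<up>, \<up>, \<up>]"
    by (rule comp_diagram_in i c)+
  fix p q :: "bool list"
  assume l: "length p = length [\<up>, \<up>, \<up>]" "length q = length [\<up>, \<up>, \<up>]"
  define hL hR where "hL p = [p ! 1, p ! 0, p ! 2]" and "hR p = [p ! 0, p ! 2, p ! 1]" for p :: "bool list"
  have hl [simp]: "length (hL p) = 3" "length (hR p) = 3" for p by (simp_all add: hL_def hR_def)
  have LR: "weight L p q = of_bool (q = hL p)" "weight R p q = of_bool (q = hR p)"
    if "length p = 3" "length q = 3" for p q
  proof -
    obtain a b c x y z where "p = [a, b, c]" "q = [x, y, z]"
      using \<open>length p = 3\<close> \<open>length q = 3\<close> by (auto simp: numeral_3_eq_3 length_Suc_conv)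
    then show "weight L p q = of_bool (q = hL p)" "weight R p q = of_bool (q = hR p)"
      by (auto simp: L_def R_def hL_def hR_def weight_tens_take weight_gen weight_id)
  qed
  have c2: "weight (comp_diagram L R) p q = of_bool (q = hL (hR p))" "weight (comp_diagram R L) p q = of_bool (q = hR (hL p))"
    if "length p = 3" "length q = 3" for p q
    using that LR by (simp_all add: weight_comp_fun[OF i(2,1), of hR] weight_comp_fun[OF i(1,2), of hL])
  have "weight (comp_diagram R (comp_diagram L R)) p q = of_bool (q = hR (hL (hR p)))"
    using l c2 LR by (simp add: weight_comp_fun[OF c(2) i(2), of "\<lambda>p. hL (hR p)"])
  moreover have "weight (comp_diagram L (comp_diagram R L)) p q = of_bool (q = hL (hR (hL p)))"
    using l c2 LR by (simp add: weight_comp_fun[OF c(1) i(1), of "\<lambda>p. hR (hL p)"])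
  ultimately show "weight (comp_diagram R (comp_diagram L R)) p q = weight (comp_diagram L (comp_diagram R L)) p q"
    by (simp add: hL_def hR_def)
qed

lemma ev_relation:
  assumes "(f, g) \<in> OB_relations"
  shows "ev f = ev g"
  using assms zigzag_up_diagram zigzag_down_diagram crossing_sq braid_diagram rot_inverse
  by (auto simp: OB_relations_def rotated_s_def tens_id rot_diagram_def)

lemma map_scale_assoc: "Poly_Mapping.map ((*) (r :: 'k::idom)) (Poly_Mapping.map ((*) s) f) = Poly_Mapping.map ((*) (r * s)) f"
  by (rule poly_mapping_eqI) (simp add: mult.assoc)

text \<open>Each rule of derivation is valid for linear combinations of diagrams: structural rules
  by the laws already shown, relations by \<open>ev_relation\<close>.\<close>

lemma ev_sound: "OB_eqv a b f g \<Longrightarrow> ev f = ev g"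
proof (induction rule: eqv.induct)
  case (Tens_cong a b f f' c d g g')
  then show ?case
    using typed_src_tgt eqv_has_type by (metis ev.simps(4))
next
  case (Ident_left f a b)
  then show ?case
    using extend_unit_left[OF keys_ev[OF Ident_left], of comp_diagram "id_diagram b"] comp_id_left by simp
next
  case (Ident_right f a b)
  then show ?case
    using extend_unit_right[OF keys_ev[OF Ident_right], of comp_diagram "id_diagram a"] comp_id_right by simp
next
  case (Comp_assoc h c d g b f a)
  then show ?case
    using extend_assoc[OF keys_ev[OF Comp_assoc(1)] keys_ev[OF Comp_assoc(2)] keys_ev[OF Comp_assoc(3)],
      of comp_diagram comp_diagram comp_diagram comp_diagram] comp_diagram_assoc by simp
next
  case (Tens_unit_left f a b)
  then show ?case
    using extend_unit_left[OF subset_refl, where op = "tens_diagram [] []" and e = "id_diagram []" and f = "ev f", OF tens_unit_left] by simp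
next
  case (Tens_unit_right f a b)
  then show ?case
    using extend_unit_right[OF subset_refl, where op = "tens_diagram (src f) (tgt f)" and e = "id_diagram []" and f = "ev f", OF tens_unit_right] by simp
next
  case (Tens_assoc f a b g c d h p q)
  then show ?case
    by (simp, intro extend_assoc[OF subset_refl subset_refl subset_refl] tens_diagram_assoc)
next
  case (Tens_Ident a b)
  then show ?case by (simp add: tens_id)
next
  case (Interchange g b c f a g' q r f' p)
  note t = Interchange[THEN typed_src_tgt]
  show ?case
    using extend_interchange[OF keys_ev[OF Interchange(1)] keys_ev[OF Interchange(2)] keys_ev[OF Interchange(3)] keys_ev[OF Interchange(4)],
      of "tens_diagram a c" comp_diagram comp_diagram comp_diagram "tens_diagram b c" "tens_diagram a b"] tens_comp t
    by simp
next
  case (relation f g a b)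
  then show ?case by (simp add: ev_relation)
next
  case (Tens_Plus_left f a b g h c d)
  then show ?case using typed_src_tgt[of f a b] typed_src_tgt[of g a b] by (simp add: extend_add_left)
next
  case (Plus_minus f a b)
  then show ?case by (intro poly_mapping_eqI) (simp add: lookup_add)
next
  case (Scale_Plus f a b g r)
  then show ?case by (intro poly_mapping_eqI) (simp add: lookup_add distrib_left)
next
  case (Scale_add f a b r s)
  then show ?case by (intro poly_mapping_eqI) (simp add: lookup_add distrib_right)
next
  case (Scale_one f a b)
  then show ?case by (intro poly_mapping_eqI) simp
qed (simp_all add: add_ac extend_add_left extend_add_right extend_scale_left extend_scale_right map_scale_assoc)

text \<open>All ill-typed expressions represent the same element of \<open>mor\<close> and so need a
  common value, chosen to be 0.\<close>

lift_definition evm :: "'k::idom mor \<Rightarrow> diagram \<Rightarrow>\<^sub>0 'k" is "\<lambda>e. if \<exists>a b. typed e a b then ev e else 0"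
  subgoal premises prems for e f
  proof -
    note D = same_morD[OF prems]
    have "(\<exists>a b. typed e a b) \<longleftrightarrow> (\<exists>a b. typed f a b)"
      using D(1,2) by blast
    moreover have "ev e = ev f" if "\<exists>a b. typed e a b"
      using that ev_sound[OF D(3)] by blast
    ultimately show ?thesis by simp
  qed
  done

lemma evm_abs: "typed e a b \<Longrightarrow> evm (abs_mor e) = ev e"
  by (auto simp: evm.abs_eq)

lemma mor_cases:
  assumes "arr f a b"
  obtains e where "f = abs_mor e" "typed e a b"
proof -
  obtain e where "f = abs_mor e" by (metis Quotient_mor Quotient_abs_rep)
  with assms that show thesis by (simp add: arr_abs_mor)
qed

lemma evm_cmp:
  assumes "arr g b c" "arr f a b"
  shows "evm (g \<cdot> f) = extend_bilinearly comp_diagram (evm g) (evm f)"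
proof -
  obtain e e' where e: "g = abs_mor e" "typed e b c" "f = abs_mor e'" "typed e' a b"
    using assms by (metis mor_cases)
  then show ?thesis
    using evm_abs[OF has_type.intros(3)[OF e(2,4)]] by (simp add: evm_abs cmp.abs_eq)
qed

lemma evm_tns:
  assumes "arr f a b" "arr g c d"
  shows "evm (f \<parallel> g) = extend_bilinearly (tens_diagram a b) (evm f) (evm g)"
proof -
  obtain e e' where e: "f = abs_mor e" "typed e a b" "g = abs_mor e'" "typed e' c d"
    using assms by (metis mor_cases)
  then show ?thesis
    using evm_abs[OF has_type.intros(4)[OF e(2,4)]] typed_src_tgt[OF e(2)] by (simp add: evm_abs tns.abs_eq)
qed

lemma evm_idm: "evm (idm a) = Poly_Mapping.single (id_diagram a) 1"
  using evm_abs[OF has_type.intros(2)] by (simp add: idm.abs_eq)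

lemma evm_gen: "evm (gen x) = Poly_Mapping.single (gen_diagram x) 1"
  using evm_abs[OF has_type.intros(1)[OF surjective_pairing]] by (simp add: gen.abs_eq)

definition diag :: "'k::idom mor \<Rightarrow> diagram" where
  "diag f = (THE D. evm f = Poly_Mapping.single D 1)"

lemma diag_eqI: "evm (f :: 'k::idom mor) = Poly_Mapping.single D 1 \<Longrightarrow> diag f = D"
  unfolding diag_def
proof (rule the_equality)
  fix D' assume "evm f = Poly_Mapping.single D 1" "evm f = Poly_Mapping.single D' 1"
  then have "Poly_Mapping.keys (Poly_Mapping.single D (1 :: 'k)) = Poly_Mapping.keys (Poly_Mapping.single D' (1 :: 'k))"
    by simp
  then show "D' = D" by simp
qed

text \<open>Stacking or juxtaposing two diagrams with coefficient 1 gives one diagram with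
  coefficient 1. This is what makes the description in \<open>diag\<close> meaningful for
  monomials.\<close>

lemma monomial_diag:
  "monomial (f :: 'k::idom mor) a b \<Longrightarrow> diag f \<in> diagrams a b \<and> evm f = Poly_Mapping.single (diag f) 1"
proof (induction rule: monomial.induct)
  case (monomial_gen x a b)
  then show ?case using diag_eqI[OF evm_gen[where 'a = 'k, of x]] by (simp add: gen_diagram_in evm_gen)
next
  case (monomial_idm a)
  then show ?case using diag_eqI[OF evm_idm[where 'a = 'k, of a]] by (simp add: evm_idm)
next
  case (monomial_cmp g b c f a)
  then have "evm (g \<cdot> f) = Poly_Mapping.single (comp_diagram (diag g) (diag f)) 1"
    by (simp add: evm_cmp[OF arr_mono arr_mono])
  then show ?case using diag_eqI comp_diagram_in monomial_cmp by metis
next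
  case (monomial_tns f a b g c d)
  then have "evm (f \<parallel> g) = Poly_Mapping.single (tens_diagram a b (diag f) (diag g)) 1"
    by (simp add: evm_tns[OF arr_mono arr_mono])
  then show ?case using diag_eqI tens_diagram_in monomial_tns by metis
qed

lemmas diag_in = monomial_diag[THEN conjunct1] and evm_mono = monomial_diag[THEN conjunct2]

lemma diag_cmp: "monomial g b c \<Longrightarrow> monomial f a b \<Longrightarrow> diag (g \<cdot> f) = comp_diagram (diag g) (diag f)"
  by (rule diag_eqI) (simp add: evm_cmp[OF arr_mono arr_mono] evm_mono)

lemma diag_tns: "monomial f a b \<Longrightarrow> monomial g c d \<Longrightarrow> diag (f \<parallel> g) = tens_diagram a b (diag f) (diag g)"
  by (rule diag_eqI) (simp add: evm_tns[OF arr_mono arr_mono] evm_mono)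

lemma diag_idm: "diag (idm a) = id_diagram a"
  by (rule diag_eqI) (rule evm_idm)

lemma diag_gen: "diag (gen x) = gen_diagram x"
  by (rule diag_eqI) (rule evm_gen)

subsection \<open>Weights of normal forms\<close>

definition wt :: "'k::idom mor \<Rightarrow> bool list \<Rightarrow> bool list \<Rightarrow> nat" where
  "wt f = weight (diag f)"

lemma wt_cmp:
  "monomial g b c \<Longrightarrow> monomial f a b \<Longrightarrow> wt (g \<cdot> f) p r = (\<Sum>q\<in>words (length b). wt g q r * wt f p q)"
  unfolding wt_def by (simp add: diag_cmp weight_comp[OF diag_in diag_in])

lemma wt_idm: "length p = length a \<Longrightarrow> length q = length a \<Longrightarrow> wt (idm a) p q = of_bool (p = q)"
  by (simp add: wt_def diag_idm weight_id)

lemma wt_tns: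
  "monomial f a b \<Longrightarrow> monomial g c d \<Longrightarrow> length p = length a \<Longrightarrow> length q = length b \<Longrightarrow>
    wt (f \<parallel> g) (p @ p') (q @ q') = wt f p q * wt g p' q'"
  unfolding wt_def by (simp add: diag_tns weight_tens[OF diag_in])

lemma wt_wh:
  assumes "monomial f a b" "length p1 = length u" "length q1 = length u" "length p = length a" "length q = length b"
    "length p2 = length v" "length q2 = length v"
  shows "wt (wh u f v) (p1 @ p @ p2) (q1 @ q @ q2) = of_bool (p1 = q1 \<and> p2 = q2) * wt f p q"
  unfolding wh_def using assms
  by (simp add: wt_tns[OF monomial_idm monomial_tns[OF assms(1) monomial_idm]] wt_tns[OF assms(1) monomial_idm] wt_idm)

lemma wt_gen:
  "wt (gen Gc) [] [x, y] = of_bool (x = y)"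
  "wt (gen Gd) [x, y] [] = of_bool (x = y)"
  "wt (gen Gs) [x, y] [z, w] = of_bool (z = y \<and> w = x)"
  "wt (gen Gt) [x, y] [z, w] = of_bool (z = y \<and> w = x)"
  by (simp_all add: wt_def diag_gen weight_gen)

text \<open>The added cup and cap carry the label of the rotated strand around its two bends
  unchanged, so rotation preserves the property of transposing two labels.\<close>

lemma wt_rot:
  assumes "monomial B [z, \<up>] [\<up>, z]" "\<And>x y k l. wt B [x, y] [k, l] = of_bool (k = y \<and> l = x)"
  shows "wt (rot z B) [x, y] [k, l] = of_bool (k = y \<and> l = x)"
proof -
  have 1: "monomial (wh [\<down>, z] (gen Gc) []) [\<down>, z] [\<down>, z, \<up>, \<down>]"
    "monomial (wh [\<down>] B [\<down>]) [\<down>, z, \<up>, \<down>] [\<down>, \<up>, z, \<down>]"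
    "monomial (wh [] (gen Gd) [z, \<down>]) [\<down>, \<up>, z, \<down>] [z, \<down>]"
    by (rule monomial_wh[OF monomial_gen] monomial_wh[OF assms(1)]; simp)+
  have c: "wt (wh [\<down>, z] (gen Gc) []) [x, y] [p, q, r, s] = of_bool (x = p \<and> y = q \<and> r = s)" for x y p q r s
    using wt_wh[OF monomial_gen[of Gc], of "[]" "[\<up>, \<down>]" "[x, y]" "[\<down>, z]" "[p, q]" "[]" "[r, s]" "[]" "[]" "[]"]
    by (auto simp: wt_gen)
  have d: "wt (wh [] (gen Gd) [z, \<down>]) [p, q, r, s] [x, y] = of_bool (p = q \<and> r = x \<and> s = y)" for x y p q r s
    using wt_wh[OF monomial_gen[of Gd], of "[\<down>, \<up>]" "[]" "[]" "[]" "[]" "[p, q]" "[]" "[r, s]" "[z, \<down>]" "[x, y]"]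
    by (auto simp: wt_gen)
  have b: "wt (wh [\<down>] B [\<down>]) [p, q, r, s] [p', q', r', s'] = of_bool (p = p' \<and> q = r' \<and> r = q' \<and> s = s')"
    for p q r s p' q' r' s'
    using wt_wh[OF assms(1), of "[p]" "[\<down>]" "[p']" "[q, r]" "[q', r']" "[s]" "[\<down>]" "[s']"]
    by (auto simp: assms(2))
  have bc: "wt (wh [\<down>] B [\<down>] \<cdot> wh [\<down>, z] (gen Gc) []) [x, y] [p, q, r, s] = of_bool (p = x \<and> r = y \<and> q = s)"
    for x y p q r s
    unfolding wt_cmp[OF 1(2,1)] by (cases x; cases y; simp add: sum_words_Suc b c; blast)
  show ?thesis
    unfolding rot_def wt_cmp[OF 1(3) monomial_cmp[OF 1(2,1)]]
    by (cases x; cases y; simp add: sum_words_Suc d bc; blast?)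
qed

lemma wt_cross: "wt (cross y x :: 'k::idom mor) [p, q] [r, s] = of_bool (r = q \<and> s = p)"
proof -
  let ?r = "rot \<up> (gen Gs) :: 'k mor"
  have 1: "monomial ?r [\<down>, \<up>] [\<up>, \<down>]"
    using monomial_cross[of \<down> \<up>, where 'a = 'k] by (simp add: cross.simps)
  have 2: "wt ?r [p, q] [r, s] = of_bool (r = q \<and> s = p)" for p q r s
    by (rule wt_rot[OF monomial_gen]) (simp_all add: wt_gen)
  show ?thesis
    using 2 wt_rot[OF 1 2] by (cases y; cases x) (simp_all add: cross.simps wt_gen)
qed

lemma wt_eta: "wt (eta x) [] [p, q] = of_bool (p = q)"
  by (cases x) (auto simp: eta.simps wt_gen wt_cmp[OF monomial_gen monomial_gen] sum_words_Suc)

lemma wt_eps: "wt (eps x) [p, q] [] = of_bool (p = q)"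
  by (cases x) (auto simp: eps.simps wt_gen wt_cmp[OF monomial_gen monomial_gen] sum_words_Suc)

lemma wt_bubs: "wt (bubs k :: 'k::idom mor) [] [] = 2 ^ k"
proof (induction k)
  case (Suc k)
  have "monomial (bub :: 'k mor) [] []"
    unfolding bub_def
    by (rule monomial_cmp[OF monomial_eps[of \<up>, simplified] monomial_eta[of \<down>, simplified]])
  moreover have "wt (bub :: 'k mor) [] [] = 2"
    unfolding bub_def wt_cmp[OF monomial_eps[of \<up>, simplified] monomial_eta[of \<down>, simplified]]
    by (simp add: sum_words_Suc wt_eta wt_eps)
  ultimately show ?case
    using Suc by (simp add: wt_cmp[OF _ monomial_bubs])
qed (simp add: wt_idm)

lemma sum_words_delta2:
  fixes F :: "bool list \<Rightarrow> nat"
  assumes "p \<in> words n" "\<And>q. q \<in> words n \<Longrightarrow> F q = of_bool (q = p) * c q"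
  shows "(\<Sum>q\<in>words n. F q) = c p"
  using assms sum_words_delta(2)[of p n c] by simp

lemma wt_slide:
  "length p = length v \<Longrightarrow> length q = length v \<Longrightarrow> wt (slide v x :: 'k::idom mor) (p @ [a]) (b # q) = of_bool (a = b \<and> p = q)"
proof (induction v arbitrary: p q b)
  case Nil
  then show ?case by (simp add: wt_idm)
next
  case (Cons y v)
  obtain c p' where p: "p = c # p'" "length p' = length v" using Cons.prems(1) by (cases p) auto
  obtain d q' where q: "q = d # q'" "length q' = length v" using Cons.prems(2) by (cases q) auto
  have m: "monomial (wh [] (cross y x :: 'k mor) v) (y # x # v) (x # y # v)" "monomial (wh [y] (slide v x :: 'k mor) []) (y # v @ [x]) (y # x # v)"
    by (rule monomial_wh[OF monomial_cross] monomial_wh[OF monomial_slide]; simp)+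
  show ?case
    unfolding slide.simps wt_cmp[OF m]
  \<comment> \<open>The only intermediate word that can contribute is the one in which
    \<open>a\<close> has passed \<open>p'\<close> but not yet \<open>c\<close>.\<close>
  proof (rule sum_words_delta2[where p = "c # a # p'" and c = "\<lambda>r. of_bool (a = b \<and> p = q)"])
    fix r assume "r \<in> words (length (y # x # v))"
    then obtain r1 r2 r' where r: "r = r1 # r2 # r'" "length r' = length v"
      by (auto simp: in_words length_Suc_conv)
    have "wt (wh [] (cross y x :: 'k mor) v) r (b # q) = of_bool (r' = q') * of_bool (b = r2 \<and> d = r1)"
      using wt_wh[OF monomial_cross[of y x, where 'a = 'k], of "[]" "[]" "[]" "[r1, r2]" "[b, d]" r' v q'] r q
      by (simp add: wt_cross)
    moreover have "wt (wh [y] (slide v x :: 'k mor) []) (p @ [a]) r = of_bool (c = r1) * of_bool (a = r2 \<and> p' = r')"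
      using wt_wh[OF monomial_slide[of v x, where 'a = 'k], of "[c]" "[y]" "[r1]" "p' @ [a]" "r2 # r'" "[]" "[]" "[]"] r p Cons.IH
      by simp
    ultimately show "wt (wh [] (cross y x :: 'k mor) v) r (b # q) * wt (wh [y] (slide v x :: 'k mor) []) (p @ [a]) r =
        of_bool (r = c # a # p') * of_bool (a = b \<and> p = q)"
      by (auto simp: r p q)
  qed (simp add: in_words p)
qed


text \<open>The new strand forces its two labels to agree and leaves the others to
  \<open>N\<close>.\<close>

lemma wt_attach:
  assumes N: "monomial (N :: 'k::idom mor) [] (u @ v)" and l: "length q1 = length u" "length q2 = length v"
  shows "wt (attach u v x N) [] (q1 @ a # q2 @ [b]) = of_bool (a = b) * wt N [] (q1 @ q2)"
proof -
  let ?e = "wh (u @ v) (eta x) [] :: 'k mor" and ?s = "wh u (slide v (bar x)) [x] :: 'k mor"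
  have e: "monomial ?e (u @ v) (u @ v @ [bar x, x])" and s: "monomial ?s (u @ v @ [bar x, x]) (u @ bar x # v @ [x])"
    by (rule monomial_wh[OF monomial_eta] monomial_wh[OF monomial_slide]; simp)+
  note eN = monomial_cmp[OF e N]
  have 1: "wt (?e \<cdot> N) [] (r @ [c, d]) = of_bool (c = d) * wt N [] r" if "length r = length (u @ v)" for r c d
    unfolding wt_cmp[OF e N]
  proof (rule sum_words_delta2[where p = r and c = "\<lambda>q. of_bool (c = d) * wt N [] q"])
    fix q assume "q \<in> words (length (u @ v))"
    then show "wt ?e q (r @ [c, d]) * wt N [] q = of_bool (q = r) * (of_bool (c = d) * wt N [] q)"
      using wt_wh[OF monomial_eta[of x, where 'a = 'k], of q "u @ v" r "[]" "[c, d]" "[]" "[]" "[]"] that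
      by (simp add: wt_eta in_words)
  qed (use that in \<open>simp add: in_words\<close>)
  show ?thesis
    unfolding attach_def wt_cmp[OF s eN]
  \<comment> \<open>Before the slide, the label \<open>a\<close> of the foot stands next to
    \<open>b\<close>; no other intermediate word contributes.\<close>
  proof (rule sum_words_delta2[where p = "(q1 @ q2) @ [a, b]" and c = "\<lambda>q. of_bool (a = b) * wt N [] (q1 @ q2)"])
    fix r assume "r \<in> words (length (u @ v @ [bar x, x]))"
    then have lr: "length r = length u + (length v + 2)" by (simp add: in_words)
    define r1 r2 c d where "r1 = take (length u) r" and "r2 = take (length v) (drop (length u) r)"
      and "c = r ! (length u + length v)" and "d = r ! (length u + length v + 1)"
    have r: "r = r1 @ r2 @ [c, d]" "length r1 = length u" "length r2 = length v"
    proof -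
      have "drop (length u + length v) r = [c, d]"
        using Cons_nth_drop_Suc[of "length u + length v" r] Cons_nth_drop_Suc[of "Suc (length u + length v)" r] lr
        by (simp add: c_def d_def)
      moreover have "r = r1 @ r2 @ drop (length v) (drop (length u) r)"
        unfolding r1_def r2_def by (simp only: append_take_drop_id)
      ultimately show "r = r1 @ r2 @ [c, d]" by (simp add: add.commute)
    qed (use lr in \<open>simp_all add: r1_def r2_def\<close>)
    have "wt ?s r (q1 @ a # q2 @ [b]) = of_bool (r1 = q1 \<and> d = b) * of_bool (c = a \<and> r2 = q2)"
      using wt_wh[OF monomial_slide[of v "bar x", where 'a = 'k], of r1 u q1 "r2 @ [c]" "a # q2" "[d]" "[x]" "[b]"] r l
      by (simp add: wt_slide)
    moreover have "wt (?e \<cdot> N) [] r = of_bool (c = d) * wt N [] (r1 @ r2)"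
      using 1[of "r1 @ r2" c d] r by simp
    ultimately show "wt ?s r (q1 @ a # q2 @ [b]) * wt (?e \<cdot> N) [] r =
      of_bool (r = (q1 @ q2) @ [a, b]) * (of_bool (a = b) * wt N [] (q1 @ q2))"
      by (auto simp: r l)
  qed (use l in \<open>simp add: in_words\<close>)
qed

text \<open>The value 1 reflects that a normal form contains no bubbles.\<close>

lemma wt_nf_pos: "nf w N \<Longrightarrow> wt N [] (replicate (length w) False) = 1"
proof (induction rule: nf.induct)
  case nf_Nil
  then show ?case by (simp add: wt_idm)
next
  case (nf_attach u v N x)
  have "replicate (length (u @ bar x # v @ [x])) False =
     replicate (length u) False @ False # replicate (length v) False @ [False]"
    by (rule HOL.sym, rule replicate_eqI) auto
  then show ?case
    using wt_attach[OF monomial_nf[OF nf_attach(1)], of "replicate (length u) False" "replicate (length v) False" x False False]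
      nf_attach(2) by (simp add: replicate_add)
qed

lemma wt_attach_pos:
  assumes "nf (u @ v) N"
  shows "wt (attach u v x N) [] (replicate (length u) False @ True # replicate (length v) False @ [True]) = 1"
  using wt_attach[OF monomial_nf[OF assms], of "replicate (length u) False" "replicate (length v) False" x True True]
    wt_nf_pos[OF assms] by (simp add: replicate_add)

text \<open>The position matched with the last letter is the only one whose label can be made true along with it.\<close>

lemma wt_attach_other:
  assumes N: "nf (u @ v) (N :: 'k::idom mor)" and w: "u @ bar x # v @ [x] = u' @ bar x # v' @ [x]" and "length u \<noteq> length u'"
  shows "wt (attach u v x N) [] (replicate (length u') False @ True # replicate (length v') False @ [True]) = 0"
proof -
  define Q where "Q = replicate (length u') False @ True # replicate (length v') False"
  have l: "length Q = length u + Suc (length v)"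
    using arg_cong[OF w, of length] by (simp add: Q_def)
  have "Q ! length u = False"
    using assms(3) l by (simp add: Q_def nth_append nth_Cons')
  then have Q: "Q = take (length u) Q @ False # drop (Suc (length u)) Q"
    using id_take_nth_drop[of "length u" Q] l by simp
  have "wt (attach u v x N) [] (take (length u) Q @ False # drop (Suc (length u)) Q @ [True]) = 0"
    using l by (subst wt_attach[OF monomial_nf[OF N]]) simp_all
  moreover have "take (length u) Q @ False # drop (Suc (length u)) Q @ [True] = Q @ [True]"
    using arg_cong[OF Q, of "\<lambda>xs. xs @ [True]"] by simp
  ultimately have "wt (attach u v x N) [] (Q @ [True]) = 0" by (simp only:)
  then show ?thesis by (simp add: Q_def)
qed

text \<open>A label word that is true at the last position and at one other has nonzero weight only
  if these two positions are joined, so the weights determine the partner of the last letter.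
  Setting both labels to true then gives the assumption for the smaller normal forms, and at the
  empty word the powers of 2 themselves are compared.\<close>

lemma nf_unique:
  "nf w (N :: 'k::idom mor) \<Longrightarrow> nf w N' \<Longrightarrow>
    (\<And>q. length q = length w \<Longrightarrow> 2 ^ k * wt N [] q = 2 ^ k' * wt N' [] q) \<Longrightarrow> N = N' \<and> k = k'"
proof (induction arbitrary: N' rule: nf.induct)
  case nf_Nil
  have "N' = idm []" using nf_Nil(1) by (cases rule: nf.cases) simp_all
  then show ?case using nf_Nil(2)[of "[]"] by (simp add: wt_idm)
next
  case (nf_attach u v N x)
  from nf_attach(3) show ?case
  proof (cases rule: nf.cases)
    case (nf_attach u' v' M x')
    note N' = this and N = nf_attach.hyps
    have "(u @ bar x # v) @ [x] = (u' @ bar x' # v') @ [x']"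
      using N'(1) by (simp only: append_assoc append_Cons)
    then have x: "x' = x" and uv: "u @ bar x # v = u' @ bar x' # v'"
      unfolding append1_eq_conv by blast+
    have len: "length u = length u'"
    proof (rule ccontr)
      assume neq: "length u \<noteq> length u'"
      have "wt (attach u v x N) [] (replicate (length u') False @ True # replicate (length v') False @ [True]) = 0"
        by (rule wt_attach_other[OF \<open>nf (u @ v) N\<close> _ neq]) (use N'(1) x in simp)
      moreover have "wt N' [] (replicate (length u') False @ True # replicate (length v') False @ [True]) = 1"
        unfolding N'(2) x by (rule wt_attach_pos[OF N'(3)])
      moreover have "length (replicate (length u') False @ True # replicate (length v') False @ [True]) = length (u @ bar x # v @ [x])"
        unfolding N'(1) by simp
      ultimately show False
        using nf_attach.prems(2) by (metis mult_0_right mult_1_right power_not_zero zero_neq_numeral)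
    qed
    then have e: "u' = u" "v' = v" using uv x by auto
    have "N = M \<and> k = k'"
    proof (rule nf_attach.IH)
      show "nf (u @ v) M" using N'(3) e by simp
      fix q :: "bool list" assume l: "length q = length (u @ v)"
      define q1 q2 where "q1 = take (length u) q" and "q2 = drop (length u) q"
      have q: "q = q1 @ q2" "length q1 = length u" "length q2 = length v"
        using l by (simp_all add: q1_def q2_def)
      show "2 ^ k * wt N [] q = 2 ^ k' * wt M [] q"
        using nf_attach.prems(2)[of "q1 @ True # q2 @ [True]"]
          wt_attach[OF monomial_nf[OF \<open>nf (u @ v) N\<close>] q(2,3), of x True True]
          wt_attach[OF monomial_nf[OF N'(3)[unfolded e]] q(2,3), of x True True]
        by (simp add: N'(2) e x q)
    qed
    then show ?thesis by (simp add: N'(2) e x)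
  qed simp
qed

section \<open>Drawing every diagram out of the empty word by a normal form\<close>

lemma wt_cmp_bubs:
  assumes "monomial (N :: 'k::idom mor) [] w"
  shows "wt (N \<cdot> bubs k) [] q = 2 ^ k * wt N [] q"
  by (simp add: wt_cmp[OF assms monomial_bubs] wt_bubs)

fun skip :: "nat \<Rightarrow> endpoint \<Rightarrow> endpoint" where
  "skip i (Bot j) = Bot j"
| "skip i (Top j) = Top (if j < i then j else Suc j)"

lemma inj_skip: "inj (skip i)"
  by (rule injI, case_tac x; case_tac y) (auto split: if_splits)

lemma letter_cases: "(x :: letter) = y \<or> x = bar y"
  by (cases x; cases y) auto

text \<open>The bottom line is empty, so both ends of the strand lie on top, where sources are downs
  and targets are ups; hence the opposite letter.\<close>

lemma last_partner:
  assumes D: "D \<in> diagrams [] (w @ [x])"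
  obtains u v s t where "w = u @ bar x # v" "(s, t) \<in> strands D" "{s, t} = {Top (length u), Top (length w)}"
proof -
  have "\<exists>i. i < length w \<and> w ! i = bar x \<and> ((Top (length w), Top i) \<in> strands D \<or> (Top i, Top (length w)) \<in> strands D)"
  proof (cases x)
    case Up
    then have "Top (length w) \<in> targets [] (w @ [x])" by (simp add: targets_def)
    then obtain y where y: "(y, Top (length w)) \<in> strands D" using diagramsD(4)[OF D] by blast
    then have "y \<in> sources [] (w @ [x])" using strand_in[OF D] by blast
    then show ?thesis using y Up by (auto simp: sources_def nth_append split: if_splits)
  next
    case Down
    then have "Top (length w) \<in> sources [] (w @ [x])" by (simp add: sources_def)
    then obtain y where y: "(Top (length w), y) \<in> strands D" using diagramsD(3)[OF D] by blast
    then have "y \<in> targets [] (w @ [x])" using strand_in[OF D] by blast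
    then show ?thesis using y Down by (auto simp: targets_def nth_append split: if_splits)
  qed
  then obtain i where i: "i < length w" "w ! i = bar x" "(Top (length w), Top i) \<in> strands D \<or> (Top i, Top (length w)) \<in> strands D"
    by blast
  then have "w = take i w @ bar x # drop (Suc i) w" using id_take_nth_drop[of i w] by simp
  moreover have "length (take i w) = i" using i by simp
  ultimately show thesis using that i(3) by (metis insert_commute)
qed

text \<open>Deleting the strand at the last position, with \<open>skip\<close> renumbering the other
  positions, changes weights by the same rule as \<open>wt_attach\<close>. This lets
  \<open>nf_full\<close> put the strand back by \<open>attach\<close>.\<close>

lemma remove_last:
  assumes D: "D \<in> diagrams [] (u @ bar x # v @ [x])" and st: "(s, t) \<in> strands D"
    and T: "{s, t} = {Top (length u), Top (Suc (length u + length v))}"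
  defines "D' \<equiv> Diagram {(y, z). (skip (length u) y, skip (length u) z) \<in> strands D} (bubbles D)"
  shows "D' \<in> diagrams [] (u @ v)"
    and "\<And>q1 q2 a b. length q1 = length u \<Longrightarrow> length q2 = length v \<Longrightarrow>
      weight D [] (q1 @ a # q2 @ [b]) = of_bool (a = b) * weight D' [] (q1 @ q2)"
proof -
  let ?i = "length u" and ?n = "Suc (length u + length v)" and ?w = "u @ bar x # v @ [x]"
  let ?T = "{Top ?i, Top ?n}" and ?S = "strands D"
  have other: "y = s \<and> z = t \<or> y \<notin> ?T \<and> z \<notin> ?T" if "(y, z) \<in> ?S" for y z
  proof -
    have "y = s \<longleftrightarrow> z = t"
      using that st diagramsD(1,2)[OF D] unfolding single_valued_def by blast
    moreover have "y \<noteq> t" "z \<noteq> s"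
      using strand_in[OF D that] strand_in[OF D st] sources_targets_disjoint by blast+
    ultimately show ?thesis unfolding T[symmetric] by blast
  qed
  have not_i: "skip ?i y \<noteq> Top ?i" for y by (cases y) auto
  have skip_other: "skip ?i y \<notin> ?T \<and> skip ?i z \<notin> ?T" if "(skip ?i y, skip ?i z) \<in> ?S" for y z
  proof -
    have "\<not> (skip ?i y = s \<and> skip ?i z = t)"
    proof
      assume "skip ?i y = s \<and> skip ?i z = t"
      then have "Top ?i \<in> {skip ?i y, skip ?i z}" using T by simp
      then show False using not_i[of y] not_i[of z] by auto
    qed
    then show ?thesis using other[OF that] by blast
  qed
  have onto: "\<exists>y. e = skip ?i y" if e: "e \<notin> ?T" "e \<in> sources [] ?w \<union> targets [] ?w" for e
  proof -
    obtain j where j: "e = Top j" "j \<noteq> ?i" using e by (auto simp: sources_def targets_def)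
    show ?thesis
    proof (cases "j < ?i")
      case True then show ?thesis using j by (intro exI[of _ "Top j"]) simp
    next
      case False then show ?thesis using j by (intro exI[of _ "Top (j - 1)"]) auto
    qed
  qed
  have nth: "j < ?i \<Longrightarrow> ?w ! j = (u @ v) ! j"
    "\<not> j < ?i \<Longrightarrow> j < ?i + length v \<Longrightarrow> ?w ! Suc j = (u @ v) ! j" for j
    by (auto simp: nth_append nth_Cons' Suc_diff_le)
  have src: "sources [] (u @ v) = {y. skip ?i y \<in> sources [] ?w \<and> skip ?i y \<notin> ?T}"
  proof (rule Set.set_eqI)
    show "y \<in> sources [] (u @ v) \<longleftrightarrow> y \<in> {y. skip ?i y \<in> sources [] ?w \<and> skip ?i y \<notin> ?T}" for y
      by (cases y) (auto simp: sources_def nth split: if_splits)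
  qed
  have tgt: "targets [] (u @ v) = {y. skip ?i y \<in> targets [] ?w \<and> skip ?i y \<notin> ?T}"
  proof (rule Set.set_eqI)
    show "y \<in> targets [] (u @ v) \<longleftrightarrow> y \<in> {y. skip ?i y \<in> targets [] ?w \<and> skip ?i y \<notin> ?T}" for y
      by (cases y) (auto simp: targets_def nth split: if_splits)
  qed
  have S: "strands D' = {(y, z). (skip ?i y, skip ?i z) \<in> ?S}" "bubbles D' = bubbles D"
    by (simp_all add: D'_def)
  show in': "D' \<in> diagrams [] (u @ v)"
    unfolding diagrams_iff S
  proof (intro conjI)
    show "single_valued {(y, z). (skip ?i y, skip ?i z) \<in> ?S}"
      using diagramsD(1)[OF D] injD[OF inj_skip] unfolding single_valued_def by blast
    show "single_valued ({(y, z). (skip ?i y, skip ?i z) \<in> ?S}\<inverse>)"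
      using diagramsD(2)[OF D] injD[OF inj_skip] unfolding single_valued_def by blast
    show "Domain {(y, z). (skip ?i y, skip ?i z) \<in> ?S} = sources [] (u @ v)"
    proof (intro equalityI subsetI)
      fix y assume "y \<in> Domain {(y, z). (skip ?i y, skip ?i z) \<in> ?S}"
      then obtain z where "(skip ?i y, skip ?i z) \<in> ?S" by blast
      from skip_other[OF this] strand_in[OF D this] show "y \<in> sources [] (u @ v)" unfolding src by blast
    next
      fix y assume "y \<in> sources [] (u @ v)"
      then have y: "skip ?i y \<in> sources [] ?w" "skip ?i y \<notin> ?T" unfolding src by blast+
      then obtain b where b: "(skip ?i y, b) \<in> ?S" using diagramsD(3)[OF D] by blast
      then have "b \<notin> ?T" using other[OF b] y T by blast
      then obtain z where "b = skip ?i z" using onto strand_in[OF D b] by blast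
      then show "y \<in> Domain {(y, z). (skip ?i y, skip ?i z) \<in> ?S}" using b by blast
    qed
    show "Range {(y, z). (skip ?i y, skip ?i z) \<in> ?S} = targets [] (u @ v)"
    proof (intro equalityI subsetI)
      fix z assume "z \<in> Range {(y, z). (skip ?i y, skip ?i z) \<in> ?S}"
      then obtain y where "(skip ?i y, skip ?i z) \<in> ?S" by blast
      from skip_other[OF this] strand_in[OF D this] show "z \<in> targets [] (u @ v)" unfolding tgt by blast
    next
      fix z assume "z \<in> targets [] (u @ v)"
      then have z: "skip ?i z \<in> targets [] ?w" "skip ?i z \<notin> ?T" unfolding tgt by blast+
      then obtain b where b: "(b, skip ?i z) \<in> ?S" using diagramsD(4)[OF D] by blast
      then have "b \<notin> ?T" using other[OF b] z T by blast
      then obtain y where "b = skip ?i y" using onto strand_in[OF D b] by blast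
      then show "z \<in> Range {(y, z). (skip ?i y, skip ?i z) \<in> ?S}" using b by blast
    qed
  qed
  fix q1 q2 :: "bool list" and a b
  assume l: "length q1 = length u" "length q2 = length v"
  let ?q = "q1 @ a # q2 @ [b]"
  have lab: "label [] ?q (skip ?i y) = label [] (q1 @ q2) y" if "y \<in> sources [] (u @ v) \<union> targets [] (u @ v)" for y
    using that l by (cases y) (auto simp: sources_def targets_def nth_append nth_Cons')
  have "label [] ?q (Top ?i) = a" "label [] ?q (Top ?n) = b"
    using l by (simp_all add: nth_append)
  then have "label [] ?q s = label [] ?q t \<longleftrightarrow> a = b"
    using T by (auto simp: doubleton_eq_iff)
  moreover have "(\<forall>(y, z)\<in>?S. y \<noteq> s \<longrightarrow> label [] ?q y = label [] ?q z) \<longleftrightarrow>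
      (\<forall>(y, z)\<in>strands D'. label [] (q1 @ q2) y = label [] (q1 @ q2) z)" (is "?L \<longleftrightarrow> ?R")
  proof
    assume L: ?L
    show ?R
    proof (rule ballI, clarify)
      fix y z assume yz: "(y, z) \<in> strands D'"
      then have m: "(skip ?i y, skip ?i z) \<in> ?S" by (simp add: S)
      then have "skip ?i y \<noteq> s" using skip_other[OF m] T by blast
      then show "label [] (q1 @ q2) y = label [] (q1 @ q2) z"
        using L m lab strand_in[OF in' yz] by fastforce
    qed
  next
    assume R: ?R
    show ?L
    proof (rule ballI, clarify)
      fix y z assume yz: "(y, z) \<in> ?S" "y \<noteq> s"
      then have "y \<notin> ?T" "z \<notin> ?T" using other by blast+
      then obtain y' z' where e: "y = skip ?i y'" "z = skip ?i z'" using onto strand_in[OF D yz(1)] by blast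
      then have m: "(y', z') \<in> strands D'" using yz by (simp add: S)
      then show "label [] ?q y = label [] ?q z"
        using R lab strand_in[OF in' m] e by fastforce
    qed
  qed
  moreover have "(\<forall>(y, z)\<in>?S. label [] ?q y = label [] ?q z) \<longleftrightarrow>
      label [] ?q s = label [] ?q t \<and> (\<forall>(y, z)\<in>?S. y \<noteq> s \<longrightarrow> label [] ?q y = label [] ?q z)" (is "?A \<longleftrightarrow> ?B \<and> ?C")
  proof (rule iffI)
    assume A: ?A
    have ?B using A st by blast
    moreover have ?C using A by blast
    ultimately show "?B \<and> ?C" ..
  next
    assume BC: "?B \<and> ?C"
    show ?A
    proof (rule ballI, clarify)
      fix y z assume yz: "(y, z) \<in> ?S"
      then have "y = s \<Longrightarrow> z = t" using st single_valuedD[OF diagramsD(1)[OF D]] by simp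
      then show "label [] ?q y = label [] ?q z" using BC yz by (cases "y = s") auto
    qed
  qed
  ultimately have "(\<forall>(y, z)\<in>?S. label [] ?q y = label [] ?q z) \<longleftrightarrow>
      a = b \<and> (\<forall>(y, z)\<in>strands D'. label [] (q1 @ q2) y = label [] (q1 @ q2) z)"
    by (simp only:)
  then show "weight D [] ?q = of_bool (a = b) * weight D' [] (q1 @ q2)"
    by (cases "a = b") (simp_all only: weight_def S(2), simp_all)
qed

text \<open>Remove the strand at the last position, draw the rest by induction and attach the strand
  again. The outcome has the weights of \<open>D\<close> and therefore equals \<open>D\<close>. For
  the empty word only the bubbles are left.\<close>

lemma nf_full:
  "D \<in> diagrams [] w \<Longrightarrow> \<exists>(N :: 'k::idom mor) k. nf w N \<and> diag (N \<cdot> bubs k) = D"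
proof (induction "length w" arbitrary: w D rule: less_induct)
  case less
  show ?case
  proof (cases w rule: rev_cases)
    case Nil
    have "Domain (strands D) = {}" using diagramsD(3)[OF less(2)] Nil by (simp add: sources_explicit)
    then have "strands D = {}" by auto
    then have "weight D [] [] = 2 ^ bubbles D" by (simp add: weight_def)
    moreover have m: "monomial (idm [] \<cdot> bubs (bubbles D) :: 'k mor) [] []"
      by (rule monomial_cmp[OF monomial_idm monomial_bubs])
    ultimately have "diag (idm [] \<cdot> bubs (bubbles D) :: 'k mor) = D"
      using wt_cmp_bubs[OF monomial_idm[of "[]"], of "bubbles D" "[]", where 'k = 'k] less(2) Nil
      by (intro weight_eqD[OF diag_in[OF m]]) (auto simp: wt_def[symmetric] wt_idm)
    then show ?thesis using nf_Nil Nil by blast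
  next
    case (snoc w' x)
    obtain u v s t where uv: "w' = u @ bar x # v" "(s, t) \<in> strands D" "{s, t} = {Top (length u), Top (length w')}"
      using last_partner less(2) snoc by metis
    then have w: "w = u @ bar x # v @ [x]" using snoc by simp
    have len: "length w' = Suc (length u + length v)" using uv(1) by simp
    note D = less(2)[unfolded w]
    note rl = remove_last[OF D uv(2) uv(3)[unfolded len]]
    obtain N :: "'k mor" and k where N: "nf (u @ v) N"
      and dN: "diag (N \<cdot> bubs k) = Diagram {(y, z). (skip (length u) y, skip (length u) z) \<in> strands D} (bubbles D)"
      using less(1)[OF _ rl(1)] w by auto
    have m: "monomial (attach u v x N \<cdot> bubs k) [] (u @ bar x # v @ [x])"
      by (rule monomial_cmp[OF monomial_attach[OF monomial_nf[OF N]] monomial_bubs])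
    have "diag (attach u v x N \<cdot> bubs k) = D"
    proof (rule weight_eqD[OF diag_in[OF m] D])
      fix p q :: "bool list"
      assume l: "length p = length ([] :: letter list)" "length q = length (u @ bar x # v @ [x])"
      define q1 q2 where "q1 = take (length u) q" and "q2 = take (length v) (drop (Suc (length u)) q)"
      obtain a b where q: "q = q1 @ a # q2 @ [b]" "length q1 = length u" "length q2 = length v"
      proof
        have "drop (Suc (length u + length v)) q = [q ! Suc (length u + length v)]"
          using Cons_nth_drop_Suc[of "Suc (length u + length v)" q] l by simp
        then show "q = q1 @ q ! length u # q2 @ [q ! Suc (length u + length v)]"
          using id_take_nth_drop[of "length u" q] l append_take_drop_id[of "length v" "drop (Suc (length u)) q"]
          unfolding q1_def q2_def drop_drop by (simp add: add.commute)
      qed (use l in \<open>simp_all add: q1_def q2_def\<close>)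
      have "weight (diag (attach u v x N \<cdot> bubs k)) [] q = of_bool (a = b) * (2 ^ k * wt N [] (q1 @ q2))"
        using wt_cmp_bubs[OF monomial_attach[OF monomial_nf[OF N]], of x k q] wt_attach[OF monomial_nf[OF N] q(2,3), of x a b]
        unfolding wt_def[symmetric] by (simp add: q(1))
      also have "2 ^ k * wt N [] (q1 @ q2) = weight (diag (N \<cdot> bubs k)) [] (q1 @ q2)"
        using wt_cmp_bubs[OF monomial_nf[OF N], of k "q1 @ q2"] by (simp add: wt_def)
      also have "of_bool (a = b) * \<dots> = weight D [] q"
        unfolding dN using rl(2)[OF q(2,3), of a b] q(1) by simp
      finally show "weight (diag (attach u v x N \<cdot> bubs k)) p q = weight D p q"
        using l by simp
    qed
    then show ?thesis using nf_attach[OF N, of x] w by auto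
  qed
qed

section \<open>Composites of generators correspond to diagrams\<close>

lemma monomial_faithful_unit:
  fixes f :: "'k::idom mor"
  assumes f: "monomial f [] w" and g: "monomial g [] w" and eq: "diag f = diag g"
  shows "f = g"
proof -
  obtain N k where N: "nf w N" "f = N \<cdot> bubs k" using monomial_normal_form[OF f] by blast
  obtain M l where M: "nf w M" "g = M \<cdot> bubs l" using monomial_normal_form[OF g] by blast
  have "2 ^ k * wt N [] q = 2 ^ l * wt M [] q" for q
    using wt_cmp_bubs[OF monomial_nf[OF N(1)], of k q] wt_cmp_bubs[OF monomial_nf[OF M(1)], of l q] eq N(2) M(2)
    by (simp add: wt_def)
  then show ?thesis using nf_unique[OF N(1) M(1), of k l] N(2) M(2) by simp
qed

text \<open>The diagram of \<open>bend a f\<close> depends only on that of \<open>f\<close>. So the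
  bent morphisms agree by the case of the empty source, and unbending recovers \<open>f\<close> and
  \<open>g\<close>.\<close>

lemma monomial_faithful:
  fixes f :: "'k::idom mor"
  assumes f: "monomial f a b" and g: "monomial g a b" and eq: "diag f = diag g"
  shows "f = g"
proof -
  have "diag (bend a h) = comp_diagram (tens_diagram a b (diag h) (id_diagram (dual a))) (diag (coev a :: 'k mor))"
    if h: "monomial h a b" for h :: "'k mor"
  proof -
    have "monomial (wh [] h (dual a)) (a @ dual a) (b @ dual a)" by (rule monomial_wh[OF h]) simp_all
    moreover have "diag (wh [] h (dual a)) = tens_diagram a b (diag h) (id_diagram (dual a))"
      using diag_tns[OF h monomial_idm[of "dual a"]] by (simp add: tns_idm diag_idm)
    ultimately show ?thesis
      unfolding bend_def using diag_cmp[OF _ monomial_coev] by metis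
  qed
  then have "diag (bend a f) = diag (bend a g)" using f g eq by simp
  then have "bend a f = bend a g" by (rule monomial_faithful_unit[OF monomial_bend[OF f] monomial_bend[OF g]])
  then show ?thesis using unbend_bend[OF arr_mono[OF f]] unbend_bend[OF arr_mono[OF g]] by metis
qed

text \<open>Bend \<open>D\<close> as a diagram, draw the result by a normal form with bubbles, and
  unbend. That this draws \<open>D\<close> is the computation of \<open>unbend_bend\<close> for
  diagrams, its zigzag being \<open>snake\<close> under \<open>diag\<close>.\<close>

lemma monomial_full:
  assumes D: "D \<in> diagrams a b"
  shows "\<exists>f :: 'k::idom mor. monomial f a b \<and> diag f = D"
proof -
  let ?a = "dual a"
  let ?X = "diag (coev a :: 'k mor)" and ?Y = "diag (eval a :: 'k mor)" and ?i = id_diagram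
  note X = diag_in[OF monomial_coev[of a, where 'a = 'k]] and Y = diag_in[OF monomial_eval[of a, where 'a = 'k]]
  note i = id_diagram_in
  let ?P = "tens_diagram a b D (?i ?a)"
  have P: "?P \<in> diagrams (a @ ?a) (b @ ?a)" by (rule tens_diagram_in[OF D i])
  have bent: "comp_diagram ?P ?X \<in> diagrams [] (b @ ?a)" by (rule comp_diagram_in[OF X P])
  obtain N :: "'k mor" and k where N: "nf (b @ ?a) N" "diag (N \<cdot> bubs k) = comp_diagram ?P ?X"
    using nf_full[OF bent] by blast
  let ?g = "N \<cdot> bubs k"
  have g: "monomial ?g [] (b @ ?a)" by (rule monomial_cmp[OF monomial_nf[OF N(1)] monomial_bubs])
  have m: "monomial (wh [] ?g a) a (b @ ?a @ a)" "monomial (wh b (eval a) [] :: 'k mor) (b @ ?a @ a) b"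
    "monomial (wh a (eval a) [] :: 'k mor) (a @ ?a @ a) a" "monomial (wh [] (coev a) a :: 'k mor) a (a @ ?a @ a)"
    by (rule monomial_wh[OF g] monomial_wh[OF monomial_eval] monomial_wh[OF monomial_coev]; simp)+
  have dw: "diag (wh u h v) = tens_diagram u u (?i u) (tens_diagram c d (diag h) (?i v))" if "monomial h c d"
    for u v c d and h :: "'k mor"
    unfolding wh_def by (simp add: diag_tns[OF monomial_idm monomial_tns[OF that monomial_idm]] diag_tns[OF that monomial_idm] diag_idm)
  have snake': "comp_diagram (tens_diagram a a (?i a) ?Y) (tens_diagram [] (a @ ?a) ?X (?i a)) = ?i a"
    using arg_cong[OF snake[of a, where 'k = 'k], of diag] diag_cmp[OF m(3,4)]
      dw[OF monomial_eval[of a], of a "[]"] dw[OF monomial_coev[of a], of "[]" a]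
    by (simp add: tens_unit_left tens_unit_right diag_idm)
  have "diag (unbend a b ?g) = comp_diagram (tens_diagram b b (?i b) ?Y) (tens_diagram [] (b @ ?a) (comp_diagram ?P ?X) (?i a))"
    unfolding unbend_def diag_cmp[OF m(2,1)] dw[OF monomial_eval[of a]] dw[OF g] N(2)
    by (simp add: tens_unit_left tens_unit_right)
  also have "tens_diagram [] (b @ ?a) (comp_diagram ?P ?X) (?i a) =
      comp_diagram (tens_diagram (a @ ?a) (b @ ?a) ?P (?i a)) (tens_diagram [] (a @ ?a) ?X (?i a))"
    using tens_comp[OF X P i i, of a] comp_id_left[OF i, of a] by simp
  also have "tens_diagram (a @ ?a) (b @ ?a) ?P (?i a) = tens_diagram a b D (?i (?a @ a))"
    by (simp add: tens_diagram_assoc tens_id)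
  also have "comp_diagram (tens_diagram b b (?i b) ?Y) (comp_diagram (tens_diagram a b D (?i (?a @ a))) (tens_diagram [] (a @ ?a) ?X (?i a))) =
      comp_diagram (comp_diagram (tens_diagram b b (?i b) ?Y) (tens_diagram a b D (?i (?a @ a)))) (tens_diagram [] (a @ ?a) ?X (?i a))"
    by (rule comp_diagram_assoc[symmetric, OF _ tens_in[OF D i] tens_in[OF i Y]])
      (use tens_diagram_in[OF X i, of a] in simp_all)
  \<comment> \<open>Both sides are the juxtaposition of \<open>D\<close> and \<open>?Y\<close>,
    computed in the two possible orders.\<close>
  also have "comp_diagram (tens_diagram b b (?i b) ?Y) (tens_diagram a b D (?i (?a @ a))) =
      comp_diagram D (tens_diagram a a (?i a) ?Y)"
    using tens_comp[OF D i i Y] tens_comp[OF i D Y i[of "[]"]] comp_id_left[OF D] comp_id_right[OF D]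
      comp_id_left[OF Y] comp_id_right[OF Y]
    by (simp add: tens_unit_right)
  also have "comp_diagram (comp_diagram D (tens_diagram a a (?i a) ?Y)) (tens_diagram [] (a @ ?a) ?X (?i a)) =
      comp_diagram D (comp_diagram (tens_diagram a a (?i a) ?Y) (tens_diagram [] (a @ ?a) ?X (?i a)))"
    by (rule comp_diagram_assoc[OF _ tens_in[OF i Y] D]) (use tens_diagram_in[OF X i, of a] in simp_all)
  also have "\<dots> = D" unfolding snake' by (rule comp_id_right[OF D])
  finally show ?thesis using monomial_unbend[OF g] by blast
qed

section \<open>Linear combinations\<close>

lemma same_mor_eqvI: "OB_eqv a b e f \<Longrightarrow> same_mor e f"
  using eqv_has_type same_mor_typedI by blast

lemma plus_assoc: "arr f a b \<Longrightarrow> arr g a b \<Longrightarrow> arr h a b \<Longrightarrow> plus (plus f g) h = plus f (plus g h)"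
  by transfer (rule same_mor_eqvI, rule eqv.Plus_assoc)
lemma plus_comm: "arr f a b \<Longrightarrow> arr g a b \<Longrightarrow> plus f g = plus g f"
  by transfer (rule same_mor_eqvI, rule eqv.Plus_comm)
lemma plus_zero: "arr f a b \<Longrightarrow> plus f (zero a b) = f"
  by transfer (rule same_mor_eqvI, rule eqv.Plus_Zero)
lemma plus_minus: "arr f a b \<Longrightarrow> plus f (scale (- 1) f) = zero a b"
  by transfer (rule same_mor_eqvI, rule eqv.Plus_minus)
lemma scale_plus: "arr f a b \<Longrightarrow> arr g a b \<Longrightarrow> scale r (plus f g) = plus (scale r f) (scale r g)"
  by transfer (rule same_mor_eqvI, rule eqv.Scale_Plus)
lemma scale_add: "arr f a b \<Longrightarrow> scale (r + s) f = plus (scale r f) (scale s f)"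
  by transfer (rule same_mor_eqvI, rule eqv.Scale_add)
lemma scale_scale: "arr f a b \<Longrightarrow> scale r (scale s f) = scale (r * s) f"
  by transfer (rule same_mor_eqvI, rule eqv.Scale_Scale)
lemma scale_one: "arr f a b \<Longrightarrow> scale 1 f = f"
  by transfer (rule same_mor_eqvI, rule eqv.Scale_one)
lemma cmp_plus_left: "arr g b c \<Longrightarrow> arr h b c \<Longrightarrow> arr f a b \<Longrightarrow> plus g h \<cdot> f = plus (g \<cdot> f) (h \<cdot> f)"
  by transfer (rule same_mor_eqvI, rule eqv.Comp_Plus_left)
lemma cmp_plus_right: "arr h b c \<Longrightarrow> arr f a b \<Longrightarrow> arr g a b \<Longrightarrow> h \<cdot> plus f g = plus (h \<cdot> f) (h \<cdot> g)"
  by transfer (rule same_mor_eqvI, rule eqv.Comp_Plus_right)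
lemma cmp_scale_left: "arr g b c \<Longrightarrow> arr f a b \<Longrightarrow> scale r g \<cdot> f = scale r (g \<cdot> f)"
  by transfer (rule same_mor_eqvI, rule eqv.Comp_Scale_left)
lemma cmp_scale_right: "arr g b c \<Longrightarrow> arr f a b \<Longrightarrow> g \<cdot> scale r f = scale r (g \<cdot> f)"
  by transfer (rule same_mor_eqvI, rule eqv.Comp_Scale_right)
lemma tns_plus_left: "arr f a b \<Longrightarrow> arr g a b \<Longrightarrow> arr h c d \<Longrightarrow> plus f g \<parallel> h = plus (f \<parallel> h) (g \<parallel> h)"
  by transfer (rule same_mor_eqvI, rule eqv.Tens_Plus_left)
lemma tns_plus_right: "arr h a b \<Longrightarrow> arr f c d \<Longrightarrow> arr g c d \<Longrightarrow> h \<parallel> plus f g = plus (h \<parallel> f) (h \<parallel> g)"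
  by transfer (rule same_mor_eqvI, rule eqv.Tens_Plus_right)
lemma tns_scale_left: "arr f a b \<Longrightarrow> arr g c d \<Longrightarrow> scale r f \<parallel> g = scale r (f \<parallel> g)"
  by transfer (rule same_mor_eqvI, rule eqv.Tens_Scale_left)
lemma tns_scale_right: "arr f a b \<Longrightarrow> arr g c d \<Longrightarrow> f \<parallel> scale r g = scale r (f \<parallel> g)"
  by transfer (rule same_mor_eqvI, rule eqv.Tens_Scale_right)

lemma zero_plus: "arr f a b \<Longrightarrow> plus (zero a b) f = f"
  using plus_comm[OF arr_zero] plus_zero by metis

text \<open>Write 0 as the sum of 1 and -1. The absorption laws for zero morphisms below all follow
  from this one.\<close>

lemma scale_zero: "arr f a b \<Longrightarrow> scale 0 f = zero a b"
  using scale_add[of f a b 1 "- 1"] by (simp add: scale_one plus_minus)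

lemma zero_cmp:
  assumes f: "arr f a b" shows "zero b c \<cdot> f = zero a c"
  using cmp_scale_left[OF arr_zero[of b c] f, of 0]
  by (simp add: scale_zero[OF arr_zero] scale_zero[OF arr_cmp[OF arr_zero f]])

lemma cmp_zero:
  assumes g: "arr g b c" shows "g \<cdot> zero a b = zero a c"
  using cmp_scale_right[OF g arr_zero[of a b], of 0]
  by (simp add: scale_zero[OF arr_zero] scale_zero[OF arr_cmp[OF g arr_zero]])

lemma zero_tns:
  assumes f: "arr f c d" shows "zero a b \<parallel> f = zero (a @ c) (b @ d)"
  using tns_scale_left[OF arr_zero[of a b] f, of 0]
  by (simp add: scale_zero[OF arr_zero] scale_zero[OF arr_tns[OF arr_zero f]])

lemma tns_zero:
  assumes f: "arr f a b" shows "f \<parallel> zero c d = zero (a @ c) (b @ d)"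
  using tns_scale_right[OF f arr_zero[of c d], of 0]
  by (simp add: scale_zero[OF arr_zero] scale_zero[OF arr_tns[OF f arr_zero]])

inductive lspan :: "letter list \<Rightarrow> letter list \<Rightarrow> 'k::idom mor \<Rightarrow> bool" for a b where
  lspan_zero: "lspan a b (zero a b)"
| lspan_cons: "monomial m a b \<Longrightarrow> lspan a b f \<Longrightarrow> lspan a b (plus (scale r m) f)"

lemma arr_lspan: "lspan a b f \<Longrightarrow> arr f a b"
  by (induction rule: lspan.induct) (auto intro: arr_plus arr_scale arr_mono)

lemma lspan_mono: "monomial m a b \<Longrightarrow> lspan a b m"
  using lspan_cons[OF _ lspan_zero, of m a b 1] by (simp add: scale_one[OF arr_mono] plus_zero[OF arr_mono])

lemma lspan_plus: "lspan a b f \<Longrightarrow> lspan a b g \<Longrightarrow> lspan a b (plus f g)"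
proof (induction rule: lspan.induct)
  case lspan_zero
  then show ?case by (simp add: zero_plus[OF arr_lspan])
next
  case (lspan_cons m f r)
  then show ?case
    using plus_assoc[OF arr_scale[OF arr_mono[OF lspan_cons(1)]] arr_lspan arr_lspan] lspan.lspan_cons by metis
qed

lemma lspan_scale: "lspan a b f \<Longrightarrow> lspan a b (scale r f)"
proof (induction rule: lspan.induct)
  case lspan_zero
  then show ?case
    using scale_scale[OF arr_zero[of a b], of r 0] lspan.lspan_zero by (simp add: scale_zero[OF arr_zero])
next
  case (lspan_cons m f s)
  note m = arr_mono[OF lspan_cons(1)]
  show ?case
    using lspan.lspan_cons[OF lspan_cons(1,3), of "r * s"] scale_plus[OF arr_scale[OF m] arr_lspan[OF lspan_cons(2)], of r s] scale_scale[OF m, of r s]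
    by simp
qed

lemma lspan_cmp: "lspan b c g \<Longrightarrow> lspan a b f \<Longrightarrow> lspan a c (g \<cdot> f)"
proof (induction rule: lspan.induct)
  case lspan_zero
  then show ?case by (simp add: zero_cmp[OF arr_lspan] lspan.lspan_zero)
next
  case (lspan_cons m g r)
  note m = arr_mono[OF lspan_cons(1)]
  have "lspan a c (m \<cdot> f)"
    using lspan_cons(4)
  proof (induction rule: lspan.induct)
    case lspan_zero
    then show ?case by (simp add: cmp_zero[OF m] lspan.lspan_zero)
  next
    case (lspan_cons n f s)
    then show ?case
      using lspan.lspan_cons[OF monomial_cmp[OF \<open>monomial m b c\<close> lspan_cons(1)] lspan_cons(3), of s]
      by (simp add: cmp_plus_right[OF m arr_scale[OF arr_mono] arr_lspan] cmp_scale_right[OF m arr_mono])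
  qed
  then show ?case
    using lspan_plus[OF lspan_scale lspan_cons(3)[OF lspan_cons(4)]]
    by (simp add: cmp_plus_left[OF arr_scale[OF m] arr_lspan[OF lspan_cons(2)] arr_lspan[OF lspan_cons(4)]]
        cmp_scale_left[OF m arr_lspan[OF lspan_cons(4)]])
qed

lemma lspan_tns: "lspan a b g \<Longrightarrow> lspan c d f \<Longrightarrow> lspan (a @ c) (b @ d) (g \<parallel> f)"
proof (induction rule: lspan.induct)
  case lspan_zero
  then show ?case by (simp add: zero_tns[OF arr_lspan] lspan.lspan_zero)
next
  case (lspan_cons m g r)
  note m = arr_mono[OF lspan_cons(1)]
  have "lspan (a @ c) (b @ d) (m \<parallel> f)"
    using lspan_cons(4)
  proof (induction rule: lspan.induct)
    case lspan_zero
    then show ?case by (simp add: tns_zero[OF m] lspan.lspan_zero)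
  next
    case (lspan_cons n f s)
    then show ?case
      using lspan.lspan_cons[OF monomial_tns[OF \<open>monomial m a b\<close> lspan_cons(1)] lspan_cons(3), of s]
      by (simp add: tns_plus_right[OF m arr_scale[OF arr_mono] arr_lspan] tns_scale_right[OF m arr_mono])
  qed
  then show ?case
    using lspan_plus[OF lspan_scale lspan_cons(3)[OF lspan_cons(4)]]
    by (simp add: tns_plus_left[OF arr_scale[OF m] arr_lspan[OF lspan_cons(2)] arr_lspan[OF lspan_cons(4)]]
        tns_scale_left[OF m arr_lspan[OF lspan_cons(4)]])
qed

lemma abs_mor_linear:
  "abs_mor (Zero a b) = zero a b" "abs_mor (Plus e f) = plus (abs_mor e) (abs_mor f)"
  "abs_mor (Scale r e) = scale r (abs_mor e)"
  by (simp_all add: zero.abs_eq plus.abs_eq scale.abs_eq)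

lemma lspan_abs: "typed e a b \<Longrightarrow> lspan a b (abs_mor e)"
  by (induction rule: has_type.induct)
    (auto simp: abs_mor_simps abs_mor_linear
      intro: lspan_mono monomial_gen monomial_idm lspan_cmp lspan_tns lspan_plus lspan_scale lspan_zero)

lemma evm_linear:
  "evm (zero a b) = 0"
  "arr f a b \<Longrightarrow> arr g a b \<Longrightarrow> evm (plus f g) = evm f + evm g"
  "arr f a b \<Longrightarrow> evm (scale r f) = Poly_Mapping.map ((*) r) (evm f)"
proof -
  show "evm (zero a b) = 0"
    using evm_abs[OF has_type.intros(5)] by (simp add: zero.abs_eq)
  show "evm (plus f g) = evm f + evm g" if fg: "arr f a b" "arr g a b"
  proof -
    obtain e e' where e: "f = abs_mor e" "typed e a b" "g = abs_mor e'" "typed e' a b"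
      using fg by (metis mor_cases)
    then show ?thesis
      using evm_abs[OF has_type.intros(6)[OF e(2,4)]] by (simp add: evm_abs plus.abs_eq)
  qed
  show "evm (scale r f) = Poly_Mapping.map ((*) r) (evm f)" if f: "arr f a b"
  proof -
    obtain e where e: "f = abs_mor e" "typed e a b"
      using f by (metis mor_cases)
    then show ?thesis
      using evm_abs[OF has_type.intros(7)[OF e(2)], of r] by (simp add: evm_abs scale.abs_eq)
  qed
qed


section \<open>Comparing coefficients\<close>

fun lin :: "letter list \<Rightarrow> letter list \<Rightarrow> ('k::idom \<times> 'k mor) list \<Rightarrow> 'k mor" where
  "lin a b [] = zero a b"
| "lin a b ((r, m) # xs) = plus (scale r m) (lin a b xs)"

definition monomial_list :: "letter list \<Rightarrow> letter list \<Rightarrow> ('k::idom \<times> 'k mor) list \<Rightarrow> bool" where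
  "monomial_list a b xs \<longleftrightarrow> (\<forall>x\<in>set xs. monomial (snd x) a b)"

lemma lspan_lin: "lspan a b f \<Longrightarrow> \<exists>xs. monomial_list a b xs \<and> f = lin a b xs"
proof (induction rule: lspan.induct)
  case lspan_zero
  show ?case by (intro exI[of _ "[]"]) (simp add: monomial_list_def)
next
  case (lspan_cons m f r)
  then obtain xs where "monomial_list a b xs" "f = lin a b xs" by blast
  then show ?case using lspan_cons(1) by (intro exI[of _ "(r, m) # xs"]) (simp add: monomial_list_def)
qed

lemma arr_lin: "monomial_list a b xs \<Longrightarrow> arr (lin a b xs) a b"
  by (induction xs) (auto simp: monomial_list_def intro!: arr_plus[OF arr_scale[OF arr_mono]])

text \<open>Gathers all terms in \<open>m\<close>, so that their total coefficient can be read
  off.\<close>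

lemma lin_collect:
  fixes m :: "'k::idom mor"
  assumes m: "monomial m a b"
  shows "monomial_list a b xs \<Longrightarrow> \<exists>s. lin a b xs = plus (scale s m) (lin a b (filter (\<lambda>x. snd x \<noteq> m) xs))"
proof (induction xs)
  case Nil
  show ?case
    by (intro exI[of _ 0]) (simp add: scale_zero[OF arr_mono[OF m]] plus_zero[OF arr_zero])
next
  case (Cons x xs)
  obtain r n where x: "x = (r, n)" by (cases x)
  let ?L = "lin a b (filter (\<lambda>x. snd x \<noteq> m) xs)"
  have n: "monomial n a b" and xs: "monomial_list a b xs" using Cons.prems by (simp_all add: monomial_list_def x)
  have L: "arr ?L a b" using xs by (intro arr_lin) (simp add: monomial_list_def)
  note am = arr_scale[OF arr_mono[OF m]] and an = arr_scale[OF arr_mono[OF n]]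
  obtain s where s: "lin a b xs = plus (scale s m) ?L" using Cons.IH[OF xs] by blast
  show ?case
  proof (cases "n = m")
    case True
    then show ?thesis
      by (intro exI[of _ "r + s"])
        (simp add: x s plus_assoc[OF am am L, symmetric] scale_add[OF arr_mono[OF m], symmetric])
  next
    case False
    then show ?thesis
      by (intro exI[of _ s])
        (simp add: x s plus_assoc[OF an am L, symmetric] plus_comm[OF an am] plus_assoc[OF am an L])
  qed
qed

lemma evm_lin_Cons:
  "monomial m a b \<Longrightarrow> arr f a b \<Longrightarrow>
    evm (plus (scale r m) f) = Poly_Mapping.map ((*) r) (Poly_Mapping.single (diag m) 1) + evm f"
  by (simp add: evm_linear(2)[OF arr_scale[OF arr_mono]] evm_linear(3)[OF arr_mono] evm_mono)

lemma lookup_lin_other: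
  "monomial_list a b xs \<Longrightarrow> \<forall>x\<in>set xs. diag (snd x) \<noteq> D \<Longrightarrow> Poly_Mapping.lookup (evm (lin a b xs)) D = 0"
proof (induction xs)
  case Nil
  then show ?case by (simp add: evm_linear)
next
  case (Cons x xs)
  obtain r n where x: "x = (r, n)" by (cases x)
  have n: "monomial n a b" and xs: "monomial_list a b xs" using Cons.prems by (simp_all add: monomial_list_def x)
  then show ?case
    using Cons.IH Cons.prems(2) by (simp add: x evm_lin_Cons[OF n arr_lin[OF xs]] lookup_add lookup_single)
qed

text \<open>Distinct monomials have distinct diagrams by \<open>monomial_faithful\<close>. So the
  coefficient of the image at \<open>diag m\<close> is the collected coefficient of
  \<open>m\<close>; it vanishes, and the terms in \<open>m\<close> drop out, leaving a shorter
  list.\<close>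

lemma lin_eq_zero:
  fixes xs :: "('k::idom \<times> 'k mor) list"
  shows "monomial_list a b xs \<Longrightarrow> evm (lin a b xs) = 0 \<Longrightarrow> lin a b xs = zero a b"
proof (induction "length xs" arbitrary: xs rule: less_induct)
  case less
  show ?case
  proof (cases xs)
    case (Cons x ys)
    obtain r m where x: "x = (r, m)" by (cases x)
    have m: "monomial m a b" and ys: "monomial_list a b ys" using less.prems(1) by (simp_all add: monomial_list_def x Cons)
    let ?zs = "filter (\<lambda>x. snd x \<noteq> m) ys"
    have zs: "monomial_list a b ?zs" using ys by (simp add: monomial_list_def)
    note L = arr_lin[OF zs] and am = arr_scale[OF arr_mono[OF m]]
    obtain s where "lin a b ys = plus (scale s m) (lin a b ?zs)" using lin_collect[OF m ys] by blast
    then have eq: "lin a b xs = plus (scale (r + s) m) (lin a b ?zs)"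
      by (simp add: Cons x plus_assoc[OF am am L, symmetric] scale_add[OF arr_mono[OF m], symmetric])
    have "\<forall>x\<in>set ?zs. diag (snd x) \<noteq> diag m"
      using monomial_faithful[OF _ m] zs by (auto simp: monomial_list_def)
    then have "Poly_Mapping.lookup (evm (lin a b xs)) (diag m) = r + s"
      unfolding eq evm_lin_Cons[OF m L] by (simp add: lookup_add lookup_lin_other[OF zs])
    then have "r + s = 0" using less.prems(2) by simp
    then have xz: "lin a b xs = lin a b ?zs"
      unfolding eq by (simp add: scale_zero[OF arr_mono[OF m]] zero_plus[OF L])
    have "length ?zs < length xs" using Cons by (simp add: less_Suc_eq_le)
    then show ?thesis using less.hyps[OF _ zs] less.prems(2) xz by simp
  qed simp
qed

lemma lspan_arr: "arr f a b \<Longrightarrow> lspan a b f"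
  using lspan_abs mor_cases by metis

text \<open>The difference of \<open>f\<close> and \<open>g\<close> is a linear combination of
  monomials with image zero, hence zero by \<open>lin_eq_zero\<close>.\<close>

lemma evm_faithful:
  fixes f :: "'k::idom mor"
  assumes f: "arr f a b" and g: "arr g a b" and eq: "evm f = evm g"
  shows "f = g"
proof -
  have d: "arr (plus f (scale (- 1) g)) a b" by (rule arr_plus[OF f arr_scale[OF g]])
  obtain xs where xs: "monomial_list a b xs" "plus f (scale (- 1) g) = lin a b xs"
    using lspan_lin[OF lspan_arr[OF d]] by blast
  have "evm (plus f (scale (- 1) g)) = 0"
    unfolding evm_linear(2)[OF f arr_scale[OF g]] evm_linear(3)[OF g] eq
    by (rule poly_mapping_eqI) (simp add: lookup_add)
  then have z: "plus f (scale (- 1) g) = zero a b"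
    using lin_eq_zero[OF xs(1)] xs(2) by simp
  have "f = plus f (plus (scale (- 1) g) g)"
    using plus_comm[OF arr_scale[OF g] g] plus_minus[OF g] plus_zero[OF f] by simp
  also have "\<dots> = plus (zero a b) g"
    using plus_assoc[OF f arr_scale[OF g] g, symmetric] z by simp
  also have "\<dots> = g" by (rule zero_plus[OF g])
  finally show ?thesis .
qed

text \<open>By linearity it is enough to reach single diagrams, which \<open>monomial_full\<close>
  does.\<close>

lemma evm_full:
  assumes "Poly_Mapping.keys p \<subseteq> diagrams a b"
  shows "\<exists>f :: 'k::idom mor. arr f a b \<and> evm f = p"
  using assms
proof (induction rule: free_induct)
  case zero
  then show ?case using evm_linear(1) arr_zero by blast
next
  case (single D r)
  obtain f :: "'k mor" where f: "monomial f a b" "diag f = D" using monomial_full[OF single] by blast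
  have "evm (scale r f) = Poly_Mapping.single D r"
    using evm_linear(3)[OF arr_mono[OF f(1)], of r] evm_mono[OF f(1)] f(2) by simp
  then show ?case using arr_scale[OF arr_mono[OF f(1)]] by blast
next
  case (add p q)
  then show ?case using evm_linear(2) arr_plus by metis
qed

section \<open>The isomorphism\<close>

lemma mem_eqv_class: "e' \<in> eqv_class G R a b e \<longleftrightarrow> eqv G R a b e e'"
  by (simp add: eqv_class_def)

lemma eqv_class_eqI:
  assumes "eqv G R a b e e'"
  shows "eqv_class G R a b e = eqv_class G R a b e'"
  using assms unfolding eqv_class_def by (auto intro: eqv.trans eqv.sym)

text \<open>An arbitrary representative is evaluated; by \<open>ev_sound\<close> the value does not
  depend on the choice.\<close>

definition OB_functor :: "letter list \<Rightarrow> letter list \<Rightarrow>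
    (letter, generator, 'k::idom) expr set \<Rightarrow> diagram \<Rightarrow>\<^sub>0 'k" where
  "OB_functor a b X = ev (SOME e. e \<in> X)"

abbreviation cls :: "letter list \<Rightarrow> letter list \<Rightarrow>
    (letter, generator, 'k::idom) expr \<Rightarrow> (letter, generator, 'k) expr set" where
  "cls \<equiv> eqv_class generator_type OB_relations"

lemma OB_functor_cls: "typed e a b \<Longrightarrow> OB_functor a b (cls a b e) = ev e"
  unfolding OB_functor_def
proof (rule someI2)
  show "e \<in> cls a b e" if "typed e a b" by (simp add: mem_eqv_class eqv.refl[OF that])
  show "ev e' = ev e" if "e' \<in> cls a b e" for e'
    using that ev_sound unfolding mem_eqv_class by metis
qed

text \<open>The operations of the presented category are unions over representatives. Such a union
  collapses to one member once the choice of representative does not matter.\<close>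

lemma UN_cls:
  assumes "typed e a b" "\<And>e'. OB_eqv a b e e' \<Longrightarrow> h e' = h e"
  shows "(\<Union>e'\<in>cls a b e. h e') = h e"
  using assms eqv.refl[OF assms(1)] unfolding eqv_class_def by blast

lemma carrier_presented:
  "X \<in> carrier (Hom OB_presented a b) \<longleftrightarrow> (\<exists>e. typed e a b \<and> X = cls a b e)"
  by (auto simp: OB_presented_def presented_category_def)

lemma presented_simps:
  "Obj OB_presented = UNIV" "Unit OB_presented = []" "TenO OB_presented = (@)"
  "Idm OB_presented a = cls a a (Ident a)"
  by (simp_all add: OB_presented_def presented_category_def)

lemma presented_add:
  assumes "typed e a b" "typed f a b"
  shows "cls a b e \<oplus>\<^bsub>Hom OB_presented a b\<^esub> cls a b f = cls a b (Plus e f)"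
proof -
  have "(\<Union>f'\<in>cls a b f. cls a b (Plus e' f')) = cls a b (Plus e' f)" if "OB_eqv a b e e'" for e'
    by (rule UN_cls[OF assms(2)], rule eqv_class_eqI,
        rule eqv.Plus_cong[OF eqv.refl[OF eqv_has_type[OF that, THEN conjunct2]] eqv.sym])
  moreover have "(\<Union>e'\<in>cls a b e. cls a b (Plus e' f)) = cls a b (Plus e f)"
    by (rule UN_cls[OF assms(1)], rule eqv_class_eqI, rule eqv.Plus_cong[OF eqv.sym eqv.refl[OF assms(2)]])
  ultimately show ?thesis
    by (simp add: OB_presented_def presented_category_def mem_eqv_class)
qed

lemma presented_smult:
  assumes "typed e a b"
  shows "r \<odot>\<^bsub>Hom OB_presented a b\<^esub> cls a b e = cls a b (Scale r e)"
proof -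
  have "(\<Union>e'\<in>cls a b e. cls a b (Scale r e')) = cls a b (Scale r e)"
    by (rule UN_cls[OF assms], rule eqv_class_eqI, rule eqv.Scale_cong[OF eqv.sym])
  then show ?thesis by (simp add: OB_presented_def presented_category_def)
qed

lemma presented_Cmp:
  assumes "typed g b c" "typed f a b"
  shows "Cmp OB_presented a b c (cls b c g) (cls a b f) = cls a c (g \<bullet> f)"
proof -
  have "(\<Union>f'\<in>cls a b f. cls a c (g' \<bullet> f')) = cls a c (g' \<bullet> f)" if "OB_eqv b c g g'" for g'
    by (rule UN_cls[OF assms(2)], rule eqv_class_eqI,
        rule eqv.Comp_cong[OF eqv.refl[OF eqv_has_type[OF that, THEN conjunct2]] eqv.sym])
  moreover have "(\<Union>g'\<in>cls b c g. cls a c (g' \<bullet> f)) = cls a c (g \<bullet> f)"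
    by (rule UN_cls[OF assms(1)], rule eqv_class_eqI, rule eqv.Comp_cong[OF eqv.sym eqv.refl[OF assms(2)]])
  ultimately show ?thesis
    by (simp add: OB_presented_def presented_category_def mem_eqv_class)
qed

lemma presented_TenM:
  assumes "typed f a b" "typed g c d"
  shows "TenM OB_presented a b c d (cls a b f) (cls c d g) = cls (a @ c) (b @ d) (f \<star> g)"
proof -
  have "(\<Union>g'\<in>cls c d g. cls (a @ c) (b @ d) (f' \<star> g')) = cls (a @ c) (b @ d) (f' \<star> g)" if "OB_eqv a b f f'" for f'
    by (rule UN_cls[OF assms(2)], rule eqv_class_eqI,
        rule eqv.Tens_cong[OF eqv.refl[OF eqv_has_type[OF that, THEN conjunct2]] eqv.sym])
  moreover have "(\<Union>f'\<in>cls a b f. cls (a @ c) (b @ d) (f' \<star> g)) = cls (a @ c) (b @ d) (f \<star> g)"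
    by (rule UN_cls[OF assms(1)], rule eqv_class_eqI, rule eqv.Tens_cong[OF eqv.sym eqv.refl[OF assms(2)]])
  ultimately show ?thesis
    by (simp add: OB_presented_def presented_category_def mem_eqv_class)
qed

lemma carrier_OB: "p \<in> carrier (Hom OB a b) \<longleftrightarrow> Poly_Mapping.keys p \<subseteq> diagrams a b"
  by (simp add: OB_def free_module_def)

lemma OB_functor_isomorphism:
  "strict_linear_monoidal_isomorphism
     (OB_presented :: (letter list, (letter, generator, 'k::idom) expr set, 'k) lmcat) OB id OB_functor"
proof (intro strict_linear_monoidal_isomorphism.intro strict_linear_monoidal_functor.intro
    strict_linear_monoidal_isomorphism_axioms.intro)
  let ?P = "OB_presented :: (letter list, (letter, generator, 'k) expr set, 'k) lmcat"
  let ?O = "OB :: (letter list, diagram \<Rightarrow>\<^sub>0 'k, 'k) lmcat"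
  let ?F = "OB_functor :: _ \<Rightarrow> _ \<Rightarrow> (letter, generator, 'k) expr set \<Rightarrow> _"
  fix a b c a' b' :: "letter list" and f g :: "(letter, generator, 'k) expr set"
  have F_in: "?F a b (cls a b e) \<in> carrier (Hom ?O a b)" if "typed e a b" for a b e
    using keys_ev[OF that] by (simp add: OB_functor_cls[OF that] carrier_OB)
  show "linear_map (Hom ?P a b) (Hom ?O (id a) (id b)) (?F a b)"
    unfolding linear_map_def
  proof (intro conjI ballI allI)
    fix x y r assume x: "x \<in> carrier (Hom ?P a b)"
    then obtain e where e: "typed e a b" "x = cls a b e" unfolding carrier_presented by blast
    show "?F a b x \<in> carrier (Hom ?O (id a) (id b))" using F_in e by simp
    show "?F a b (r \<odot>\<^bsub>Hom ?P a b\<^esub> x) = r \<odot>\<^bsub>Hom ?O (id a) (id b)\<^esub> ?F a b x"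
      using has_type.intros(7)[OF e(1), of r]
      by (simp add: e presented_smult OB_functor_cls) (simp add: OB_def free_module_def)
    assume "y \<in> carrier (Hom ?P a b)"
    then obtain e' where e': "typed e' a b" "y = cls a b e'" unfolding carrier_presented by blast
    show "?F a b (x \<oplus>\<^bsub>Hom ?P a b\<^esub> y) = ?F a b x \<oplus>\<^bsub>Hom ?O (id a) (id b)\<^esub> ?F a b y"
      using has_type.intros(6)[OF e(1) e'(1)]
      by (simp add: e e' presented_add OB_functor_cls) (simp add: OB_def free_module_def)
  qed
  show "?F a a (Idm ?P a) = Idm ?O (id a)"
    using OB_functor_cls[OF has_type.intros(2), of a] by (simp add: presented_simps) (simp add: OB_def)
  show "?F a c (Cmp ?P a b c g f) = Cmp ?O (id a) (id b) (id c) (?F b c g) (?F a b f)"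
    if "f \<in> carrier (Hom ?P a b)" "g \<in> carrier (Hom ?P b c)"
  proof -
    obtain e e' where e: "typed e a b" "f = cls a b e" "typed e' b c" "g = cls b c e'"
      using \<open>f \<in> _\<close> \<open>g \<in> _\<close> unfolding carrier_presented by blast
    show ?thesis
      using has_type.intros(3)[OF e(3,1)]
      by (simp add: e presented_Cmp OB_functor_cls) (simp add: OB_def)
  qed
  show "?F (TenO ?P a a') (TenO ?P b b') (TenM ?P a b a' b' f g) =
      TenM ?O (id a) (id b) (id a') (id b') (?F a b f) (?F a' b' g)"
    if "f \<in> carrier (Hom ?P a b)" "g \<in> carrier (Hom ?P a' b')"
  proof -
    obtain e e' where e: "typed e a b" "f = cls a b e" "typed e' a' b'" "g = cls a' b' e'"
      using \<open>f \<in> _\<close> \<open>g \<in> _\<close> unfolding carrier_presented by blast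
    show ?thesis
      using has_type.intros(4)[OF e(1,3)] typed_src_tgt[OF e(1)]
      by (simp add: e presented_TenM presented_simps OB_functor_cls) (simp add: OB_def)
  qed
  show "bij_betw (?F a b) (carrier (Hom ?P a b)) (carrier (Hom ?O (id a) (id b)))"
    unfolding bij_betw_def
  proof
    show "inj_on (?F a b) (carrier (Hom ?P a b))"
    proof (rule inj_onI)
      fix x y assume "x \<in> carrier (Hom ?P a b)" "y \<in> carrier (Hom ?P a b)" and eq: "?F a b x = ?F a b y"
      then obtain e e' where e: "typed e a b" "x = cls a b e" "typed e' a b" "y = cls a b e'"
        unfolding carrier_presented by blast
      \<comment> \<open>Equality of the images is moved to \<open>mor\<close>, where faithfulness is
        available, and then back to derivability.\<close>
      then have "abs_mor e = abs_mor e'"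
        using eq by (intro evm_faithful[of _ a b]) (simp_all add: arr_abs_mor evm_abs OB_functor_cls)
      then have "OB_eqv a b e e'"
        using e(1) by (simp add: mor.abs_eq_iff same_mor_def)
      then show "x = y" unfolding e by (rule eqv_class_eqI)
    qed
    show "?F a b ` carrier (Hom ?P a b) = carrier (Hom ?O (id a) (id b))"
    proof (intro equalityI subsetI)
      fix p assume "p \<in> carrier (Hom ?O (id a) (id b))"
      then obtain m :: "'k mor" where m: "arr m a b" "evm m = p"
        using evm_full[of p a b] by (auto simp: carrier_OB)
      obtain e where e: "m = abs_mor e" "typed e a b" using mor_cases[OF m(1)] by blast
      then have "?F a b (cls a b e) = p" using m(2) by (simp add: OB_functor_cls evm_abs)
      then show "p \<in> ?F a b ` carrier (Hom ?P a b)" using e(2) carrier_presented by blast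
    next
      fix p assume "p \<in> ?F a b ` carrier (Hom ?P a b)"
      then obtain x where x: "x \<in> carrier (Hom ?P a b)" "p = ?F a b x" by blast
      then obtain e where "typed e a b" "x = cls a b e" unfolding carrier_presented by blast
      then show "p \<in> carrier (Hom ?O (id a) (id b))"
        using F_in x(2) by simp
    qed
  qed
qed (simp_all add: presented_simps OB_def)

theorem theorem1p1:
  "strict_linear_monoidal_category (OB :: (letter list, diagram \<Rightarrow>\<^sub>0 'k::idom, 'k) lmcat) \<and>
   (\<exists>F. strict_linear_monoidal_isomorphism
          (OB_presented :: (letter list, (letter, generator, 'k) expr set, 'k) lmcat) OB id F \<and>
        F [] [\<up>, \<down>] (generator_class Gc) = cup \<and>
        F [\<down>, \<up>] [] (generator_class Gd) = cap \<and>
        F [\<up>, \<up>] [\<up>, \<up>] (generator_class Gs) = crossing)"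
proof (intro conjI exI[of _ OB_functor])
  show "strict_linear_monoidal_category (OB :: (letter list, diagram \<Rightarrow>\<^sub>0 'k::idom, 'k) lmcat)"
    by (rule OB_category)
  show "strict_linear_monoidal_isomorphism
      (OB_presented :: (letter list, (letter, generator, 'k) expr set, 'k) lmcat) OB id OB_functor"
    by (rule OB_functor_isomorphism)
  show "OB_functor [] [\<up>, \<down>] (generator_class Gc) = cup" "OB_functor [\<down>, \<up>] [] (generator_class Gd) = cap"
    "OB_functor [\<up>, \<up>] [\<up>, \<up>] (generator_class Gs) = crossing"
    by (simp_all add: generator_class_def OB_functor_cls has_type.intros(1) gen_diagram.simps
        cup_def cap_def crossing_def)
qed

end
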